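(* Fix an agent $i\in\{1,\dots,N\}$, non-negative weights $b=(b_{jl})_{1\le j,l\le N}$, and $\varepsilon>0$ (with $\mathcal N_i^\varepsilon(2b)\ge1$, so that the following weights are defined). Set $\lambda_j=\mathbf 1_{\{b_{ij}\le\varepsilon/2\}}/\mathcal N_i^{\varepsilon}(2b)$ for $1\le j\le N$, and generate $(x^k)_{k\ge0}$ by the weighted gradient averaging recursion $x^{k+1}=x^k-\eta\sum_{j=1}^N\lambda_jG^k(x^k)_j$. 1. (Asynchronous oracle, convex case.) Assume every $f_j$ is convex with $\mathbb E\|g_j^k(x)\|^2\le B^2$ for all $x\in\mathbb R^d$ and all $k$. Assume that for some $D>0$, $\|x^k-x_j^\star\|\le D$ for all $k\ge0$ and all $j$, and that $\|\mathbb E[g_j^k(x)]-\mathbb E[g_l^k(x)]\|^2\le(b_{jl}/D)^2$ for all $j,l,x,k$. Then, with $K=T_\varepsilon(i)$ and $\eta=\sqrt{\frac{D^2}{2KNB^2\sum_{j=1}^N\lambda_j^2}}$, one has $\mathbb E\big[\frac1K\sum_{0\le k<K}f_i(x^k)-f_i(x_i^\star)\big]\le\varepsilon$ using a total number $T_\varepsilon(i)$ of stochastic gradients from all agents satisfying $$T_\varepsilon(i)\le\frac{4D^2B^2}{\varepsilon^2}\,\frac{N}{\mathcal N_i^\varepsilon(2b)}.$$ 2. (Synchronous oracle, strongly convex and smooth case.) Assume every $f_j$ is $\mu$-strongly convex and $L$-smooth, write $\kappa=L/\mu$, and assume $\mathbb E\|g_j^k(x)-\nabla f_j(x)\|^2\le\sigma^2$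 for all $j,x,k$. Assume that one of the following holds with $\tilde b=\mu b$: (i) $\|\nabla f_j(x)-\nabla f_l(x)\|^2\le\tilde b_{jl}$ for all $j,l,x$; or (ii) for some $m\ge0$ (any value of $m\ge0$ is allowed), for every $j$, every stochastic vector $\lambda'\in\mathbb R^N$ and every $x\in\mathbb R^d$, writing $g_{\lambda'}(x)=\sum_l\lambda'_l\nabla f_l(x)$, one has $\|\nabla f_j(x)-g_{\lambda'}(x)\|^2\le m\|g_{\lambda'}(x)\|^2+\sum_l\lambda'_l\tilde b_{jl}$. Then, with $K=T_\varepsilon(i)/N$ and $\eta=\min\Big(\frac1{2L},\ \frac1{\mu K}\ln\Big(\frac{F_\lambda^0\mu^2K}{L\sigma^2\sum_j\lambda_j^2}\Big)\Big)$, where $F_\lambda^0=\sum_j\lambda_j(f_j(x^0)-f_j(x_j^\star))$, one has $\mathbb E[f_i(x^K)-f_i(x_i^\star)]\le\varepsilon$ using a total number $T_\varepsilon(i)$ of stochastic gradients from all agents satisfying $$T_\varepsilon(i)\le\tilde{\mathcal O}\left(\frac{\kappa\sigma^2}{\mu\varepsilon}\,\frac{N}{\mathcal N_i^\varepsilon(2b)}\right).$$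
   Context: There are $N$ agents; agent $j$ has a function $f_j:\mathbb R^d\to\mathbb R$ that has a minimizer $x_j^\star$ over $\mathbb R^d$. At every iteration $k$, $g_j^k(\cdot)$ is an unbiased stochastic (sub)gradient: $\mathbb E[g_j^k(x)]\in\partial f_j(x)$ for all $x$ (equal to $\nabla f_j(x)$ in the differentiable case); the $g_j^k$ are i.i.d. over $k$ for each $j$, and independent across agents and iterations. Oracles. Asynchronous oracle: at iteration $k$ one agent $i_k$, sampled uniformly at random in $\{1,\dots,N\}$, samples a stochastic gradient; $G^k(x)_j=N\mathbf 1_{\{j=i_k\}}g_{i_k}^k(x)$; $K$ iterations use $K$ stochastic gradients in total. Synchronous oracle: every agent samples a stochastic gradient at each iteration; $G^k(x)_j=g_j^k(x)$; $K$ iterations use $NK$ stochastic gradients in total. For $c>0$, $\mathcal N_i^\varepsilon(cb)=\sum_{j=1}^N\mathbf 1_{\{c\,b_{ij}\le\varepsilon\}}$. A stochastic vector has non-negative entries summing to $1$. $\tilde{\mathcal O}$ hides constants and logarithmic factors, in the regime where $\varepsilon$ is small enough that the exponentially decaying optimization term is dominated by the statistical (noise) term.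
   Formalization: In part 1 the bound on T_ε(i) is max(1, 4D²B²N/(ε²N_i^ε(2b))), since a bound below 1 would force K=0, where the average and η are undefined; in part 2 the small-ε regime is made explicit as ε ≤ F_λ^0/κ and ε ≤ σ²/(μN_i^ε(2b)). *)

theory Defs
  imports "HOL-Probability.Probability"
begin

definition gradient :: "('a::euclidean_space \<Rightarrow> real) \<Rightarrow> 'a \<Rightarrow> 'a" where
  "gradient f x = (THE D. GDERIV f x :> D)"

definition subdifferential :: "('a::euclidean_space \<Rightarrow> real) \<Rightarrow> 'a \<Rightarrow> 'a set" where
  "subdifferential f x = {v. \<forall>y. f x + v \<bullet> (y - x) \<le> f y}"

definition strongly_convex :: "real \<Rightarrow> ('a::euclidean_space \<Rightarrow> real) \<Rightarrow> bool" where
  "strongly_convex \<mu> f \<longleftrightarrow>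
     (\<forall>x y. \<forall>t\<in>{0..1}. f (t *\<^sub>R x + (1 - t) *\<^sub>R y)
        \<le> t * f x + (1 - t) * f y - \<mu> / 2 * t * (1 - t) * (norm (x - y))\<^sup>2)"

definition L_smooth :: "real \<Rightarrow> ('a::euclidean_space \<Rightarrow> real) \<Rightarrow> bool" where
  "L_smooth L f \<longleftrightarrow> (\<forall>x. \<exists>D. GDERIV f x :> D) \<and>
     (\<forall>x y. norm (gradient f x - gradient f y) \<le> L * norm (x - y))"

definition stochastic_vector :: "('n::finite \<Rightarrow> real) \<Rightarrow> bool" where
  "stochastic_vector w \<longleftrightarrow> (\<forall>l. 0 \<le> w l) \<and> (\<Sum>l\<in>UNIV. w l) = 1"

(* The expectation of h exists and is at most c. The Bochner integral of a non-integrable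
   function is 0, so the bound alone would not express this. *)
definition mean_le :: "'w measure \<Rightarrow> ('w \<Rightarrow> real) \<Rightarrow> real \<Rightarrow> bool" where
  "mean_le M h c \<longleftrightarrow> integrable M h \<and> (\<integral>\<omega>. h \<omega> \<partial>M) \<le> c"

(* The agents are the elements of a finite type 'n, so N = CARD('n).
   The random function g_j^k is modelled as \<gamma> j (\<xi> j k \<omega>), where \<xi> j k is a random seed with
   values in S j and \<gamma> j is jointly measurable in seed and point; joint measurability is what
   makes evaluation of g_j^k at a random point meaningful. The seeds are independent over all
   (j, k) and, for each j, identically distributed over k. *)
definition iid_seeds ::
  "'w measure \<Rightarrow> ('n::finite \<Rightarrow> 's measure) \<Rightarrow> ('n \<Rightarrow> nat \<Rightarrow> 'w \<Rightarrow> 's) \<Rightarrow> bool" where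
  "iid_seeds M S \<xi> \<longleftrightarrow>
     prob_space.indep_vars M (\<lambda>(j, k). S j) (\<lambda>(j, k). \<xi> j k) UNIV \<and>
     (\<forall>j k. distr M (S j) (\<xi> j k) = distr M (S j) (\<xi> j 0))"

definition stoch_grad ::
  "('n \<Rightarrow> 's \<Rightarrow> 'a \<Rightarrow> 'a) \<Rightarrow> ('n \<Rightarrow> nat \<Rightarrow> 'w \<Rightarrow> 's) \<Rightarrow> 'n \<Rightarrow> nat \<Rightarrow> 'a \<Rightarrow> 'w \<Rightarrow> 'a" where
  "stoch_grad \<gamma> \<xi> j k x \<omega> = \<gamma> j (\<xi> j k \<omega>) x"

(* I k is the agent drawn at iteration k: uniform, independent over k, and the whole sequence
   of draws is independent of the family of all seeds. *)
definition uniform_agents ::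
  "'w measure \<Rightarrow> ('n::finite \<Rightarrow> 's measure) \<Rightarrow> ('n \<Rightarrow> nat \<Rightarrow> 'w \<Rightarrow> 's) \<Rightarrow> (nat \<Rightarrow> 'w \<Rightarrow> 'n) \<Rightarrow> bool" where
  "uniform_agents M S \<xi> I \<longleftrightarrow>
     (\<forall>k j. measure M {\<omega> \<in> space M. I k \<omega> = j} = 1 / real CARD('n)) \<and>
     prob_space.indep_vars M (\<lambda>_. count_space UNIV) I UNIV \<and>
     prob_space.indep_set M
       (sets (vimage_algebra (space M) (\<lambda>\<omega> k. I k \<omega>) (\<Pi>\<^sub>M k\<in>UNIV. count_space UNIV)))
       (sets (vimage_algebra (space M) (\<lambda>\<omega> (j, k). \<xi> j k \<omega>) (\<Pi>\<^sub>M (j, k)\<in>UNIV. S j)))"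

(* An oracle G maps (k, x, \<omega>, j) to the j-th block of G^k(x). One iteration costs one stochastic
   gradient with the asynchronous oracle and N with the synchronous one. *)
definition async_oracle ::
  "('n::finite \<Rightarrow> nat \<Rightarrow> 'a::euclidean_space \<Rightarrow> 'w \<Rightarrow> 'a) \<Rightarrow> (nat \<Rightarrow> 'w \<Rightarrow> 'n)
    \<Rightarrow> nat \<Rightarrow> 'a \<Rightarrow> 'w \<Rightarrow> 'n \<Rightarrow> 'a" where
  "async_oracle g I k x \<omega> j = (if j = I k \<omega> then real CARD('n) *\<^sub>R g j k x \<omega> else 0)"

definition sync_oracle ::
  "('n::finite \<Rightarrow> nat \<Rightarrow> 'a::euclidean_space \<Rightarrow> 'w \<Rightarrow> 'a) \<Rightarrow> nat \<Rightarrow> 'a \<Rightarrow> 'w \<Rightarrow> 'n \<Rightarrow> 'a" where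
  "sync_oracle g k x \<omega> j = g j k x \<omega>"

primrec wga :: "(nat \<Rightarrow> 'a::euclidean_space \<Rightarrow> 'w \<Rightarrow> 'n::finite \<Rightarrow> 'a) \<Rightarrow> ('n \<Rightarrow> real) \<Rightarrow> real \<Rightarrow> 'a
    \<Rightarrow> nat \<Rightarrow> 'w \<Rightarrow> 'a" where
  "wga G w \<eta> x0 0 \<omega> = x0"
| "wga G w \<eta> x0 (Suc k) \<omega> =
     wga G w \<eta> x0 k \<omega> - \<eta> *\<^sub>R (\<Sum>j\<in>UNIV. w j *\<^sub>R G k (wga G w \<eta> x0 k \<omega>) \<omega> j)"

definition num_close :: "real \<Rightarrow> ('n::finite \<Rightarrow> 'n \<Rightarrow> real) \<Rightarrow> 'n \<Rightarrow> nat" where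
  "num_close \<epsilon> b i = (\<Sum>j\<in>UNIV. of_bool (b i j \<le> \<epsilon>))"

definition collab_weight :: "real \<Rightarrow> ('n::finite \<Rightarrow> 'n \<Rightarrow> real) \<Rightarrow> 'n \<Rightarrow> 'n \<Rightarrow> real" where
  "collab_weight \<epsilon> b i j =
     of_bool (b i j \<le> \<epsilon> / 2) / real (num_close \<epsilon> (\<lambda>p q. 2 * b p q) i)"

end

theory Submission
  imports Defs
begin

text \<open>
Both guarantees rest on one trade-off. The weights spread the step over the agents whose gradients
nearly agree with those of agent \<open>i\<close>. In the mean the iteration therefore follows a gradient of
\<open>F = (\<Sum>j. lam j * f j)\<close>, while the randomness of different agents is uncorrelated, so that the
second moment of the step carries the factor \<open>(\<Sum>j. (lam j)^2) = 1 / Ni\<close>. The price is the bias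
between \<open>F\<close> and \<open>f i\<close>, which the choice of the agents keeps at the order of \<open>\<epsilon>\<close>. Each step
uses randomness that is independent of the iterates computed so far. By Fubini's theorem
(\<open>second_moment_at_independent_point\<close>, \<open>unbiased_at_independent_point\<close>), properties of the
stochastic gradients at fixed points thus carry over to the iterates.

For the asynchronous oracle, the difference \<open>f i - F\<close> is Lipschitz with constant \<open>\<epsilon> / (2 * D)\<close>
(\<open>convex_difference_Lipschitz\<close>). Regret against the fixed point \<open>xstar i\<close> alone does not suffice:
with the prescribed step size, the initial distance contributes \<open>sqrt 2 / 4 * \<epsilon>\<close>, the noise
\<open>sqrt 2 / 8 * \<epsilon>\<close> and the bias \<open>\<epsilon> / 2\<close>, which is more than \<open>\<epsilon>\<close> even before rounding \<open>K\<close>.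
These worst cases exclude each other. The initial distance is used up only if the last iterate is
close to \<open>xstar i\<close>, whereas the bias is \<open>\<epsilon> / 2\<close> only if almost all iterates are at distance \<open>D\<close> from
\<open>xstar i\<close>. Regret against every earlier iterate \<open>x a\<close> excludes that the iterates first linger at
distance \<open>D\<close> and then collect all of the regret in a short final phase: after time \<open>a\<close> the values
of \<open>F\<close> cannot on average exceed the value at \<open>x a\<close> by more than the noise, and by still less if the
last iterate is far from \<open>x a\<close>. Averaging the inequalities over all \<open>a\<close> bounds the mean squared
distance to \<open>xstar i\<close>, hence the bias, and the sum of the three contributions is then at most
\<open>\<epsilon>\<close> (\<open>async_regret_arithmetic\<close>, \<open>async_collaboration\<close>).

For the synchronous oracle, let \<open>z\<close> minimize \<open>F\<close>. The weighted gradient vanishes at \<open>z\<close>, so either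
closeness condition gives \<open>(norm (gradient (f i) z))^2 \<le> \<mu> * \<epsilon> / 2\<close>; in the second one the term with
\<open>m\<close> is zero there. Then \<open>f i x\<close> exceeds the minimum of \<open>f i\<close> by at most
\<open>\<epsilon> / 2 + L * (norm (x - z))^2\<close> (\<open>suboptimality_near_almost_stationary_point\<close>), and only the
mean squared distance of the iterates to \<open>z\<close> remains to be bounded. Following distances instead of
function values keeps the noise term linear in the condition number \<open>\<kappa>\<close>. The initial distance is
bounded only by \<open>2 * F0 / \<mu>\<close>, which costs a factor \<open>\<kappa>\<close> that does not appear in the logarithm of the
step size; it is absorbed because the squared distance contracts by nearly \<open>1 - 2 * \<eta> * \<mu>\<close> per step
(\<open>gradient_step_contraction\<close>, \<open>sync_budget_arithmetic\<close>).
\<close>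

section \<open>Randomness at independent points\<close>

text \<open>Independence is expressed by the joint law, which allows different value types and is the form in
which Fubini's theorem applies.\<close>

definition independent_pair :: "'w measure \<Rightarrow> 'a measure \<Rightarrow> ('w \<Rightarrow> 'a) \<Rightarrow> 'b measure \<Rightarrow> ('w \<Rightarrow> 'b) \<Rightarrow> bool" where
  "independent_pair M A X B Y \<longleftrightarrow> X \<in> measurable M A \<and> Y \<in> measurable M B \<and>
     distr M A X \<Otimes>\<^sub>M distr M B Y = distr M (A \<Otimes>\<^sub>M B) (\<lambda>\<omega>. (X \<omega>, Y \<omega>))"

text \<open>The sigma-algebra generated by all sources but \<open>p\<close> is independent of source \<open>p\<close>, because
independence of intersection-stable generators passes to the sigma-algebras of disjoint groups.\<close>

lemma (in prob_space) independent_pair_of_rest: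
  assumes ind: "indep_sets E UNIV" and st: "\<And>q. Int_stable (E q)"
    and X: "X \<in> measurable (sigma (space M) (\<Union>q\<in>-{p}. E q)) A"
    and Y: "Y \<in> measurable M B" "\<And>C. C \<in> sets B \<Longrightarrow> Y -` C \<inter> space M \<in> E p"
  shows "independent_pair M A X B Y"
proof -
  have ev: "E q \<subseteq> events" for q
    using ind by (auto simp: indep_sets_def)
  have sub: "(\<Union>q\<in>-{p}. E q) \<subseteq> Pow (space M)"
    using ev sets.sets_into_space by blast
  let ?J = "case_bool (-{p}) {p}"
  have "indep_sets (\<lambda>c. sigma_sets (space M) (\<Union>q\<in>?J c. E q)) (UNIV :: bool set)"
  proof (rule indep_sets_collect_sigma)
    show "indep_sets E (\<Union>c\<in>UNIV. ?J c)"
      by (rule indep_sets_mono_index[OF _ ind]) simp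
    show "disjoint_family_on ?J UNIV"
      by (simp add: disjoint_family_on_def all_bool_eq)
    show "Int_stable (E q)" for q by (rule st)
  qed
  moreover have "(\<lambda>c. sigma_sets (space M) (\<Union>q\<in>?J c. E q))
      = case_bool (sigma_sets (space M) (\<Union>q\<in>-{p}. E q)) (sigma_sets (space M) (E p))"
    by (rule ext) (simp split: bool.split)
  ultimately have rest: "indep_set (sigma_sets (space M) (\<Union>q\<in>-{p}. E q)) (sigma_sets (space M) (E p))"
    unfolding indep_set_def by simp
  have XE: "X -` C \<inter> space M \<in> sigma_sets (space M) (\<Union>q\<in>-{p}. E q)" if "C \<in> sets A" for C
    using measurable_sets[OF X that] sub by (simp add: sets_measure_of space_measure_of)
  have XM: "X \<in> measurable M A"
  proof (rule measurableI)
    show "X x \<in> space A" if "x \<in> space M" for x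
      using measurable_space[OF X] that sub by (simp add: space_measure_of)
    have "sigma_sets (space M) (\<Union>q\<in>-{p}. E q) \<subseteq> events"
      using ev by (intro sets.sigma_sets_subset) auto
    then show "X -` C \<inter> space M \<in> events" if "C \<in> sets A" for C
      using XE[OF that] by auto
  qed
  note [measurable] = XM Y(1)
  interpret X: prob_space "distr M A X" by (rule prob_space_distr) simp
  interpret Y: prob_space "distr M B Y" by (rule prob_space_distr) simp
  have "distr M A X \<Otimes>\<^sub>M distr M B Y = distr M (A \<Otimes>\<^sub>M B) (\<lambda>\<omega>. (X \<omega>, Y \<omega>))"
  proof (rule pair_measure_eqI)
    show "sigma_finite_measure (distr M A X)" "sigma_finite_measure (distr M B Y)" by unfold_locales
    show "sets (distr M A X \<Otimes>\<^sub>M distr M B Y) = sets (distr M (A \<Otimes>\<^sub>M B) (\<lambda>\<omega>. (X \<omega>, Y \<omega>)))"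
      by simp
    fix C D assume "C \<in> sets (distr M A X)" "D \<in> sets (distr M B Y)"
    then have CD[measurable]: "C \<in> sets A" "D \<in> sets B" by auto
    have "prob ((X -` C \<inter> space M) \<inter> (Y -` D \<inter> space M)) = prob (X -` C \<inter> space M) * prob (Y -` D \<inter> space M)"
      using indep_setD[OF rest XE[OF CD(1)] sigma_sets.Basic[OF Y(2)[OF CD(2)]]] .
    moreover have "(\<lambda>\<omega>. (X \<omega>, Y \<omega>)) -` (C \<times> D) \<inter> space M = (X -` C \<inter> space M) \<inter> (Y -` D \<inter> space M)"
      by auto
    ultimately show "emeasure (distr M A X) C * emeasure (distr M B Y) D
        = emeasure (distr M (A \<Otimes>\<^sub>M B) (\<lambda>\<omega>. (X \<omega>, Y \<omega>))) (C \<times> D)"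
      by (simp add: emeasure_distr emeasure_eq_measure ennreal_mult)
  qed
  then show ?thesis
    unfolding independent_pair_def using XM Y(1) by simp
qed

lemma (in prob_space) independent_pair_nn_integral_iterated:
  assumes "independent_pair M A X B Y" and [measurable]: "\<phi> \<in> borel_measurable (A \<Otimes>\<^sub>M B)"
  shows "(\<integral>\<^sup>+\<omega>. \<phi> (X \<omega>, Y \<omega>) \<partial>M) = (\<integral>\<^sup>+\<omega>. (\<integral>\<^sup>+\<omega>'. \<phi> (X \<omega>, Y \<omega>') \<partial>M) \<partial>M)"
proof -
  have [measurable]: "X \<in> measurable M A" "Y \<in> measurable M B"
    and D: "distr M A X \<Otimes>\<^sub>M distr M B Y = distr M (A \<Otimes>\<^sub>M B) (\<lambda>x. (X x, Y x))"
    using assms(1) unfolding independent_pair_def by auto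
  interpret Y: prob_space "distr M B Y" by (rule prob_space_distr) simp
  have "(\<integral>\<^sup>+\<omega>. \<phi> (X \<omega>, Y \<omega>) \<partial>M) = (\<integral>\<^sup>+p. \<phi> p \<partial>(distr M A X \<Otimes>\<^sub>M distr M B Y))"
    unfolding D by (subst nn_integral_distr) auto
  also have "\<dots> = (\<integral>\<^sup>+x. \<integral>\<^sup>+y. \<phi> (x, y) \<partial>distr M B Y \<partial>distr M A X)"
    by (subst Y.nn_integral_fst[symmetric]) auto
  also have "\<dots> = (\<integral>\<^sup>+\<omega>. (\<integral>\<^sup>+\<omega>'. \<phi> (X \<omega>, Y \<omega>') \<partial>M) \<partial>M)"
  proof -
    have "(\<lambda>x. \<integral>\<^sup>+y. \<phi> (x, y) \<partial>distr M B Y) \<in> borel_measurable A"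
      by measurable
    then show ?thesis
      using measurable_space[OF \<open>X \<in> measurable M A\<close>]
      by (subst nn_integral_distr) (auto intro!: nn_integral_cong nn_integral_distr measurable_Pair2[OF assms(2)])
  qed
  finally show ?thesis .
qed

lemma (in prob_space) independent_pair_integral_iterated:
  fixes \<phi> :: "_ \<Rightarrow> 'b::{banach, second_countable_topology}"
  assumes "independent_pair M A X B Y" and [measurable]: "\<phi> \<in> borel_measurable (A \<Otimes>\<^sub>M B)"
    and int: "integrable M (\<lambda>\<omega>. \<phi> (X \<omega>, Y \<omega>))"
  shows "integrable M (\<lambda>\<omega>. \<integral>\<omega>'. \<phi> (X \<omega>, Y \<omega>') \<partial>M)"
    and "(\<integral>\<omega>. \<phi> (X \<omega>, Y \<omega>) \<partial>M) = (\<integral>\<omega>. (\<integral>\<omega>'. \<phi> (X \<omega>, Y \<omega>') \<partial>M) \<partial>M)"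
proof -
  have [measurable]: "X \<in> measurable M A" "Y \<in> measurable M B"
    and D: "distr M A X \<Otimes>\<^sub>M distr M B Y = distr M (A \<Otimes>\<^sub>M B) (\<lambda>x. (X x, Y x))"
    using assms(1) unfolding independent_pair_def by auto
  interpret X: prob_space "distr M A X" by (rule prob_space_distr) simp
  interpret Y: prob_space "distr M B Y" by (rule prob_space_distr) simp
  interpret XY: pair_sigma_finite "distr M A X" "distr M B Y" ..
  have meas: "(\<lambda>x. \<integral>y. \<phi> (x, y) \<partial>distr M B Y) \<in> borel_measurable A"
    by measurable
  have inner: "(\<integral>y. \<phi> (X \<omega>, y) \<partial>distr M B Y) = (\<integral>\<omega>'. \<phi> (X \<omega>, Y \<omega>') \<partial>M)" if "\<omega> \<in> space M" for \<omega>
    using that by (subst integral_distr) (auto dest: measurable_space)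
  have I: "integrable (distr M A X \<Otimes>\<^sub>M distr M B Y) \<phi>"
    unfolding D using int by (subst integrable_distr_eq) auto
  have J: "integrable (distr M A X) (\<lambda>x. \<integral>y. \<phi> (x, y) \<partial>distr M B Y)"
    using XY.integrable_fst'[OF I] .
  then have "integrable M (\<lambda>\<omega>. \<integral>y. \<phi> (X \<omega>, y) \<partial>distr M B Y)"
    using meas by (subst (asm) integrable_distr_eq) auto
  then show "integrable M (\<lambda>\<omega>. \<integral>\<omega>'. \<phi> (X \<omega>, Y \<omega>') \<partial>M)"
    by (rule Bochner_Integration.integrable_cong[THEN iffD1, rotated 2]) (auto simp: inner)
  have "(\<integral>\<omega>. \<phi> (X \<omega>, Y \<omega>) \<partial>M) = (\<integral>p. \<phi> p \<partial>(distr M A X \<Otimes>\<^sub>M distr M B Y))"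
    unfolding D by (subst integral_distr) auto
  also have "\<dots> = (\<integral>x. \<integral>y. \<phi> (x, y) \<partial>distr M B Y \<partial>distr M A X)"
    using XY.integral_fst'[OF I] by simp
  also have "\<dots> = (\<integral>\<omega>. \<integral>y. \<phi> (X \<omega>, y) \<partial>distr M B Y \<partial>M)"
    using meas by (subst integral_distr) auto
  also have "\<dots> = (\<integral>\<omega>. (\<integral>\<omega>'. \<phi> (X \<omega>, Y \<omega>') \<partial>M) \<partial>M)"
    by (intro Bochner_Integration.integral_cong) (auto simp: inner)
  finally show "(\<integral>\<omega>. \<phi> (X \<omega>, Y \<omega>) \<partial>M) = (\<integral>\<omega>. (\<integral>\<omega>'. \<phi> (X \<omega>, Y \<omega>') \<partial>M) \<partial>M)" .
qed

text \<open>Conditionally on \<open>X\<close> the point is fixed, so the uniform bound applies and is then averaged. The centre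
\<open>c\<close> is \<open>0\<close> for raw second moments and the gradient for variances.\<close>

lemma (in prob_space) second_moment_at_independent_point:
  fixes c :: "'b::euclidean_space \<Rightarrow> 'b"
  assumes ind: "independent_pair M (borel :: 'b measure) X S \<zeta>"
    and [measurable]: "(\<lambda>(s, x). \<gamma> s x) \<in> borel_measurable (S \<Otimes>\<^sub>M borel)" "c \<in> borel_measurable borel"
    and le: "\<And>x. mean_le M (\<lambda>\<omega>. (norm (\<gamma> (\<zeta> \<omega>) x - c x))\<^sup>2) v"
  shows "mean_le M (\<lambda>\<omega>. (norm (\<gamma> (\<zeta> \<omega>) (X \<omega>) - c (X \<omega>)))\<^sup>2) v"
proof -
  have [measurable]: "X \<in> borel_measurable M" "\<zeta> \<in> measurable M S"
    using ind unfolding independent_pair_def by auto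
  have inner: "(\<integral>\<^sup>+\<omega>'. ennreal ((norm (\<gamma> (\<zeta> \<omega>') x - c x))\<^sup>2) \<partial>M) \<le> ennreal v" for x
    using le[of x] by (subst nn_integral_eq_integral) (auto simp: mean_le_def intro: ennreal_leI)
  have v: "0 \<le> v"
    using le[of 0] order_trans[OF Bochner_Integration.integral_nonneg, of M "\<lambda>\<omega>. (norm (\<gamma> (\<zeta> \<omega>) 0 - c 0))\<^sup>2" v]
    unfolding mean_le_def by simp
  have "(\<integral>\<^sup>+\<omega>. ennreal ((norm (\<gamma> (\<zeta> \<omega>) (X \<omega>) - c (X \<omega>)))\<^sup>2) \<partial>M)
      = (\<integral>\<^sup>+\<omega>. (\<integral>\<^sup>+\<omega>'. ennreal ((norm (\<gamma> (\<zeta> \<omega>') (X \<omega>) - c (X \<omega>)))\<^sup>2) \<partial>M) \<partial>M)"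
    using independent_pair_nn_integral_iterated[OF ind, of "\<lambda>(x, s). ennreal ((norm (\<gamma> s x - c x))\<^sup>2)"]
    by simp
  also have "\<dots> \<le> (\<integral>\<^sup>+\<omega>. ennreal v \<partial>M)"
    by (intro nn_integral_mono inner)
  also have "\<dots> = ennreal v" by (simp add: emeasure_space_1)
  finally have fin: "(\<integral>\<^sup>+\<omega>. ennreal ((norm (\<gamma> (\<zeta> \<omega>) (X \<omega>) - c (X \<omega>)))\<^sup>2) \<partial>M) \<le> ennreal v" .
  have int: "integrable M (\<lambda>\<omega>. (norm (\<gamma> (\<zeta> \<omega>) (X \<omega>) - c (X \<omega>)))\<^sup>2)"
    using fin by (intro integrableI_nonneg) (auto intro: le_less_trans)
  moreover have "(\<integral>\<omega>. (norm (\<gamma> (\<zeta> \<omega>) (X \<omega>) - c (X \<omega>)))\<^sup>2 \<partial>M) \<le> v"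
    using fin int v by (subst (asm) nn_integral_eq_integral) auto
  ultimately show ?thesis unfolding mean_le_def by simp
qed

text \<open>The test vector \<open>V\<close> may be as random as the point. Displacements from a comparator, and the noise of
another agent at the same iteration, are test vectors of this kind.\<close>

lemma (in prob_space) unbiased_at_independent_point:
  fixes V :: "'a \<Rightarrow> 'b::euclidean_space"
  assumes ind: "independent_pair M (borel :: ('b \<times> 'b) measure) (\<lambda>\<omega>. (X \<omega>, V \<omega>)) S \<zeta>"
    and [measurable]: "(\<lambda>(s, x). \<gamma> s x) \<in> borel_measurable (S \<Otimes>\<^sub>M borel)"
    and mean: "\<And>x. integrable M (\<lambda>\<omega>. \<gamma> (\<zeta> \<omega>) x)"
    and int: "integrable M (\<lambda>\<omega>. \<gamma> (\<zeta> \<omega>) (X \<omega>) \<bullet> V \<omega>)"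
  shows "integrable M (\<lambda>\<omega>. (\<integral>\<omega>'. \<gamma> (\<zeta> \<omega>') (X \<omega>) \<partial>M) \<bullet> V \<omega>)"
    and "(\<integral>\<omega>. \<gamma> (\<zeta> \<omega>) (X \<omega>) \<bullet> V \<omega> \<partial>M) = (\<integral>\<omega>. (\<integral>\<omega>'. \<gamma> (\<zeta> \<omega>') (X \<omega>) \<partial>M) \<bullet> V \<omega> \<partial>M)"
proof -
  let ?\<phi> = "\<lambda>p. \<gamma> (snd p) (fst (fst p)) \<bullet> snd (fst p)"
  have m: "?\<phi> \<in> borel_measurable (borel \<Otimes>\<^sub>M S)"
    unfolding borel_prod[symmetric] by measurable
  have eq: "(\<integral>\<omega>'. \<gamma> (\<zeta> \<omega>') x \<bullet> v \<partial>M) = (\<integral>\<omega>'. \<gamma> (\<zeta> \<omega>') x \<partial>M) \<bullet> v" for x v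
    using mean[of x] by simp
  show "integrable M (\<lambda>\<omega>. (\<integral>\<omega>'. \<gamma> (\<zeta> \<omega>') (X \<omega>) \<partial>M) \<bullet> V \<omega>)"
    using independent_pair_integral_iterated(1)[OF ind m] int by (simp add: eq)
  show "(\<integral>\<omega>. \<gamma> (\<zeta> \<omega>) (X \<omega>) \<bullet> V \<omega> \<partial>M) = (\<integral>\<omega>. (\<integral>\<omega>'. \<gamma> (\<zeta> \<omega>') (X \<omega>) \<partial>M) \<bullet> V \<omega> \<partial>M)"
    using independent_pair_integral_iterated(2)[OF ind m] int by (simp add: eq)
qed

section \<open>Independence of the seeds and the drawn agents\<close>

definition preimage_events :: "'w measure \<Rightarrow> 's measure \<Rightarrow> ('w \<Rightarrow> 's) \<Rightarrow> 'w set set" where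
  "preimage_events M A X = {X -` C \<inter> space M |C. C \<in> sets A}"

lemma Int_stable_preimage_events: "Int_stable (preimage_events M A X)"
proof (rule Int_stableI)
  fix P Q assume "P \<in> preimage_events M A X" "Q \<in> preimage_events M A X"
  then obtain C D where "P = X -` C \<inter> space M" "Q = X -` D \<inter> space M" "C \<in> sets A" "D \<in> sets A"
    by (auto simp: preimage_events_def)
  then have "P \<inter> Q = X -` (C \<inter> D) \<inter> space M" "C \<inter> D \<in> sets A" by auto
  then show "P \<inter> Q \<in> preimage_events M A X" unfolding preimage_events_def by blast
qed

lemma indep_vars_preimage_events:
  assumes "prob_space.indep_vars M A X UNIV"  "prob_space M"
  shows "prob_space.indep_sets M (\<lambda>p. preimage_events M (A p) (X p)) UNIV" "\<And>p. X p \<in> measurable M (A p)"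
  using assms(1) unfolding prob_space.indep_vars_def2[OF assms(2)] preimage_events_def by simp_all

lemma preimage_events_measurable:
  assumes "X \<in> measurable M A" "preimage_events M A X \<subseteq> \<E>" "\<E> \<subseteq> Pow (space M)"
  shows "X \<in> measurable (sigma (space M) \<E>) A"
proof (rule measurableI)
  show "X x \<in> space A" if "x \<in> space (sigma (space M) \<E>)" for x
    using that assms(3) measurable_space[OF assms(1)] by (simp add: space_measure_of)
  show "X -` C \<inter> space (sigma (space M) \<E>) \<in> sets (sigma (space M) \<E>)" if "C \<in> sets A" for C
    using that assms(2,3) by (auto simp: space_measure_of sets_measure_of preimage_events_def)
qed

definition seed_events :: "'w measure \<Rightarrow> ('n \<Rightarrow> 's measure) \<Rightarrow> ('n \<Rightarrow> nat \<Rightarrow> 'w \<Rightarrow> 's) \<Rightarrow> 'n \<times> nat \<Rightarrow> 'w set set" where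
  "seed_events M S \<xi> p = preimage_events M (S (fst p)) (\<xi> (fst p) (snd p))"

lemma iid_seeds_indep:
  assumes "prob_space M" "iid_seeds M S \<xi>"
  shows "prob_space.indep_sets M (seed_events M S \<xi>) UNIV" and "\<And>j k. \<xi> j k \<in> measurable M (S j)"
proof -
  have i: "prob_space.indep_vars M (\<lambda>(j, k). S j) (\<lambda>(j, k). \<xi> j k) UNIV"
    using assms(2) by (simp add: iid_seeds_def)
  have "(\<lambda>p. preimage_events M (case p of (j, k) \<Rightarrow> S j) (case p of (j, k) \<Rightarrow> \<xi> j k)) = seed_events M S \<xi>"
    by (simp add: fun_eq_iff seed_events_def split_beta)
  then show "prob_space.indep_sets M (seed_events M S \<xi>) UNIV"
    using indep_vars_preimage_events(1)[OF i assms(1)] by simp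
  show "\<xi> j k \<in> measurable M (S j)" for j k
    using indep_vars_preimage_events(2)[OF i assms(1), of "(j, k)"] by simp
qed

lemma (in prob_space) prob_all_of_finitely_many:
  assumes "indep_sets F UNIV" "finite J" "\<And>p. p \<in> J \<Longrightarrow> A p \<in> F p"
  shows "prob {\<omega> \<in> space M. \<forall>p\<in>J. \<omega> \<in> A p} = (\<Prod>p\<in>J. prob (A p))"
proof (cases "J = {}")
  case True
  then show ?thesis by (simp add: prob_space)
next
  case False
  have ev: "F p \<subseteq> events" for p using assms(1) by (simp add: indep_sets_def)
  have sp: "A p \<subseteq> space M" if "p \<in> J" for p
    using assms(3)[OF that] ev[of p] sets.sets_into_space by blast
  have "{\<omega> \<in> space M. \<forall>p\<in>J. \<omega> \<in> A p} = (\<Inter>p\<in>J. A p)" using False sp by blast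
  then show ?thesis using indep_setsD[OF assms(1) _ False assms(2), of A] assms(3) by simp
qed

text \<open>Two families that are independent internally, and independent of each other as wholes, form one
independent family: the probability of a finite intersection factors first into the two families
and then within each of them.\<close>

lemma (in prob_space) indep_sets_Plus:
  assumes F: "indep_sets F UNIV" and G: "indep_sets G UNIV"
    and FG: "indep_set (sets \<G>) (sets \<F>)" "space \<F> = space M" "space \<G> = space M"
    and sub: "\<And>p. F p \<subseteq> sets \<F>" "\<And>p. G p \<subseteq> sets \<G>"
  shows "indep_sets (case_sum F G) UNIV"
  unfolding indep_sets_def
proof (intro conjI ballI allI impI)
  show ev: "case_sum F G p \<subseteq> events" for p
    using F G unfolding indep_sets_def by (cases p) auto
  fix J :: "('b + 'c) set" and A
  assume J: "J \<noteq> {}" "finite J" and A: "A \<in> Pi J (case_sum F G)"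
  define J1 where "J1 = Inl -` J"
  define J2 where "J2 = Inr -` J"
  have fin: "finite J1" "finite J2" using J by (auto simp: J1_def J2_def intro!: finite_vimageI)
  have Jeq: "J = Inl ` J1 \<union> Inr ` J2"
  proof (rule set_eqI)
    show "p \<in> J \<longleftrightarrow> p \<in> Inl ` J1 \<union> Inr ` J2" for p by (cases p) (auto simp: J1_def J2_def)
  qed
  have A1: "A (Inl p) \<in> F p" if "p \<in> J1" for p
    using Pi_mem[OF A, of "Inl p"] that by (simp add: J1_def)
  have A2: "A (Inr p) \<in> G p" if "p \<in> J2" for p
    using Pi_mem[OF A, of "Inr p"] that by (simp add: J2_def)
  let ?C1 = "{\<omega> \<in> space M. \<forall>p\<in>J1. \<omega> \<in> A (Inl p)}" and ?C2 = "{\<omega> \<in> space M. \<forall>p\<in>J2. \<omega> \<in> A (Inr p)}"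
  have "?C1 = {\<omega> \<in> space \<F>. \<forall>p\<in>J1. \<omega> \<in> A (Inl p)}" by (simp add: FG(2))
  also have "\<dots> \<in> sets \<F>"
  proof (rule sets.sets_Collect_finite_All[OF _ fin(1)])
    fix p assume p: "p \<in> J1"
    then have "{\<omega> \<in> space \<F>. \<omega> \<in> A (Inl p)} = A (Inl p)"
      using sets.sets_into_space[of "A (Inl p)" \<F>] A1[OF p] sub(1)[of p] by auto
    then show "{\<omega> \<in> space \<F>. \<omega> \<in> A (Inl p)} \<in> sets \<F>" using A1[OF p] sub(1) by auto
  qed
  finally have C1: "?C1 \<in> sets \<F>" .
  have "?C2 = {\<omega> \<in> space \<G>. \<forall>p\<in>J2. \<omega> \<in> A (Inr p)}" by (simp add: FG(3))
  also have "\<dots> \<in> sets \<G>"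
  proof (rule sets.sets_Collect_finite_All[OF _ fin(2)])
    fix p assume p: "p \<in> J2"
    then have "{\<omega> \<in> space \<G>. \<omega> \<in> A (Inr p)} = A (Inr p)"
      using sets.sets_into_space[of "A (Inr p)" \<G>] A2[OF p] sub(2)[of p] by auto
    then show "{\<omega> \<in> space \<G>. \<omega> \<in> A (Inr p)} \<in> sets \<G>" using A2[OF p] sub(2) by auto
  qed
  finally have C2: "?C2 \<in> sets \<G>" .
  have sp: "A p \<subseteq> space M" if "p \<in> J" for p
    using Pi_mem[OF A that] ev[of p] sets.sets_into_space by blast
  have "(\<Inter>p\<in>J. A p) \<subseteq> space M" using sp J(1) by blast
  then have "(\<Inter>p\<in>J. A p) = ?C1 \<inter> ?C2" unfolding Jeq by blast
  then have "prob (\<Inter>p\<in>J. A p) = prob ?C1 * prob ?C2"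
    using indep_setD[OF FG(1) C2 C1] by (simp add: Int_commute mult.commute)
  also have "\<dots> = (\<Prod>p\<in>J1. prob (A (Inl p))) * (\<Prod>p\<in>J2. prob (A (Inr p)))"
    using prob_all_of_finitely_many[OF F fin(1), of "\<lambda>p. A (Inl p)"]
      prob_all_of_finitely_many[OF G fin(2), of "\<lambda>p. A (Inr p)"] A1 A2 by simp
  also have "\<dots> = (\<Prod>p\<in>J. prob (A p))"
    unfolding Jeq using fin by (subst prod.union_disjoint) (auto simp: prod.reindex)
  finally show "prob (\<Inter>p\<in>J. A p) = (\<Prod>p\<in>J. prob (A p))" .
qed

definition draw_events :: "'w measure \<Rightarrow> (nat \<Rightarrow> 'w \<Rightarrow> 'n) \<Rightarrow> nat \<Rightarrow> 'w set set" where
  "draw_events M I k = preimage_events M (count_space UNIV) (I k)"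

lemma preimage_events_vimage_algebra:
  assumes "\<And>p. X p \<in> measurable M (A p)"
  shows "preimage_events M (A p) (X p) \<subseteq> sets (vimage_algebra (space M) (\<lambda>\<omega> p. X p \<omega>) (\<Pi>\<^sub>M p\<in>UNIV. A p))"
proof -
  let ?V = "vimage_algebra (space M) (\<lambda>\<omega> p. X p \<omega>) (\<Pi>\<^sub>M p\<in>UNIV. A p)"
  have "(\<lambda>\<omega> p. X p \<omega>) \<in> measurable ?V (\<Pi>\<^sub>M p\<in>UNIV. A p)"
    by (rule measurable_vimage_algebra1) (use measurable_space[OF assms] in \<open>auto simp: space_PiM\<close>)
  then have "(\<lambda>\<omega>. X p \<omega>) \<in> measurable ?V (A p)"
    using measurable_compose[OF _ measurable_component_singleton[of p UNIV A]] by simp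
  then show ?thesis
    using measurable_sets[of "X p" ?V "A p"] by (auto simp: preimage_events_def)
qed

lemma seeds_and_draws_indep:
  assumes "prob_space M" "iid_seeds M S \<xi>" "uniform_agents M S \<xi> I"
  shows "prob_space.indep_sets M (case_sum (seed_events M S \<xi>) (draw_events M I)) UNIV"
    and "\<And>k. I k \<in> measurable M (count_space UNIV)"
proof -
  interpret prob_space M by fact
  have d: "indep_vars (\<lambda>_. count_space UNIV) I UNIV"
    using assms(3) by (simp add: uniform_agents_def)
  note d' = indep_vars_preimage_events[OF d assms(1)]
  let ?F = "vimage_algebra (space M) (\<lambda>\<omega> (j, k). \<xi> j k \<omega>) (\<Pi>\<^sub>M (j, k)\<in>UNIV. S j)"
  let ?G = "vimage_algebra (space M) (\<lambda>\<omega> k. I k \<omega>) (\<Pi>\<^sub>M k\<in>UNIV. count_space UNIV)"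
  have "indep_set (sets ?G) (sets ?F)"
    using assms(3) unfolding uniform_agents_def by (elim conjE)
  show "I k \<in> measurable M (count_space UNIV)" for k by (rule d'(2))
  show "indep_sets (case_sum (seed_events M S \<xi>) (draw_events M I)) UNIV"
  proof (rule indep_sets_Plus)
    show "indep_sets (seed_events M S \<xi>) UNIV" by (rule iid_seeds_indep[OF assms(1,2)])
    show "indep_sets (draw_events M I) UNIV" using d'(1) unfolding draw_events_def .
    show "indep_set (sets ?G) (sets ?F)" by fact
    show "seed_events M S \<xi> p \<subseteq> sets ?F" for p
      using preimage_events_vimage_algebra[where p = p and X = "\<lambda>p. \<xi> (fst p) (snd p)" and A = "\<lambda>p. S (fst p)"
          and M = M] iid_seeds_indep(2)[OF assms(1,2)]
      by (simp add: seed_events_def case_prod_unfold)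
    show "draw_events M I k \<subseteq> sets ?G" for k
      using preimage_events_vimage_algebra[where p = k and X = I and A = "\<lambda>_. count_space UNIV" and M = M] d'(2)
      by (simp add: draw_events_def)
  qed simp_all
qed

text \<open>The information carried by all sources except \<open>p\<close>. It contains every iterate up to the iteration of
\<open>p\<close>, and also the other randomness of that same iteration.\<close>

definition rest_algebra :: "'w measure \<Rightarrow> ('p \<Rightarrow> 'w set set) \<Rightarrow> 'p \<Rightarrow> 'w measure" where
  "rest_algebra M E p = sigma (space M) (\<Union>q\<in>-{p}. E q)"

lemma measurable_rest_algebra:
  assumes "X \<in> measurable M A" "E q = preimage_events M A X" "q \<noteq> p" "\<And>q. E q \<subseteq> sets M"
  shows "X \<in> measurable (rest_algebra M E p) A"
  unfolding rest_algebra_def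
  by (rule preimage_events_measurable[OF assms(1)])
    (use assms(2-4) sets.sets_into_space in blast)+

lemma (in prob_space) measurable_rest_algebraD:
  assumes "X \<in> measurable (rest_algebra M E p) A" "indep_sets E UNIV"
  shows "X \<in> measurable M A"
proof -
  have ev: "E q \<subseteq> events" for q using assms(2) by (simp add: indep_sets_def)
  have sub: "(\<Union>q\<in>-{p}. E q) \<subseteq> Pow (space M)" using ev sets.sets_into_space by blast
  have "sigma_sets (space M) (\<Union>q\<in>-{p}. E q) \<subseteq> events"
    using ev by (intro sets.sigma_sets_subset) auto
  then show ?thesis
    using assms(1) sub unfolding rest_algebra_def
    by (auto simp: measurable_def space_measure_of sets_measure_of)
qed

lemma (in prob_space) independent_pair_rest_algebra:
  assumes "indep_sets E UNIV" "\<And>q. Int_stable (E q)"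
    and "X \<in> measurable (rest_algebra M E p) A" "Y \<in> measurable M B" "E p = preimage_events M B Y"
  shows "independent_pair M A X B Y"
  by (rule independent_pair_of_rest[where E = E and p = p, OF assms(1,2) _ assms(4)])
    (use assms(3,5) in \<open>auto simp: rest_algebra_def preimage_events_def\<close>)

section \<open>Second moments of a step\<close>

lemma integrable_inner_of_squares:
  fixes X Y :: "'w \<Rightarrow> 'a::euclidean_space"
  assumes [measurable]: "X \<in> borel_measurable M" "Y \<in> borel_measurable M"
    and "integrable M (\<lambda>\<omega>. (norm (X \<omega>))\<^sup>2)" "integrable M (\<lambda>\<omega>. (norm (Y \<omega>))\<^sup>2)"
  shows "integrable M (\<lambda>\<omega>. X \<omega> \<bullet> Y \<omega>)"
proof (rule Bochner_Integration.integrable_bound)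
  show "integrable M (\<lambda>\<omega>. (norm (X \<omega>))\<^sup>2 + (norm (Y \<omega>))\<^sup>2)" using assms by simp
  have "\<bar>x \<bullet> y\<bar> \<le> (norm x)\<^sup>2 + (norm y)\<^sup>2" for x y :: 'a
  proof -
    have "\<bar>x \<bullet> y\<bar> \<le> norm x * norm y" by (rule Cauchy_Schwarz_ineq2)
    also have "\<dots> \<le> (norm x)\<^sup>2 + (norm y)\<^sup>2"
    proof -
      have "2 * (norm x * norm y) \<le> (norm x)\<^sup>2 + (norm y)\<^sup>2"
        using sum_squares_bound[of "norm x" "norm y"] by (simp add: mult.assoc)
      moreover have "0 \<le> norm x * norm y" by simp
      ultimately show ?thesis by linarith
    qed
    finally show ?thesis .
  qed
  then show "AE \<omega> in M. norm (X \<omega> \<bullet> Y \<omega>) \<le> norm ((norm (X \<omega>))\<^sup>2 + (norm (Y \<omega>))\<^sup>2)" by simp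
qed simp

lemma integrable_add_square:
  fixes X Y :: "'w \<Rightarrow> 'a::euclidean_space"
  assumes [measurable]: "X \<in> borel_measurable M" "Y \<in> borel_measurable M"
    and "integrable M (\<lambda>\<omega>. (norm (X \<omega>))\<^sup>2)" "integrable M (\<lambda>\<omega>. (norm (Y \<omega>))\<^sup>2)"
  shows "integrable M (\<lambda>\<omega>. (norm (X \<omega> + Y \<omega>))\<^sup>2)"
  using assms(3,4) integrable_inner_of_squares[OF assms]
  by (simp add: power2_norm_eq_inner inner_add inner_commute)

text \<open>All cross terms vanish, so variances add up with squared weights. This is where averaging over
\<open>Ni\<close> agents reduces the noise by the factor \<open>Ni\<close>.\<close>

lemma uncorrelated_noise_square:
  fixes V :: "'w \<Rightarrow> 'a::euclidean_space" and n :: "'n::finite \<Rightarrow> 'w \<Rightarrow> 'a"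
  assumes [measurable]: "V \<in> borel_measurable M" "\<And>j. n j \<in> borel_measurable M"
    and V2: "integrable M (\<lambda>\<omega>. (norm (V \<omega>))\<^sup>2)"
    and n2: "\<And>j. mean_le M (\<lambda>\<omega>. (norm (n j \<omega>))\<^sup>2) v"
    and nV: "\<And>j. (\<integral>\<omega>. n j \<omega> \<bullet> V \<omega> \<partial>M) = 0"
    and nn: "\<And>j l. j \<noteq> l \<Longrightarrow> (\<integral>\<omega>. n j \<omega> \<bullet> n l \<omega> \<partial>M) = 0"
  shows "mean_le M (\<lambda>\<omega>. (norm (V \<omega> - \<eta> *\<^sub>R (\<Sum>j\<in>UNIV. w j *\<^sub>R n j \<omega>)))\<^sup>2)
     ((\<integral>\<omega>. (norm (V \<omega>))\<^sup>2 \<partial>M) + \<eta>\<^sup>2 * (v * (\<Sum>j\<in>UNIV. (w j)\<^sup>2)))"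
proof -
  have n2i: "integrable M (\<lambda>\<omega>. (norm (n j \<omega>))\<^sup>2)" for j
    using n2 by (simp add: mean_le_def)
  have iV: "integrable M (\<lambda>\<omega>. n j \<omega> \<bullet> V \<omega>)" for j
    by (intro integrable_inner_of_squares n2i V2) auto
  have in': "integrable M (\<lambda>\<omega>. n j \<omega> \<bullet> n l \<omega>)" for j l
    by (intro integrable_inner_of_squares n2i) auto
  have expand: "(norm (V \<omega> - \<eta> *\<^sub>R (\<Sum>j\<in>UNIV. w j *\<^sub>R n j \<omega>)))\<^sup>2
      = (norm (V \<omega>))\<^sup>2 - 2 * \<eta> * (\<Sum>j\<in>UNIV. w j * (n j \<omega> \<bullet> V \<omega>))
        + \<eta>\<^sup>2 * (\<Sum>j\<in>UNIV. \<Sum>l\<in>UNIV. w j * w l * (n j \<omega> \<bullet> n l \<omega>))" for \<omega>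
  proof -
    let ?s = "\<Sum>j\<in>UNIV. w j *\<^sub>R n j \<omega>"
    have "(norm (V \<omega> - \<eta> *\<^sub>R ?s))\<^sup>2 = (norm (V \<omega>))\<^sup>2 - 2 * \<eta> * (?s \<bullet> V \<omega>) + \<eta>\<^sup>2 * (?s \<bullet> ?s)"
      by (simp add: power2_norm_eq_inner inner_diff inner_commute)
        (simp add: power2_eq_square algebra_simps)
    moreover have "?s \<bullet> V \<omega> = (\<Sum>j\<in>UNIV. w j * (n j \<omega> \<bullet> V \<omega>))"
      by (simp add: inner_sum_left)
    moreover have "?s \<bullet> ?s = (\<Sum>j\<in>UNIV. \<Sum>l\<in>UNIV. w j * w l * (n j \<omega> \<bullet> n l \<omega>))"
      by (simp add: inner_sum_left) (simp add: inner_sum_right sum_distrib_left mult.assoc)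
    ultimately show ?thesis by simp
  qed
  have diag: "(\<Sum>l\<in>UNIV. w j * w l * (\<integral>\<omega>. n j \<omega> \<bullet> n l \<omega> \<partial>M)) = (w j)\<^sup>2 * (\<integral>\<omega>. (norm (n j \<omega>))\<^sup>2 \<partial>M)" for j
  proof -
    have "(\<Sum>l\<in>UNIV. w j * w l * (\<integral>\<omega>. n j \<omega> \<bullet> n l \<omega> \<partial>M))
        = (\<Sum>l\<in>UNIV. if l = j then (w j)\<^sup>2 * (\<integral>\<omega>. (norm (n j \<omega>))\<^sup>2 \<partial>M) else 0)"
      by (intro sum.cong) (auto simp: nn power2_eq_square[of "w j"] power2_norm_eq_inner)
    then show ?thesis by simp
  qed
  have "(\<integral>\<omega>. (norm (V \<omega> - \<eta> *\<^sub>R (\<Sum>j\<in>UNIV. w j *\<^sub>R n j \<omega>)))\<^sup>2 \<partial>M)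
     = (\<integral>\<omega>. (norm (V \<omega>))\<^sup>2 \<partial>M) + \<eta>\<^sup>2 * (\<Sum>j\<in>UNIV. (w j)\<^sup>2 * (\<integral>\<omega>. (norm (n j \<omega>))\<^sup>2 \<partial>M))"
    unfolding expand using V2 iV in' by (simp add: nV diag)
  also have "\<dots> \<le> (\<integral>\<omega>. (norm (V \<omega>))\<^sup>2 \<partial>M) + \<eta>\<^sup>2 * (\<Sum>j\<in>UNIV. (w j)\<^sup>2 * v)"
    using n2 by (intro add_mono mult_left_mono sum_mono) (auto simp: mean_le_def)
  finally have "(\<integral>\<omega>. (norm (V \<omega> - \<eta> *\<^sub>R (\<Sum>j\<in>UNIV. w j *\<^sub>R n j \<omega>)))\<^sup>2 \<partial>M)
     \<le> (\<integral>\<omega>. (norm (V \<omega>))\<^sup>2 \<partial>M) + \<eta>\<^sup>2 * (v * (\<Sum>j\<in>UNIV. (w j)\<^sup>2))"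
    by (simp add: sum_distrib_right[symmetric] mult.commute[of v])
  moreover have "integrable M (\<lambda>\<omega>. (norm (V \<omega> - \<eta> *\<^sub>R (\<Sum>j\<in>UNIV. w j *\<^sub>R n j \<omega>)))\<^sup>2)"
    unfolding expand using V2 iV in' by simp
  ultimately show ?thesis by (simp add: mean_le_def)
qed

text \<open>The sigma-algebra of \<open>F\<close> is left open because the lemma serves two purposes: measurability on the
probability space, and measurability with respect to the sources that precede iteration \<open>k\<close>,
which yields independence from the randomness of iteration \<open>k\<close>.\<close>

lemma wga_measurable:
  assumes "\<And>l j X. l < k \<Longrightarrow> X \<in> borel_measurable F \<Longrightarrow> (\<lambda>\<omega>. G l (X \<omega>) \<omega> j) \<in> borel_measurable F"
  shows "wga G w \<eta> x0 k \<in> borel_measurable F"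
  using assms
proof (induction k)
  case 0
  have "wga G w \<eta> x0 0 = (\<lambda>\<omega>. x0)" by (rule ext) simp
  then show ?case by simp
next
  case (Suc k)
  then have [measurable]: "wga G w \<eta> x0 k \<in> borel_measurable F" by simp
  have [measurable]: "(\<lambda>\<omega>. G k (wga G w \<eta> x0 k \<omega>) \<omega> j) \<in> borel_measurable F" for j
    using Suc.prems by simp
  have "wga G w \<eta> x0 (Suc k)
      = (\<lambda>\<omega>. wga G w \<eta> x0 k \<omega> - \<eta> *\<^sub>R (\<Sum>j\<in>UNIV. w j *\<^sub>R G k (wga G w \<eta> x0 k \<omega>) \<omega> j))"
    by (rule ext) simp
  then show ?case by simp
qed

lemma async_iterate_measurable:
  fixes F :: "'w measure" and \<gamma> :: "'n::finite \<Rightarrow> 's \<Rightarrow> 'a::euclidean_space \<Rightarrow> 'a"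
  assumes g: "\<And>j. (\<lambda>(s, x). \<gamma> j s x) \<in> borel_measurable (S j \<Otimes>\<^sub>M borel)"
    and \<xi>: "\<And>l j. l < k \<Longrightarrow> \<xi> j l \<in> measurable F (S j)"
    and I: "\<And>l. l < k \<Longrightarrow> I l \<in> measurable F (count_space UNIV)"
  shows "wga (async_oracle (stoch_grad \<gamma> \<xi>) I) w \<eta> x0 k \<in> borel_measurable F"
proof (rule wga_measurable)
  fix l j and X :: "'w \<Rightarrow> 'a" assume l: "l < k" and [measurable]: "X \<in> borel_measurable F"
  have [measurable]: "\<xi> j l \<in> measurable F (S j)" "I l \<in> measurable F (count_space UNIV)"
    "(\<lambda>(s, x). \<gamma> j s x) \<in> borel_measurable (S j \<Otimes>\<^sub>M borel)"
    using \<xi>[OF l] I[OF l] g by auto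
  show "(\<lambda>\<omega>. async_oracle (stoch_grad \<gamma> \<xi>) I l (X \<omega>) \<omega> j) \<in> borel_measurable F"
    unfolding async_oracle_def stoch_grad_def by measurable
qed

lemma sync_iterate_measurable:
  fixes F :: "'w measure" and \<gamma> :: "'n::finite \<Rightarrow> 's \<Rightarrow> 'a::euclidean_space \<Rightarrow> 'a"
  assumes g: "\<And>j. (\<lambda>(s, x). \<gamma> j s x) \<in> borel_measurable (S j \<Otimes>\<^sub>M borel)"
    and \<xi>: "\<And>l j. l < k \<Longrightarrow> \<xi> j l \<in> measurable F (S j)"
  shows "wga (sync_oracle (stoch_grad \<gamma> \<xi>)) w \<eta> x0 k \<in> borel_measurable F"
proof (rule wga_measurable)
  fix l j and X :: "'w \<Rightarrow> 'a" assume l: "l < k" and [measurable]: "X \<in> borel_measurable F"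
  have [measurable]: "\<xi> j l \<in> measurable F (S j)"
    "(\<lambda>(s, x). \<gamma> j s x) \<in> borel_measurable (S j \<Otimes>\<^sub>M borel)"
    using \<xi>[OF l] g by auto
  show "(\<lambda>\<omega>. sync_oracle (stoch_grad \<gamma> \<xi>) l (X \<omega>) \<omega> j) \<in> borel_measurable F"
    unfolding sync_oracle_def stoch_grad_def by measurable
qed

text \<open>Agent \<open>j\<close> is drawn with probability \<open>1 / N\<close>, and its gradient enters with the factor \<open>N\<close>. The two
cancel in the mean, whereas the second moment keeps one factor \<open>N\<close>. Since only one agent is active,
the squared norm of the step has no mixed terms.\<close>

lemma async_second_moment_step:
  fixes M :: "'w measure" and S :: "'n::finite \<Rightarrow> 's measure" and \<gamma> :: "'n \<Rightarrow> 's \<Rightarrow> 'a::euclidean_space \<Rightarrow> 'a"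
    and \<xi> :: "'n \<Rightarrow> nat \<Rightarrow> 'w \<Rightarrow> 's" and I :: "nat \<Rightarrow> 'w \<Rightarrow> 'n"
  defines "E \<equiv> case_sum (seed_events M S \<xi>) (draw_events M I)"
  assumes P: "prob_space M" and iid: "iid_seeds M S \<xi>" and unif: "uniform_agents M S \<xi> I"
    and \<gamma>: "\<And>j. (\<lambda>(s, x). \<gamma> j s x) \<in> borel_measurable (S j \<Otimes>\<^sub>M borel)"
    and int: "\<And>j x. integrable M (stoch_grad \<gamma> \<xi> j k x)"
    and sq: "\<And>j x. mean_le M (\<lambda>\<omega>. (norm (stoch_grad \<gamma> \<xi> j k x \<omega>))\<^sup>2) v"
    and X: "\<And>j. X \<in> borel_measurable (rest_algebra M E (Inl (j, k)))" "X \<in> borel_measurable (rest_algebra M E (Inr k))"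
    and Z: "\<And>j. Z \<in> borel_measurable (rest_algebra M E (Inl (j, k)))" "Z \<in> borel_measurable (rest_algebra M E (Inr k))"
    and bd: "AE \<omega> in M. norm (X \<omega> - Z \<omega>) \<le> R"
  shows "\<And>j. integrable M (\<lambda>\<omega>. (\<integral>\<omega>'. stoch_grad \<gamma> \<xi> j k (X \<omega>) \<omega>' \<partial>M) \<bullet> (X \<omega> - Z \<omega>))"
    and "mean_le M (\<lambda>\<omega>. (norm (X \<omega> - \<eta> *\<^sub>R (\<Sum>j\<in>UNIV. w j *\<^sub>R async_oracle (stoch_grad \<gamma> \<xi>) I k (X \<omega>) \<omega> j) - Z \<omega>))\<^sup>2)
      ((\<integral>\<omega>. (norm (X \<omega> - Z \<omega>))\<^sup>2 \<partial>M)
        - 2 * \<eta> * (\<Sum>j\<in>UNIV. w j * (\<integral>\<omega>. (\<integral>\<omega>'. stoch_grad \<gamma> \<xi> j k (X \<omega>) \<omega>' \<partial>M) \<bullet> (X \<omega> - Z \<omega>) \<partial>M))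
        + \<eta>\<^sup>2 * (real CARD('n) * v * (\<Sum>j\<in>UNIV. (w j)\<^sup>2)))"
proof -
  interpret prob_space M by fact
  have ind: "indep_sets E UNIV"
    using seeds_and_draws_indep(1)[OF P iid unif] by (simp add: E_def)
  have st: "Int_stable (E q)" for q
    by (cases q) (auto simp: E_def seed_events_def draw_events_def Int_stable_preimage_events)
  have ev: "E q \<subseteq> events" for q using ind by (simp add: indep_sets_def)
  have \<xi>m: "\<xi> j k \<in> measurable M (S j)" for j by (rule iid_seeds_indep(2)[OF P iid])
  have Im: "I k \<in> measurable M (count_space UNIV)" by (rule seeds_and_draws_indep(2)[OF P iid unif])
  have E1: "E (Inl (j, k)) = preimage_events M (S j) (\<xi> j k)" for j by (simp add: E_def seed_events_def)
  have E2: "E (Inr k) = preimage_events M (count_space UNIV) (I k)" by (simp add: E_def draw_events_def)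
  have [measurable]: "X \<in> borel_measurable M" "Z \<in> borel_measurable M"
    using measurable_rest_algebraD[OF X(2) ind] measurable_rest_algebraD[OF Z(2) ind] by auto
  note \<xi>m[measurable] Im[measurable] \<gamma>[measurable]
  define V where "V \<omega> = X \<omega> - Z \<omega>" for \<omega>
  have [measurable]: "V \<in> borel_measurable M" unfolding V_def by measurable
  have V2: "integrable M (\<lambda>\<omega>. (norm (V \<omega>))\<^sup>2)"
  proof (rule integrable_const_bound)
    show "AE \<omega> in M. norm ((norm (V \<omega>))\<^sup>2) \<le> R\<^sup>2"
      using bd by eventually_elim (simp add: V_def power_mono)
  qed simp
  define P where "P j \<omega> = \<gamma> j (\<xi> j k \<omega>) (X \<omega>)" for j \<omega>
  have [measurable]: "P j \<in> borel_measurable M" for j unfolding P_def by measurable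
  have P2: "mean_le M (\<lambda>\<omega>. (norm (P j \<omega>))\<^sup>2) v" for j
  proof -
    have i: "independent_pair M borel X (S j) (\<xi> j k)"
      by (rule independent_pair_rest_algebra[OF ind st X(1) \<xi>m E1])
    show ?thesis
      using second_moment_at_independent_point[OF i \<gamma>, of "\<lambda>_. 0" v] sq[of j]
      by (simp add: P_def stoch_grad_def)
  qed
  have PV: "integrable M (\<lambda>\<omega>. P j \<omega> \<bullet> V \<omega>)" for j
    by (rule integrable_inner_of_squares) (use P2[of j] V2 in \<open>auto simp: mean_le_def\<close>)
  have iXV: "independent_pair M borel (\<lambda>\<omega>. (X \<omega>, V \<omega>)) (S j) (\<xi> j k)" for j
  proof (rule independent_pair_rest_algebra[OF ind st _ \<xi>m E1])
    note X(1)[of j, measurable] Z(1)[of j, measurable]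
    show "(\<lambda>\<omega>. (X \<omega>, V \<omega>)) \<in> borel_measurable (rest_algebra M E (Inl (j, k)))"
      unfolding V_def by measurable
  qed
  have mean: "integrable M (\<lambda>\<omega>. \<gamma> j (\<xi> j k \<omega>) x)" for j x using int[of j x] by (simp add: stoch_grad_def[abs_def])
  show "integrable M (\<lambda>\<omega>. (\<integral>\<omega>'. stoch_grad \<gamma> \<xi> j k (X \<omega>) \<omega>' \<partial>M) \<bullet> (X \<omega> - Z \<omega>))" for j
    using unbiased_at_independent_point(1)[OF iXV \<gamma> mean] PV[of j] by (simp add: P_def V_def stoch_grad_def)
  have unb: "(\<integral>\<omega>. P j \<omega> \<bullet> V \<omega> \<partial>M) = (\<integral>\<omega>. (\<integral>\<omega>'. stoch_grad \<gamma> \<xi> j k (X \<omega>) \<omega>' \<partial>M) \<bullet> (X \<omega> - Z \<omega>) \<partial>M)" for j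
    using unbiased_at_independent_point(2)[OF iXV \<gamma> mean] PV[of j] by (simp add: P_def V_def stoch_grad_def)
  define c where "c j \<omega> = (if j = I k \<omega> then 1 else 0 :: real)" for j \<omega>
  have [measurable]: "c j \<in> borel_measurable M" for j unfolding c_def by measurable
  \<comment> \<open>The drawn agent is independent of everything else, including the seeds of iteration k.\<close>
  have cW: "integrable M (\<lambda>\<omega>. c j \<omega> * W \<omega>)" "(\<integral>\<omega>. c j \<omega> * W \<omega> \<partial>M) = (\<integral>\<omega>. W \<omega> \<partial>M) / real CARD('n)"
    if W: "W \<in> borel_measurable (rest_algebra M E (Inr k))" "integrable M W" for j and W :: "'w \<Rightarrow> real"
  proof -
    show i: "integrable M (\<lambda>\<omega>. c j \<omega> * W \<omega>)"
      by (rule Bochner_Integration.integrable_bound[OF W(2)]) (use W in \<open>auto simp: c_def\<close>)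
    have ivar: "independent_pair M borel W (count_space UNIV) (I k)"
      by (rule independent_pair_rest_algebra[OF ind st W(1) Im E2])
    have [measurable]: "(\<lambda>p. (if j = snd p then 1 else 0) * fst p :: real) \<in> borel_measurable (borel \<Otimes>\<^sub>M count_space UNIV)"
      by measurable
    have pr: "(\<integral>\<omega>. c j \<omega> \<partial>M) = 1 / real CARD('n)"
    proof -
      have "(\<integral>\<omega>. c j \<omega> \<partial>M) = (\<integral>\<omega>. indicator {\<omega> \<in> space M. I k \<omega> = j} \<omega> \<partial>M)"
        by (intro Bochner_Integration.integral_cong) (auto simp: c_def indicator_def)
      also have "\<dots> = measure M {\<omega> \<in> space M. I k \<omega> = j}" by simp
      finally show ?thesis using unif by (simp add: uniform_agents_def)
    qed
    have "(\<integral>\<omega>. c j \<omega> * W \<omega> \<partial>M) = (\<integral>\<omega>. (\<integral>\<omega>'. c j \<omega>' * W \<omega> \<partial>M) \<partial>M)"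
      using independent_pair_integral_iterated(2)[OF ivar, of "\<lambda>p. (if j = snd p then 1 else 0) * fst p"] i
      by (simp add: c_def)
    also have "\<dots> = (\<integral>\<omega>. W \<omega> / real CARD('n) \<partial>M)"
      by (simp add: pr)
    finally show "(\<integral>\<omega>. c j \<omega> * W \<omega> \<partial>M) = (\<integral>\<omega>. W \<omega> \<partial>M) / real CARD('n)" by simp
  qed
  have \<xi>r: "\<xi> j k \<in> measurable (rest_algebra M E (Inr k)) (S j)" for j
    by (rule measurable_rest_algebra[where E = E and q = "Inl (j, k)", OF \<xi>m E1]) (simp_all add: ev)
  note \<xi>r[measurable] X(2)[measurable] Z(2)[measurable]
  have Wm: "(\<lambda>\<omega>. P j \<omega> \<bullet> V \<omega>) \<in> borel_measurable (rest_algebra M E (Inr k))"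
    "(\<lambda>\<omega>. (norm (P j \<omega>))\<^sup>2) \<in> borel_measurable (rest_algebra M E (Inr k))" for j
    unfolding P_def V_def by measurable
  note c1 = cW[OF Wm(1) PV] and c2 = cW[OF Wm(2)]
  have P2i: "integrable M (\<lambda>\<omega>. (norm (P j \<omega>))\<^sup>2)" for j using P2 by (simp add: mean_le_def)
  let ?N = "real CARD('n)"
  have expand: "(norm (X \<omega> - \<eta> *\<^sub>R (\<Sum>j\<in>UNIV. w j *\<^sub>R async_oracle (stoch_grad \<gamma> \<xi>) I k (X \<omega>) \<omega> j) - Z \<omega>))\<^sup>2
      = (norm (V \<omega>))\<^sup>2 - 2 * \<eta> * (\<Sum>j\<in>UNIV. w j * ?N * (c j \<omega> * (P j \<omega> \<bullet> V \<omega>)))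
        + \<eta>\<^sup>2 * (\<Sum>j\<in>UNIV. (w j * ?N)\<^sup>2 * (c j \<omega> * (norm (P j \<omega>))\<^sup>2))" for \<omega>
  proof -
    let ?i = "I k \<omega>"
    have "(\<Sum>j\<in>UNIV. w j *\<^sub>R async_oracle (stoch_grad \<gamma> \<xi>) I k (X \<omega>) \<omega> j)
        = (\<Sum>j\<in>UNIV. if j = ?i then (w j * ?N) *\<^sub>R P j \<omega> else 0)"
      by (intro sum.cong) (auto simp: async_oracle_def stoch_grad_def P_def)
    then have s: "(\<Sum>j\<in>UNIV. w j *\<^sub>R async_oracle (stoch_grad \<gamma> \<xi>) I k (X \<omega>) \<omega> j) = (w ?i * ?N) *\<^sub>R P ?i \<omega>"
      by simp
    have "(\<Sum>j\<in>UNIV. w j * ?N * (c j \<omega> * (P j \<omega> \<bullet> V \<omega>)))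
        = (\<Sum>j\<in>UNIV. if j = ?i then w j * ?N * (P j \<omega> \<bullet> V \<omega>) else 0)"
      by (intro sum.cong) (auto simp: c_def)
    then have s1: "(\<Sum>j\<in>UNIV. w j * ?N * (c j \<omega> * (P j \<omega> \<bullet> V \<omega>))) = w ?i * ?N * (P ?i \<omega> \<bullet> V \<omega>)"
      by simp
    have "(\<Sum>j\<in>UNIV. (w j * ?N)\<^sup>2 * (c j \<omega> * (norm (P j \<omega>))\<^sup>2))
        = (\<Sum>j\<in>UNIV. if j = ?i then (w j * ?N)\<^sup>2 * (norm (P j \<omega>))\<^sup>2 else 0)"
      by (intro sum.cong) (auto simp: c_def)
    then have s2: "(\<Sum>j\<in>UNIV. (w j * ?N)\<^sup>2 * (c j \<omega> * (norm (P j \<omega>))\<^sup>2)) = (w ?i * ?N)\<^sup>2 * (norm (P ?i \<omega>))\<^sup>2"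
      by simp
    define r where "r = w ?i * ?N"
    have e: "X \<omega> - \<eta> *\<^sub>R (r *\<^sub>R P ?i \<omega>) - Z \<omega> = V \<omega> - (\<eta> * r) *\<^sub>R P ?i \<omega>" by (simp add: V_def)
    have "(norm (V \<omega> - (\<eta> * r) *\<^sub>R P ?i \<omega>))\<^sup>2
        = (norm (V \<omega>))\<^sup>2 - 2 * \<eta> * (r * (P ?i \<omega> \<bullet> V \<omega>)) + \<eta>\<^sup>2 * (r\<^sup>2 * (norm (P ?i \<omega>))\<^sup>2)"
      unfolding power2_norm_eq_inner
      by (simp add: inner_diff inner_commute) (simp add: power2_eq_square algebra_simps)
    then show ?thesis unfolding s s1 s2 r_def[symmetric] e .
  qed
  have "(\<integral>\<omega>. (norm (X \<omega> - \<eta> *\<^sub>R (\<Sum>j\<in>UNIV. w j *\<^sub>R async_oracle (stoch_grad \<gamma> \<xi>) I k (X \<omega>) \<omega> j) - Z \<omega>))\<^sup>2 \<partial>M)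
      = (\<integral>\<omega>. (norm (V \<omega>))\<^sup>2 \<partial>M) - 2 * \<eta> * (\<Sum>j\<in>UNIV. w j * ?N * ((\<integral>\<omega>. P j \<omega> \<bullet> V \<omega> \<partial>M) / ?N))
        + \<eta>\<^sup>2 * (\<Sum>j\<in>UNIV. (w j * ?N)\<^sup>2 * ((\<integral>\<omega>. (norm (P j \<omega>))\<^sup>2 \<partial>M) / ?N))"
    unfolding expand using V2 c1(1) c2(1)[OF P2i]
    by (simp add: c1(2) c2(2)[OF P2i])
  also have "\<dots> = (\<integral>\<omega>. (norm (V \<omega>))\<^sup>2 \<partial>M) - 2 * \<eta> * (\<Sum>j\<in>UNIV. w j * (\<integral>\<omega>. P j \<omega> \<bullet> V \<omega> \<partial>M))
        + \<eta>\<^sup>2 * (\<Sum>j\<in>UNIV. (w j)\<^sup>2 * ?N * (\<integral>\<omega>. (norm (P j \<omega>))\<^sup>2 \<partial>M))"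
    by (simp add: power_mult_distrib power2_eq_square[of ?N] mult.assoc)
  also have "\<dots> \<le> (\<integral>\<omega>. (norm (V \<omega>))\<^sup>2 \<partial>M) - 2 * \<eta> * (\<Sum>j\<in>UNIV. w j * (\<integral>\<omega>. P j \<omega> \<bullet> V \<omega> \<partial>M))
        + \<eta>\<^sup>2 * (\<Sum>j\<in>UNIV. (w j)\<^sup>2 * ?N * v)"
    using P2 by (intro add_mono mult_left_mono sum_mono order_refl) (auto simp: mean_le_def)
  also have "(\<Sum>j\<in>UNIV. (w j)\<^sup>2 * ?N * v) = ?N * v * (\<Sum>j\<in>UNIV. (w j)\<^sup>2)"
    by (simp add: sum_distrib_left ac_simps)
  finally show "mean_le M (\<lambda>\<omega>. (norm (X \<omega> - \<eta> *\<^sub>R (\<Sum>j\<in>UNIV. w j *\<^sub>R async_oracle (stoch_grad \<gamma> \<xi>) I k (X \<omega>) \<omega> j) - Z \<omega>))\<^sup>2)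
      ((\<integral>\<omega>. (norm (X \<omega> - Z \<omega>))\<^sup>2 \<partial>M)
        - 2 * \<eta> * (\<Sum>j\<in>UNIV. w j * (\<integral>\<omega>. (\<integral>\<omega>'. stoch_grad \<gamma> \<xi> j k (X \<omega>) \<omega>' \<partial>M) \<bullet> (X \<omega> - Z \<omega>) \<partial>M))
        + \<eta>\<^sup>2 * (real CARD('n) * v * (\<Sum>j\<in>UNIV. (w j)\<^sup>2)))"
    unfolding mean_le_def unb unfolding expand V_def[symmetric] using V2 c1(1) c2(1)[OF P2i] by simp
qed

text \<open>The new displacement is the displacement after an exact gradient step minus fresh noise. The noise of
each agent is orthogonal to whatever does not involve its own seed, in particular to the
noise of the other agents.\<close>

lemma sync_second_moment_step:
  fixes M :: "'w measure" and S :: "'n::finite \<Rightarrow> 's measure" and \<gamma> :: "'n \<Rightarrow> 's \<Rightarrow> 'a::euclidean_space \<Rightarrow> 'a"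
  assumes P: "prob_space M" and iid: "iid_seeds M S \<xi>"
    and \<gamma>: "\<And>j. (\<lambda>(s, y). \<gamma> j s y) \<in> borel_measurable (S j \<Otimes>\<^sub>M borel)"
    and G: "\<And>j. G j \<in> borel_measurable borel"
    and mean: "\<And>j y. integrable M (stoch_grad \<gamma> \<xi> j k y) \<and> (\<integral>\<omega>. stoch_grad \<gamma> \<xi> j k y \<omega> \<partial>M) = G j y"
    and var: "\<And>j y. mean_le M (\<lambda>\<omega>. (norm (stoch_grad \<gamma> \<xi> j k y \<omega> - G j y))\<^sup>2) v"
    and x: "x = wga (sync_oracle (stoch_grad \<gamma> \<xi>)) w \<eta> x0"
    and contract: "\<And>y. (norm (y - \<eta> *\<^sub>R (\<Sum>j\<in>UNIV. w j *\<^sub>R G j y) - z))\<^sup>2 \<le> \<rho> * (norm (y - z))\<^sup>2"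
    and past: "mean_le M (\<lambda>\<omega>. (norm (x k \<omega> - z))\<^sup>2) u" and \<rho>: "0 \<le> \<rho>"
  shows "mean_le M (\<lambda>\<omega>. (norm (x (Suc k) \<omega> - z))\<^sup>2) (\<rho> * u + \<eta>\<^sup>2 * (v * (\<Sum>j\<in>UNIV. (w j)\<^sup>2)))"
proof -
  interpret prob_space M by fact
  let ?E = "seed_events M S \<xi>"
  have ind: "indep_sets ?E UNIV" by (rule iid_seeds_indep(1)[OF P iid])
  have ev: "?E q \<subseteq> events" for q using ind unfolding indep_sets_def by blast
  have st: "Int_stable (?E q)" for q by (simp add: seed_events_def Int_stable_preimage_events)
  have \<xi>m: "\<xi> j l \<in> measurable M (S j)" for j l by (rule iid_seeds_indep(2)[OF P iid])
  have E1: "?E (j, k) = preimage_events M (S j) (\<xi> j k)" for j by (simp add: seed_events_def)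
  have \<xi>r: "\<xi> j l \<in> measurable (rest_algebra M ?E q) (S j)" if "q \<noteq> (j, l)" for q j l
    by (rule measurable_rest_algebra[where q = "(j, l)", OF \<xi>m]) (use that ev in \<open>auto simp: seed_events_def\<close>)
  have xr: "x k \<in> borel_measurable (rest_algebra M ?E (j, k))" for j
    unfolding x by (rule sync_iterate_measurable[OF \<gamma>]) (auto intro: \<xi>r)
  have [measurable]: "x k \<in> borel_measurable M" by (rule measurable_rest_algebraD[OF xr ind])
  note \<xi>m[measurable] \<gamma>[measurable] G[measurable]
  define n where "n j \<omega> = \<gamma> j (\<xi> j k \<omega>) (x k \<omega>) - G j (x k \<omega>)" for j \<omega>
  define V where "V \<omega> = x k \<omega> - \<eta> *\<^sub>R (\<Sum>j\<in>UNIV. w j *\<^sub>R G j (x k \<omega>)) - z" for \<omega>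
  have [measurable]: "n j \<in> borel_measurable M" for j unfolding n_def by measurable
  have [measurable]: "V \<in> borel_measurable M" unfolding V_def by measurable
  have Vle: "(norm (V \<omega>))\<^sup>2 \<le> \<rho> * (norm (x k \<omega> - z))\<^sup>2" for \<omega> unfolding V_def by (rule contract)
  have xz: "integrable M (\<lambda>\<omega>. (norm (x k \<omega> - z))\<^sup>2)" using past by (simp add: mean_le_def)
  have V2: "integrable M (\<lambda>\<omega>. (norm (V \<omega>))\<^sup>2)"
  proof (rule Bochner_Integration.integrable_bound)
    show "integrable M (\<lambda>\<omega>. \<rho> * (norm (x k \<omega> - z))\<^sup>2)" using xz by simp
    show "AE \<omega> in M. norm ((norm (V \<omega>))\<^sup>2) \<le> norm (\<rho> * (norm (x k \<omega> - z))\<^sup>2)"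
      using Vle \<rho> by simp
  qed simp
  have n2: "mean_le M (\<lambda>\<omega>. (norm (n j \<omega>))\<^sup>2) v" for j
    unfolding n_def
    by (rule second_moment_at_independent_point[OF _ \<gamma> G])
      (use independent_pair_rest_algebra[OF ind st xr \<xi>m E1] var[of j] in \<open>auto simp: stoch_grad_def\<close>)
  \<comment> \<open>The noise is an unbiased oracle for the zero map.\<close>
  have orth: "(\<integral>\<omega>. n j \<omega> \<bullet> W \<omega> \<partial>M) = 0"
    if Wr: "W \<in> borel_measurable (rest_algebra M ?E (j, k))" and W2: "integrable M (\<lambda>\<omega>. (norm (W \<omega>))\<^sup>2)" for j W
  proof -
    have [measurable]: "W \<in> borel_measurable M" by (rule measurable_rest_algebraD[OF Wr ind])
    have i: "independent_pair M borel (\<lambda>\<omega>. (x k \<omega>, W \<omega>)) (S j) (\<xi> j k)"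
    proof (rule independent_pair_rest_algebra[OF ind st _ \<xi>m E1])
      note xr[measurable] Wr[measurable]
      show "(\<lambda>\<omega>. (x k \<omega>, W \<omega>)) \<in> borel_measurable (rest_algebra M ?E (j, k))" by measurable
    qed
    have m: "(\<lambda>(s, y). \<gamma> j s y - G j y) \<in> borel_measurable (S j \<Otimes>\<^sub>M borel)" by measurable
    have im: "integrable M (\<lambda>\<omega>. \<gamma> j (\<xi> j k \<omega>) y)" "(\<integral>\<omega>. \<gamma> j (\<xi> j k \<omega>) y \<partial>M) = G j y" for y
      using mean[of j y] by (auto simp: stoch_grad_def[abs_def])
    have nW: "integrable M (\<lambda>\<omega>. n j \<omega> \<bullet> W \<omega>)"
      by (rule integrable_inner_of_squares) (use n2[of j] W2 in \<open>auto simp: mean_le_def\<close>)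
    have "(\<integral>\<omega>. n j \<omega> \<bullet> W \<omega> \<partial>M) = (\<integral>\<omega>. (\<integral>\<omega>'. \<gamma> j (\<xi> j k \<omega>') (x k \<omega>) - G j (x k \<omega>) \<partial>M) \<bullet> W \<omega> \<partial>M)"
      using unbiased_at_independent_point(2)[OF i m] im(1) nW by (simp add: n_def)
    also have "\<dots> = 0" using im by (simp add: prob_space)
    finally show ?thesis .
  qed
  have nV: "(\<integral>\<omega>. n j \<omega> \<bullet> V \<omega> \<partial>M) = 0" for j
  proof (rule orth[OF _ V2])
    note xr[of j, measurable]
    show "V \<in> borel_measurable (rest_algebra M ?E (j, k))" unfolding V_def by measurable
  qed
  have nn: "(\<integral>\<omega>. n j \<omega> \<bullet> n l \<omega> \<partial>M) = 0" if "j \<noteq> l" for j l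
  proof (rule orth)
    note xr[of j, measurable]
    have [measurable]: "\<xi> l k \<in> measurable (rest_algebra M ?E (j, k)) (S l)" by (rule \<xi>r) (use that in simp)
    show "n l \<in> borel_measurable (rest_algebra M ?E (j, k))" unfolding n_def by measurable
    show "integrable M (\<lambda>\<omega>. (norm (n l \<omega>))\<^sup>2)" using n2 by (simp add: mean_le_def)
  qed
  have next_iterate: "x (Suc k) \<omega> - z = V \<omega> - \<eta> *\<^sub>R (\<Sum>j\<in>UNIV. w j *\<^sub>R n j \<omega>)" for \<omega>
    by (simp add: x V_def n_def sync_oracle_def stoch_grad_def scaleR_diff_right sum_subtractf)
  have "(\<integral>\<omega>. (norm (V \<omega>))\<^sup>2 \<partial>M) \<le> (\<integral>\<omega>. \<rho> * (norm (x k \<omega> - z))\<^sup>2 \<partial>M)"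
    using V2 xz Vle by (intro integral_mono) auto
  also have "\<dots> \<le> \<rho> * u" using past \<rho> by (simp add: mean_le_def mult_left_mono)
  finally have "(\<integral>\<omega>. (norm (V \<omega>))\<^sup>2 \<partial>M) \<le> \<rho> * u" .
  moreover have "mean_le M (\<lambda>\<omega>. (norm (V \<omega> - \<eta> *\<^sub>R (\<Sum>j\<in>UNIV. w j *\<^sub>R n j \<omega>)))\<^sup>2)
     ((\<integral>\<omega>. (norm (V \<omega>))\<^sup>2 \<partial>M) + \<eta>\<^sup>2 * (v * (\<Sum>j\<in>UNIV. (w j)\<^sup>2)))"
    by (rule uncorrelated_noise_square[OF _ _ V2 n2 nV nn]) auto
  ultimately show ?thesis unfolding next_iterate mean_le_def by auto
qed

section \<open>The asynchronous oracle with convex functions\<close>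

lemma (in prob_space) norm_mean_square_le:
  fixes g :: "'a \<Rightarrow> 'b::euclidean_space"
  assumes "integrable M g" "mean_le M (\<lambda>\<omega>. (norm (g \<omega>))\<^sup>2) v"
  shows "(norm (\<integral>\<omega>. g \<omega> \<partial>M))\<^sup>2 \<le> v"
proof -
  let ?m = "\<integral>\<omega>. g \<omega> \<partial>M"
  have "0 \<le> (\<integral>\<omega>. (norm (g \<omega> - ?m))\<^sup>2 \<partial>M)" by simp
  also have "(\<lambda>\<omega>. (norm (g \<omega> - ?m))\<^sup>2) = (\<lambda>\<omega>. (norm (g \<omega>))\<^sup>2 - 2 * (g \<omega> \<bullet> ?m) + (norm ?m)\<^sup>2)"
    by (simp add: fun_eq_iff power2_norm_eq_inner inner_diff inner_commute)
  also have "(\<integral>\<omega>. (norm (g \<omega>))\<^sup>2 - 2 * (g \<omega> \<bullet> ?m) + (norm ?m)\<^sup>2 \<partial>M)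
      = (\<integral>\<omega>. (norm (g \<omega>))\<^sup>2 \<partial>M) - (norm ?m)\<^sup>2"
    using assms by (simp add: mean_le_def prob_space) (simp add: power2_norm_eq_inner)
  finally show ?thesis using assms(2) by (simp add: mean_le_def)
qed

text \<open>Along a segment cut into \<open>n\<close> pieces, the increments of \<open>f\<close> are bounded by subgradients at the end of
each piece and those of \<open>h\<close> by subgradients at its beginning. The mismatch of the two evaluation points
telescopes to \<open>(vh y - vh x) \<bullet> (y - x) / n\<close>, which vanishes as \<open>n\<close> grows.\<close>

lemma convex_difference_Lipschitz:
  fixes x y :: "'a::euclidean_space"
  assumes f: "\<And>x. vf x \<in> subdifferential f x" and h: "\<And>x. vh x \<in> subdifferential h x"
    and close: "\<And>x. norm (vf x - vh x) \<le> c"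
  shows "(f y - h y) - (f x - h x) \<le> c * norm (y - x)"
proof -
  have part: "(f y - h y) - (f x - h x) \<le> c * norm (y - x) + ((vh y - vh x) \<bullet> (y - x)) / real n"
    if n: "0 < n" for n :: nat
  proof -
    define \<delta> where "\<delta> = (1 / real n) *\<^sub>R (y - x)"
    define p where "p m = x + real m *\<^sub>R \<delta>" for m
    have p: "p 0 = x" "p n = y" "p (Suc m) - p m = \<delta>" "p m - p (Suc m) = - \<delta>" for m
    proof -
      show "p 0 = x" by (simp add: p_def)
      show "p n = y" using n by (simp add: p_def \<delta>_def)
      show "p (Suc m) - p m = \<delta>" "p m - p (Suc m) = - \<delta>" by (simp_all add: p_def algebra_simps)
    qed
    have step: "(f (p (Suc m)) - h (p (Suc m))) - (f (p m) - h (p m))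
        \<le> c * norm \<delta> + (vh (p (Suc m)) - vh (p m)) \<bullet> \<delta>" for m
    proof -
      have "f (p (Suc m)) + vf (p (Suc m)) \<bullet> (p m - p (Suc m)) \<le> f (p m)"
        using f[of "p (Suc m)"] unfolding subdifferential_def by blast
      moreover have "h (p m) + vh (p m) \<bullet> (p (Suc m) - p m) \<le> h (p (Suc m))"
        using h[of "p m"] unfolding subdifferential_def by blast
      moreover have "(vf (p (Suc m)) - vh (p (Suc m))) \<bullet> \<delta> \<le> c * norm \<delta>"
        using norm_cauchy_schwarz[of "vf (p (Suc m)) - vh (p (Suc m))" \<delta>]
          mult_right_mono[OF close[of "p (Suc m)"] norm_ge_zero[of \<delta>]] by linarith
      ultimately show ?thesis unfolding p(3,4) by (simp add: inner_diff_left)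
    qed
    have "(f y - h y) - (f x - h x) = (\<Sum>m<n. (f (p (Suc m)) - h (p (Suc m))) - (f (p m) - h (p m)))"
      by (subst sum_lessThan_telescope[of "\<lambda>m. f (p m) - h (p m)"]) (simp add: p)
    also have "\<dots> \<le> (\<Sum>m<n. c * norm \<delta> + (vh (p (Suc m)) - vh (p m)) \<bullet> \<delta>)"
      by (intro sum_mono step)
    also have "\<dots> = real n * (c * norm \<delta>) + (\<Sum>m<n. vh (p (Suc m)) - vh (p m)) \<bullet> \<delta>"
      by (simp add: sum.distrib inner_sum_left)
    also have "(\<Sum>m<n. vh (p (Suc m)) - vh (p m)) = vh y - vh x"
      by (subst sum_lessThan_telescope[of "\<lambda>m. vh (p m)"]) (simp add: p)
    finally show ?thesis using n by (simp add: \<delta>_def)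
  qed
  have "(\<lambda>n. c * norm (y - x) + ((vh y - vh x) \<bullet> (y - x)) / real n) \<longlonglongrightarrow> c * norm (y - x) + 0"
    by (intro tendsto_add tendsto_const lim_const_over_n)
  then have "(\<lambda>n. c * norm (y - x) + ((vh y - vh x) \<bullet> (y - x)) / real n) \<longlonglongrightarrow> c * norm (y - x)" by simp
  then show ?thesis
    by (rule LIMSEQ_le_const) (use part in \<open>auto intro: exI[of _ 1]\<close>)
qed

lemma (in prob_space) integrable_continuous_of_bounded:
  fixes h :: "'b::euclidean_space \<Rightarrow> real"
  assumes [measurable]: "X \<in> borel_measurable M" and h: "continuous_on UNIV h"
    and bd: "AE \<omega> in M. norm (X \<omega> - z) \<le> R"
  shows "integrable M (\<lambda>\<omega>. h (X \<omega>))"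
proof -
  have "compact (h ` cball z R)"
    using h by (intro compact_continuous_image continuous_on_subset[OF h]) auto
  then obtain C where C: "\<And>x. x \<in> cball z R \<Longrightarrow> norm (h x) \<le> C"
    using compact_imp_bounded bounded_iff by (metis imageI)
  have [measurable]: "h \<in> borel_measurable borel" using h by (rule borel_measurable_continuous_onI)
  show ?thesis
  proof (rule integrable_const_bound)
    show "AE \<omega> in M. norm (h (X \<omega>)) \<le> C"
      using bd
    proof eventually_elim
      case (elim \<omega>)
      then show ?case using C[of "X \<omega>"] by (simp add: dist_norm norm_minus_commute)
    qed
  qed measurable
qed

text \<open>One step of the regret analysis. The comparator \<open>Z\<close> is a fixed point or an earlier iterate; both are
known before iteration \<open>k\<close>.\<close>

lemma async_regret_step:
  fixes M :: "'w measure" and S :: "'n::finite \<Rightarrow> 's measure" and \<gamma> :: "'n \<Rightarrow> 's \<Rightarrow> 'a::euclidean_space \<Rightarrow> 'a"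
  assumes P: "prob_space M" and iid: "iid_seeds M S \<xi>" and unif: "uniform_agents M S \<xi> I"
    and \<gamma>: "\<And>j. (\<lambda>(s, x). \<gamma> j s x) \<in> borel_measurable (S j \<Otimes>\<^sub>M borel)"
    and convex: "\<And>j. convex_on UNIV (f j)"
    and sub: "\<And>j k y. integrable M (stoch_grad \<gamma> \<xi> j k y) \<and> (\<integral>\<omega>. stoch_grad \<gamma> \<xi> j k y \<omega> \<partial>M) \<in> subdifferential (f j) y"
    and sq: "\<And>j k y. mean_le M (\<lambda>\<omega>. (norm (stoch_grad \<gamma> \<xi> j k y \<omega>))\<^sup>2) v"
    and x: "x = wga (async_oracle (stoch_grad \<gamma> \<xi>) I) w \<eta> x0"
    and w: "\<And>j. 0 \<le> w j" and \<eta>: "0 \<le> \<eta>"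
    and bd: "\<And>k. AE \<omega> in M. norm (x k \<omega> - c) \<le> R"
    and Z: "Z = (\<lambda>_. c) \<or> (\<exists>a\<le>k. Z = x a)"
  shows "(\<integral>\<omega>. (norm (x (Suc k) \<omega> - Z \<omega>))\<^sup>2 \<partial>M) \<le> (\<integral>\<omega>. (norm (x k \<omega> - Z \<omega>))\<^sup>2 \<partial>M)
     - 2 * \<eta> * ((\<integral>\<omega>. (\<Sum>j\<in>UNIV. w j * f j (x k \<omega>)) \<partial>M) - (\<integral>\<omega>. (\<Sum>j\<in>UNIV. w j * f j (Z \<omega>)) \<partial>M))
     + \<eta>\<^sup>2 * (real CARD('n) * v * (\<Sum>j\<in>UNIV. (w j)\<^sup>2))"
proof -
  interpret prob_space M by fact
  let ?E = "case_sum (seed_events M S \<xi>) (draw_events M I)"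
  have ind: "indep_sets ?E UNIV" by (rule seeds_and_draws_indep(1)[OF P iid unif])
  have ev: "?E q \<subseteq> events" for q using ind unfolding indep_sets_def by blast
  have \<xi>m: "\<xi> j l \<in> measurable M (S j)" for j l by (rule iid_seeds_indep(2)[OF P iid])
  have Im: "I l \<in> measurable M (count_space UNIV)" for l by (rule seeds_and_draws_indep(2)[OF P iid unif])
  have past: "x a \<in> borel_measurable (rest_algebra M ?E q)"
    if "a \<le> k" and q: "q = Inr k \<or> (\<exists>j. q = Inl (j, k))" for a q
    unfolding x
  proof (rule async_iterate_measurable[OF \<gamma>])
    fix l assume "l < a"
    then have lk: "l < k" using that by simp
    show "\<xi> j l \<in> measurable (rest_algebra M ?E q) (S j)" for j
      by (rule measurable_rest_algebra[where q = "Inl (j, l)", OF \<xi>m])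
        (use q lk ev in \<open>auto simp: seed_events_def\<close>)
    show "I l \<in> measurable (rest_algebra M ?E q) (count_space UNIV)"
      by (rule measurable_rest_algebra[where q = "Inr l", OF Im])
        (use q lk ev in \<open>auto simp: draw_events_def\<close>)
  qed
  have Zm: "Z \<in> borel_measurable (rest_algebra M ?E q)" if "q = Inr k \<or> (\<exists>j. q = Inl (j, k))" for q
    using Z past[OF _ that] by auto
  have Zbd: "AE \<omega> in M. norm (Z \<omega> - c) \<le> \<bar>R\<bar>"
    using Z
  proof
    assume "\<exists>a\<le>k. Z = x a"
    then obtain a where "Z = x a" by blast
    then show ?thesis using bd[of a] by (auto elim: eventually_mono)
  qed simp
  have diff: "AE \<omega> in M. norm (x k \<omega> - Z \<omega>) \<le> 2 * \<bar>R\<bar>"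
    using bd[of k] Zbd
  proof eventually_elim
    case (elim \<omega>)
    then show ?case using norm_triangle_ineq4[of "x k \<omega> - c" "Z \<omega> - c"] by simp
  qed
  define m where "m j y = (\<integral>\<omega>. stoch_grad \<gamma> \<xi> j k y \<omega> \<partial>M)" for j y
  note step = async_second_moment_step[where k = k and X = "x k" and Z = Z and \<gamma> = \<gamma> and R = "2 * \<bar>R\<bar>" and v = v,
      OF P iid unif \<gamma> conjunct1[OF sub] sq past past Zm Zm diff]
  have int: "integrable M (\<lambda>\<omega>. m j (x k \<omega>) \<bullet> (x k \<omega> - Z \<omega>))" for j
    using step(1)[of j] by (simp add: m_def)
  have [measurable]: "x k \<in> borel_measurable M" "Z \<in> borel_measurable M"
    using measurable_rest_algebraD[OF past[of k "Inr k"] ind] measurable_rest_algebraD[OF Zm[of "Inr k"] ind] by auto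
  have cont: "continuous_on UNIV (f j)" for j
    using convex_on_continuous[OF open_UNIV convex] .
  have fx: "integrable M (\<lambda>\<omega>. f j (x k \<omega>))" for j
    by (rule integrable_continuous_of_bounded[OF _ cont bd]) simp
  have fZ: "integrable M (\<lambda>\<omega>. f j (Z \<omega>))" for j
    by (rule integrable_continuous_of_bounded[OF _ cont Zbd]) simp
  have "(\<integral>\<omega>. f j (x k \<omega>) \<partial>M) - (\<integral>\<omega>. f j (Z \<omega>) \<partial>M) \<le> (\<integral>\<omega>. m j (x k \<omega>) \<bullet> (x k \<omega> - Z \<omega>) \<partial>M)" for j
  proof -
    have "f j (x k \<omega>) - f j (Z \<omega>) \<le> m j (x k \<omega>) \<bullet> (x k \<omega> - Z \<omega>)" for \<omega>
    proof -
      have "f j (x k \<omega>) + m j (x k \<omega>) \<bullet> (Z \<omega> - x k \<omega>) \<le> f j (Z \<omega>)"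
        using sub[of j k "x k \<omega>"] unfolding m_def subdifferential_def by blast
      then show ?thesis by (simp add: inner_diff_right)
    qed
    then have "(\<integral>\<omega>. f j (x k \<omega>) - f j (Z \<omega>) \<partial>M) \<le> (\<integral>\<omega>. m j (x k \<omega>) \<bullet> (x k \<omega> - Z \<omega>) \<partial>M)"
      using fx fZ int by (intro integral_mono) auto
    then show ?thesis using fx fZ by simp
  qed
  then have "(\<Sum>j\<in>UNIV. w j * ((\<integral>\<omega>. f j (x k \<omega>) \<partial>M) - (\<integral>\<omega>. f j (Z \<omega>) \<partial>M)))
      \<le> (\<Sum>j\<in>UNIV. w j * (\<integral>\<omega>. m j (x k \<omega>) \<bullet> (x k \<omega> - Z \<omega>) \<partial>M))"
    by (intro sum_mono mult_left_mono w)
  then have "(\<integral>\<omega>. (\<Sum>j\<in>UNIV. w j * f j (x k \<omega>)) \<partial>M) - (\<integral>\<omega>. (\<Sum>j\<in>UNIV. w j * f j (Z \<omega>)) \<partial>M)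
      \<le> (\<Sum>j\<in>UNIV. w j * (\<integral>\<omega>. m j (x k \<omega>) \<bullet> (x k \<omega> - Z \<omega>) \<partial>M))"
    using fx fZ by (simp add: right_diff_distrib sum_subtractf)
  then have "2 * \<eta> * ((\<integral>\<omega>. (\<Sum>j\<in>UNIV. w j * f j (x k \<omega>)) \<partial>M) - (\<integral>\<omega>. (\<Sum>j\<in>UNIV. w j * f j (Z \<omega>)) \<partial>M))
      \<le> 2 * \<eta> * (\<Sum>j\<in>UNIV. w j * (\<integral>\<omega>. m j (x k \<omega>) \<bullet> (x k \<omega> - Z \<omega>) \<partial>M))"
    using \<eta> by (intro mult_left_mono) auto
  moreover have "x (Suc k) \<omega> = x k \<omega> - \<eta> *\<^sub>R (\<Sum>j\<in>UNIV. w j *\<^sub>R async_oracle (stoch_grad \<gamma> \<xi>) I k (x k \<omega>) \<omega> j)" for \<omega>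
    by (simp add: x)
  ultimately show ?thesis
    using step(2)[of \<eta> w] by (simp add: mean_le_def m_def)
qed

text \<open>Here \<open>u k\<close> and \<open>d a\<close> are the mean squared distances of iterate \<open>k\<close> from the target and of the last
iterate from iterate \<open>a\<close>, and \<open>h k\<close> is the mean excess of the averaged function at iterate \<open>k\<close>.
Per step, the regret inequality gains \<open>2 * \<eta> * h k\<close> and loses the noise \<open>D^2 / (2 * K)\<close>.
Summing the inequality for \<open>u\<close> over all prefixes, and half of the one for \<open>d\<close> over all
suffixes, cancels the position-weighted sum of the \<open>h k\<close> and bounds the sum of the \<open>u k\<close> in terms of
the plain sum of the \<open>h k\<close>. The more regret is collected, the closer the iterates are
to the target on average, so that regret and bias cannot be maximal together. The range of \<open>q\<close> and
\<open>4 \<le> K\<close> make the resulting linear expression at most \<open>K * \<epsilon>\<close>; for \<open>K = 4\<close> and \<open>q = \<epsilon> / 5\<close> the slack is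
below one percent.\<close>

lemma async_regret_arithmetic:
  fixes u h d :: "nat \<Rightarrow> real" and K :: nat
  assumes K: "4 \<le> K" and D: "0 < D" and \<epsilon>: "0 < \<epsilon>" and q: "\<epsilon> / 6 \<le> q" "q \<le> \<epsilon> / 5"
    and \<eta>: "\<eta> = D\<^sup>2 / (4 * real K * q)"
    and u: "\<And>a. a \<le> K \<Longrightarrow> u a \<le> D\<^sup>2 - 2 * \<eta> * (\<Sum>k<a. h k) + real a * (D\<^sup>2 / (2 * real K))"
    and d: "\<And>a. a < K \<Longrightarrow> d a \<le> - 2 * \<eta> * (\<Sum>k\<in>{a..<K}. h k - h a) + real (K - a) * (D\<^sup>2 / (2 * real K))"
    and ud: "\<And>a. a < K \<Longrightarrow> u a / 2 - u K \<le> d a" and uK: "0 \<le> u K"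
  shows "(\<Sum>k<K. h k) + \<epsilon> / (2 * D) * (\<Sum>k<K. 2 / 5 * D + 5 / 8 * u k / D) \<le> real K * \<epsilon>"
proof -
  define H where "H = (\<Sum>k<K. h k)"
  define W where "W = (\<Sum>k<K. real (k + 1) * h k)"
  define U where "U = (\<Sum>k<K. u k)"
  have prefix: "(\<Sum>a<n. \<Sum>k<a. h k) = real n * (\<Sum>k<n. h k) - (\<Sum>k<n. real (k + 1) * h k)" for n
    by (induction n) (auto simp: algebra_simps)
  have suffix: "(\<Sum>a<n. \<Sum>k\<in>{a..<n}. h k) = (\<Sum>k<n. real (k + 1) * h k)" for n
    by (induction n) (auto simp: algebra_simps sum.distrib)
  have diag: "(\<Sum>a<n. real (n - a) * h a) = real (n + 1) * (\<Sum>k<n. h k) - (\<Sum>k<n. real (k + 1) * h k)" for n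
  proof -
    have "(\<Sum>a<n. real (n - a) * h a) = (\<Sum>a<n. real (n + 1) * h a - real (a + 1) * h a)"
      by (intro sum.cong) (auto simp: algebra_simps of_nat_diff)
    then show ?thesis by (simp add: sum_subtractf sum_distrib_left)
  qed
  have s1: "(\<Sum>a<n. real a) = real n * (real n - 1) / 2" for n
    by (induction n) (auto simp: field_simps)
  have s2: "(\<Sum>a<n. real (n - a)) = real n * (real n + 1) / 2" for n
  proof -
    have "(\<Sum>a<n. real (n - a)) = (\<Sum>a<n. real n - real a)" by (intro sum.cong) (auto simp: of_nat_diff)
    then show ?thesis by (simp add: sum_subtractf s1 field_simps)
  qed
  have q0: "0 < q" using q \<epsilon> by linarith
  have K0: "0 < real K" using K by simp
  have "U \<le> (\<Sum>a<K. D\<^sup>2 - 2 * \<eta> * (\<Sum>k<a. h k) + real a * (D\<^sup>2 / (2 * real K)))"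
    unfolding U_def by (intro sum_mono u) simp
  also have "\<dots> = real K * D\<^sup>2 - 2 * \<eta> * (real K * H - W) + (real K * (real K - 1) / 2) * (D\<^sup>2 / (2 * real K))"
    unfolding sum.distrib sum_subtractf sum_distrib_left[symmetric] sum_distrib_right[symmetric] prefix s1
    by (simp add: H_def W_def)
  also have "(real K * (real K - 1) / 2) * (D\<^sup>2 / (2 * real K)) = (real K - 1) / 4 * D\<^sup>2"
    using K0 by simp
  finally have U1: "U \<le> real K * D\<^sup>2 - 2 * \<eta> * (real K * H - W) + (real K - 1) / 4 * D\<^sup>2" .
  have "U / 2 - real K * u K = (\<Sum>a<K. u a / 2 - u K)"
    unfolding U_def by (simp add: sum_subtractf sum_divide_distrib)
  also have "\<dots> \<le> (\<Sum>a<K. - 2 * \<eta> * (\<Sum>k\<in>{a..<K}. h k - h a) + real (K - a) * (D\<^sup>2 / (2 * real K)))"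
    by (intro sum_mono order_trans[OF ud d]) auto
  also have "\<dots> = - 2 * \<eta> * (W - (real (K + 1) * H - W)) + (real K * (real K + 1) / 2) * (D\<^sup>2 / (2 * real K))"
  proof -
    have "(\<Sum>a<K. \<Sum>k\<in>{a..<K}. h k - h a) = W - (real (K + 1) * H - W)"
      using diag[of K] unfolding sum_subtractf suffix by (simp add: H_def W_def del: of_nat_add of_nat_diff)
    then show ?thesis
      unfolding sum.distrib sum_distrib_left[symmetric] sum_distrib_right[symmetric] s2 by simp
  qed
  also have "(real K * (real K + 1) / 2) * (D\<^sup>2 / (2 * real K)) = (real K + 1) / 4 * D\<^sup>2"
    using K0 by simp
  finally have U2: "U / 2 - real K * u K \<le> - 2 * \<eta> * (2 * W - (real K + 1) * H) + (real K + 1) / 4 * D\<^sup>2"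
    by (simp add: algebra_simps)
  \<comment> \<open>The weighted sum W cancels in the first inequality plus half of the second one.\<close>
  have U3: "5 / 4 * U \<le> (11 / 8 * real K - 1 / 8) * D\<^sup>2 - \<eta> * (real K - 1) * H + real K * u K / 2"
  proof -
    define A where "A = \<eta> * W"
    define B where "B = \<eta> * H"
    define C where "C = \<eta> * (real K * H)"
    define E where "E = real K * D\<^sup>2"
    have "U \<le> E - 2 * C + 2 * A + E / 4 - D\<^sup>2 / 4"
      using U1 by (simp add: A_def C_def E_def algebra_simps diff_divide_distrib)
    moreover have "U / 2 - real K * u K \<le> 2 * C + 2 * B - 4 * A + E / 4 + D\<^sup>2 / 4"
      using U2 by (simp add: A_def B_def C_def E_def algebra_simps add_divide_distrib)
    ultimately have "5 / 4 * U \<le> 11 / 8 * E - 1 / 8 * D\<^sup>2 - (C - B) + real K * u K / 2"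
      by linarith
    then show ?thesis by (simp add: B_def C_def E_def algebra_simps)
  qed
  have \<eta>0: "0 < \<eta>" using D q0 K0 by (simp add: \<eta>)
  have "2 * \<eta> * H \<le> 3 / 2 * D\<^sup>2 - u K"
    using u[of K] K0 by (simp add: H_def)
  then have H1: "H \<le> 3 * real K * q - 2 * real K * q * (u K / D\<^sup>2)"
    using D q0 K0 by (simp add: \<eta> field_simps)
  \<comment> \<open>From here on all quantities are dimensionless: lengths in units of D, function values in units of q.\<close>
  define v where "v = u K / D\<^sup>2"
  have v: "0 \<le> v" "u K = v * D\<^sup>2" using uK D by (simp_all add: v_def)
  define t where "t = \<epsilon> / q"
  have t: "5 \<le> t" "t \<le> 6" "t * q = \<epsilon>" using q q0 \<epsilon> by (simp_all add: t_def field_simps)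
  have "5 / 4 * (U / D\<^sup>2) \<le> (11 / 8 * real K - 1 / 8) - (real K - 1) / (4 * real K) * (H / q) + real K * v / 2"
  proof -
    have "5 / 4 * U / D\<^sup>2 \<le> ((11 / 8 * real K - 1 / 8) * D\<^sup>2 - \<eta> * (real K - 1) * H + real K * u K / 2) / D\<^sup>2"
      using U3 D by (intro divide_right_mono) auto
    also have "\<dots> = (11 / 8 * real K - 1 / 8) - (real K - 1) / (4 * real K) * (H / q) + real K * v / 2"
      using D q0 K0 by (simp add: v(2) \<eta> field_simps)
    finally show ?thesis by simp
  qed
  moreover define Y where "Y = U / D\<^sup>2"
  moreover define G where "G = H / q"
  ultimately have Y: "5 / 4 * Y \<le> (11 / 8 * real K - 1 / 8) - (real K - 1) / (4 * real K) * G + real K * v / 2"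
    by simp
  have G: "G \<le> 3 * real K - 2 * real K * v"
    using H1 q0 by (simp add: G_def v_def field_simps)
  have Hq: "H = G * q" using q0 by (simp add: G_def)
  have main: "G + t * (real K / 5 + 5 / 16 * Y) \<le> real K * t"
  proof -
    define c where "c = (real K - 1) / (4 * real K)"
    have c: "0 \<le> c" "c \<le> 1 / 4" "4 * c * real K = real K - 1" using K0 K by (simp_all add: c_def field_simps)
    have "t * (5 / 16 * Y) \<le> t * (1 / 4 * ((11 / 8 * real K - 1 / 8) - c * G + real K * v / 2))"
      using Y t unfolding c_def by (intro mult_left_mono) auto
    moreover have "(1 - t * c / 4) * G \<le> (1 - t * c / 4) * (3 * real K - 2 * real K * v)"
    proof (intro mult_left_mono G)
      have "t * c \<le> 6 * (1 / 4)" using t c by (intro mult_mono) auto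
      then show "0 \<le> 1 - t * c / 4" by linarith
    qed
    moreover have "(1 - t * c / 4) * (3 * real K - 2 * real K * v) + t * (real K / 5 + 1 / 4 * ((11 / 8 * real K - 1 / 8) + real K * v / 2)) \<le> real K * t"
    proof -
      have "t * c * real K = t * (4 * c * real K) / 4" by simp
      then have ck: "t * c * real K = t * (real K - 1) / 4" unfolding c(3) .
      have "(1 - t * c / 4) * (3 * real K - 2 * real K * v) = 3 * real K - 2 * real K * v - 3 / 4 * (t * c * real K) + (t * c * real K) * v / 2"
        by (simp add: field_simps)
      also have "\<dots> = 3 * real K - 2 * real K * v - 3 / 16 * t * (real K - 1) + t * (real K - 1) * v / 8"
        unfolding ck by (simp add: field_simps)
      finally have e: "(1 - t * c / 4) * (3 * real K - 2 * real K * v)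
         = 3 * real K - 2 * real K * v - 3 / 16 * t * (real K - 1) + t * (real K - 1) * v / 8" .
      define A where "A = t * real K"
      define B where "B = real K * v"
      define C where "C = t * v"
      define E where "E = t * (real K * v)"
      have "E \<le> 6 * B" unfolding E_def B_def using t v K0 by (intro mult_right_mono) auto
      moreover have "0 \<le> C" "0 \<le> B" using t v K0 by (auto simp: B_def C_def)
      moreover have "5 * real K \<le> A" "4 * t \<le> A"
        unfolding A_def using t K by (auto intro: mult_right_mono simp: mult.commute)
      ultimately have "3 * real K - 2 * B - 3 / 16 * (A - t) + (E - C) / 8
          + (A / 5 + 11 / 32 * A - t / 32 + E / 8) \<le> A"
        using K0 by (simp add: field_simps)
      then show ?thesis unfolding e
        by (simp add: A_def B_def C_def E_def algebra_simps add_divide_distrib diff_divide_distrib)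
    qed
    ultimately show ?thesis by (simp add: algebra_simps)
  qed
  have "H + \<epsilon> / (2 * D) * (\<Sum>k<K. 2 / 5 * D + 5 / 8 * u k / D) = q * (G + t * (real K / 5 + 5 / 16 * Y))"
  proof -
    have "(\<Sum>k<K. 2 / 5 * D + 5 / 8 * u k / D) = real K * (2 / 5 * D) + 5 / 8 * U / D"
      unfolding sum.distrib U_def by (simp add: sum_distrib_left sum_divide_distrib)
    then have "H + \<epsilon> / (2 * D) * (\<Sum>k<K. 2 / 5 * D + 5 / 8 * u k / D)
        = H + \<epsilon> / (2 * D) * (real K * (2 / 5 * D) + 5 / 8 * U / D)"
      by simp
    also have "\<dots> = H + \<epsilon> * (real K / 5 + 5 / 16 * Y)"
      using D by (simp add: Y_def field_simps power2_eq_square)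
    also have "\<dots> = G * q + (t * q) * (real K / 5 + 5 / 16 * Y)"
      unfolding t(3) Hq ..
    finally show ?thesis by (simp add: algebra_simps)
  qed
  also have "\<dots> \<le> q * (real K * t)" using main q0 by (intro mult_left_mono) auto
  also have "\<dots> = real K * \<epsilon>" unfolding t(3)[symmetric] by simp
  finally show ?thesis by (simp add: H_def)
qed

text \<open>Both bounds on \<open>q = \<eta> * V / 2\<close>, the noise per step in units of function values, come from
\<open>q^2 = D^2 * V / (8 * K)\<close>. Rounding the number of iterations down changes this by a factor of at most \<open>5 / 4\<close>,
because \<open>4 \<le> K\<close>.\<close>

lemma async_step_size_range:
  fixes D V \<epsilon> \<eta> :: real and K :: nat
  assumes D: "0 < D" and V: "0 < V" and \<epsilon>: "0 < \<epsilon>" and K: "4 \<le> K"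
    and Ka: "real K \<le> 4 * D\<^sup>2 * V / \<epsilon>\<^sup>2" "4 * D\<^sup>2 * V / \<epsilon>\<^sup>2 < real K + 1"
    and \<eta>: "\<eta> = sqrt (D\<^sup>2 / (2 * real K * V))"
  shows "\<eta>\<^sup>2 * V = D\<^sup>2 / (2 * real K)" "\<eta> = D\<^sup>2 / (4 * real K * (\<eta> * V / 2))"
    "\<epsilon> / 6 \<le> \<eta> * V / 2" "\<eta> * V / 2 \<le> \<epsilon> / 5"
proof -
  have K0: "0 < real K" using K by simp
  have e2: "\<eta>\<^sup>2 = D\<^sup>2 / (2 * real K * V)" using V K0 by (simp add: \<eta>)
  have e0: "0 < \<eta>" using V K0 D by (simp add: \<eta>)
  show e3: "\<eta>\<^sup>2 * V = D\<^sup>2 / (2 * real K)" using V by (simp add: e2)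
  show "\<eta> = D\<^sup>2 / (4 * real K * (\<eta> * V / 2))"
  proof -
    have "D\<^sup>2 = 2 * real K * (\<eta>\<^sup>2 * V)" using K0 by (simp add: e3)
    then show ?thesis using e0 V K0 by (simp add: power2_eq_square)
  qed
  define q where "q = \<eta> * V / 2"
  have q0: "0 \<le> q" using e0 V by (simp add: q_def)
  have "q\<^sup>2 = (\<eta>\<^sup>2 * V) * V / 4" by (simp add: q_def power2_eq_square)
  also have "\<dots> = D\<^sup>2 * V / (8 * real K)" by (simp add: e3)
  finally have q2: "q\<^sup>2 * (8 * real K) = D\<^sup>2 * V" using K0 by simp
  have a1: "real K * \<epsilon>\<^sup>2 \<le> 4 * D\<^sup>2 * V" "4 * D\<^sup>2 * V < (real K + 1) * \<epsilon>\<^sup>2"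
    using Ka \<epsilon> by (simp_all add: pos_le_divide_eq pos_divide_less_eq)
  have q2': "4 * D\<^sup>2 * V = real K * (32 * q\<^sup>2)"
  proof -
    have "4 * D\<^sup>2 * V = 4 * (q\<^sup>2 * (8 * real K))" unfolding q2 by simp
    then show ?thesis by simp
  qed
  have "real K * \<epsilon>\<^sup>2 \<le> real K * (32 * q\<^sup>2)" using a1(1) unfolding q2' .
  then have "\<epsilon>\<^sup>2 \<le> 32 * q\<^sup>2" using K0 by simp
  then have "\<epsilon>\<^sup>2 \<le> 36 * q\<^sup>2" using zero_le_power2[of q] by linarith
  then have "(\<epsilon> / 6)\<^sup>2 \<le> q\<^sup>2" by (simp add: power_divide)
  then show "\<epsilon> / 6 \<le> \<eta> * V / 2" using power2_le_imp_le[OF _ q0, of "\<epsilon> / 6"] unfolding q_def by blast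
  have "real K + 1 \<le> 5 / 4 * real K" using K by simp
  then have "(real K + 1) * \<epsilon>\<^sup>2 \<le> 5 / 4 * real K * \<epsilon>\<^sup>2" by (intro mult_right_mono) auto
  then have "real K * (32 * q\<^sup>2) \<le> real K * (5 / 4 * \<epsilon>\<^sup>2)" using a1(2) unfolding q2' by simp
  then have "32 * q\<^sup>2 \<le> 5 / 4 * \<epsilon>\<^sup>2" using K0 by simp
  then have "25 * q\<^sup>2 \<le> \<epsilon>\<^sup>2" using zero_le_power2[of \<epsilon>] by linarith
  then have "q\<^sup>2 \<le> (\<epsilon> / 5)\<^sup>2" by (simp add: power_divide)
  then show "\<eta> * V / 2 \<le> \<epsilon> / 5" using power2_le_imp_le[of q "\<epsilon> / 5"] \<epsilon> by (simp add: q_def)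
qed

text \<open>If \<open>B * D \<le> \<epsilon>\<close>, then the subgradient inequality bounds every single error by \<open>\<epsilon>\<close>. Otherwise the budget
allows at least four iterations, and the regret inequalities against the target and against all
earlier iterates apply.\<close>

lemma async_collaboration:
  fixes M :: "'w measure" and S :: "'n::finite \<Rightarrow> 's measure" and \<gamma> :: "'n \<Rightarrow> 's \<Rightarrow> 'a::euclidean_space \<Rightarrow> 'a"
    and i :: 'n and K :: nat
  assumes P: "prob_space M" and iid: "iid_seeds M S \<xi>" and unif: "uniform_agents M S \<xi> I"
    and \<gamma>: "\<And>j. (\<lambda>(s, x). \<gamma> j s x) \<in> borel_measurable (S j \<Otimes>\<^sub>M borel)"
    and convex: "\<And>j. convex_on UNIV (f j)"
    and sub: "\<And>j k y. integrable M (stoch_grad \<gamma> \<xi> j k y) \<and> (\<integral>\<omega>. stoch_grad \<gamma> \<xi> j k y \<omega> \<partial>M) \<in> subdifferential (f j) y"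
    and sq: "\<And>j k y. mean_le M (\<lambda>\<omega>. (norm (stoch_grad \<gamma> \<xi> j k y \<omega>))\<^sup>2) (B\<^sup>2)"
    and x: "x = wga (async_oracle (stoch_grad \<gamma> \<xi>) I) w \<eta> x0"
    and w: "\<And>j. 0 \<le> w j" "(\<Sum>j\<in>UNIV. w j) = 1"
    and close: "\<And>j k y. w j \<noteq> 0 \<Longrightarrow>
      norm ((\<integral>\<omega>. stoch_grad \<gamma> \<xi> i k y \<omega> \<partial>M) - (\<integral>\<omega>. stoch_grad \<gamma> \<xi> j k y \<omega> \<partial>M)) \<le> \<epsilon> / (2 * D)"
    and B: "0 < B" and D: "0 < D" and \<epsilon>: "0 < \<epsilon>"
    and V: "V = real CARD('n) * B\<^sup>2 * (\<Sum>j\<in>UNIV. (w j)\<^sup>2)" "B\<^sup>2 \<le> V"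
    and K: "K = max 1 (nat \<lfloor>4 * D\<^sup>2 * V / \<epsilon>\<^sup>2\<rfloor>)"
    and \<eta>: "\<eta> = sqrt (D\<^sup>2 / (2 * real K * V))"
    and bd: "AE \<omega> in M. \<forall>k. norm (x k \<omega> - c) \<le> D"
  shows "mean_le M (\<lambda>\<omega>. 1 / real K * (\<Sum>k<K. f i (x k \<omega>)) - f i c) \<epsilon>"
proof -
  interpret prob_space M by fact
  have bdk: "AE \<omega> in M. norm (x k \<omega> - c) \<le> D" for k using bd by eventually_elim simp
  have K1: "1 \<le> K" using K by simp
  then have K0: "0 < real K" by simp
  have cont: "continuous_on UNIV (f j)" for j
    using convex_on_continuous[OF open_UNIV convex] .
  have [measurable]: "x k \<in> borel_measurable M" for k
    unfolding x by (rule async_iterate_measurable[OF \<gamma> iid_seeds_indep(2)[OF P iid] seeds_and_draws_indep(2)[OF P iid unif]])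
  have fx: "integrable M (\<lambda>\<omega>. f j (x k \<omega>))" for j k
    by (rule integrable_continuous_of_bounded[OF _ cont bdk]) simp
  have int: "integrable M (\<lambda>\<omega>. 1 / real K * (\<Sum>k<K. f i (x k \<omega>)) - f i c)" using fx by simp
  define e where "e k = (\<integral>\<omega>. f i (x k \<omega>) - f i c \<partial>M)" for k
  have val: "(\<integral>\<omega>. 1 / real K * (\<Sum>k<K. f i (x k \<omega>)) - f i c \<partial>M) = (\<Sum>k<K. e k) / real K"
  proof -
    have "(\<Sum>k<K. e k) = (\<Sum>k<K. \<integral>\<omega>. f i (x k \<omega>) \<partial>M) - real K * f i c"
      using fx by (simp add: e_def prob_space sum_subtractf)
    then show ?thesis using fx K0 by (simp add: prob_space diff_divide_distrib)
  qed
  have "(\<Sum>k<K. e k) \<le> real K * \<epsilon>"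
  proof (cases "B * D \<le> \<epsilon>")
    case True
    have "e k \<le> \<epsilon>" for k
    proof -
      have "AE \<omega> in M. f i (x k \<omega>) - f i c \<le> \<epsilon>"
        using bdk[of k]
      proof eventually_elim
        case (elim \<omega>)
        let ?m = "\<integral>\<omega>'. stoch_grad \<gamma> \<xi> i k (x k \<omega>) \<omega>' \<partial>M"
        have "f i (x k \<omega>) + ?m \<bullet> (c - x k \<omega>) \<le> f i c"
          using sub[of i k "x k \<omega>"] unfolding subdifferential_def by blast
        moreover have "- (?m \<bullet> (c - x k \<omega>)) \<le> norm ?m * norm (x k \<omega> - c)"
          using norm_cauchy_schwarz[of ?m "x k \<omega> - c"] by (simp add: inner_diff_right)
        moreover have "(norm ?m)\<^sup>2 \<le> B\<^sup>2"
          by (rule norm_mean_square_le[OF conjunct1[OF sub] sq])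
        then have "norm ?m \<le> B" by (rule power2_le_imp_le) (use B in simp)
        then have "norm ?m * norm (x k \<omega> - c) \<le> B * D" using elim B by (intro mult_mono) auto
        ultimately show ?case using True by linarith
      qed
      then have "e k \<le> (\<integral>\<omega>. \<epsilon> \<partial>M)" unfolding e_def using fx by (intro integral_mono_AE) auto
      then show ?thesis by (simp add: prob_space)
    qed
    then have "(\<Sum>k<K. e k) \<le> (\<Sum>k<K. \<epsilon>)" by (intro sum_mono)
    then show ?thesis by simp
  next
    case False
    have s0: "0 < V" using B V(2) by (meson less_le_trans zero_less_power)
    define A where "A = 4 * D\<^sup>2 * V / \<epsilon>\<^sup>2"
    have "4 < A"
    proof -
      have "\<epsilon>\<^sup>2 < (B * D)\<^sup>2" using False \<epsilon> by (intro power_strict_mono) auto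
      also have "\<dots> \<le> D\<^sup>2 * V" using V(2) D by (simp add: power_mult_distrib mult.commute)
      finally show ?thesis using \<epsilon> by (simp add: A_def pos_less_divide_eq)
    qed
    then have fl: "4 \<le> \<lfloor>A\<rfloor>" by (simp add: le_floor_iff)
    then have KA: "real K = of_int \<lfloor>A\<rfloor>" using K by (simp add: A_def)
    then have K4: "4 \<le> K" using fl by linarith
    have Ka: "real K \<le> A" "A < real K + 1" unfolding KA by linarith+
    define q where "q = \<eta> * V / 2"
    note range = async_step_size_range[OF D s0 \<epsilon> K4 Ka[unfolded A_def] \<eta>, folded q_def]
    have \<eta>0: "0 \<le> \<eta>" using s0 by (simp add: \<eta>)
    define \<phi> where "\<phi> y = (\<Sum>j\<in>UNIV. w j * f j y)" for y
    have \<phi>x: "integrable M (\<lambda>\<omega>. \<phi> (x k \<omega>))" for k unfolding \<phi>_def using fx by simp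
    define h where "h k = (\<integral>\<omega>. \<phi> (x k \<omega>) \<partial>M) - \<phi> c" for k
    define u where "u k = (\<integral>\<omega>. (norm (x k \<omega> - c))\<^sup>2 \<partial>M)" for k
    define d where "d a k = (\<integral>\<omega>. (norm (x k \<omega> - x a \<omega>))\<^sup>2 \<partial>M)" for a k
    have u2: "integrable M (\<lambda>\<omega>. (norm (x k \<omega> - c))\<^sup>2)" for k
    proof (rule integrable_const_bound)
      show "AE \<omega> in M. norm ((norm (x k \<omega> - c))\<^sup>2) \<le> D\<^sup>2"
        using bdk[of k] by eventually_elim (simp add: power_mono)
    qed simp
    have d2: "integrable M (\<lambda>\<omega>. (norm (x k \<omega> - x a \<omega>))\<^sup>2)" for k a
    proof -
      have "integrable M (\<lambda>\<omega>. (norm ((x k \<omega> - c) + - (x a \<omega> - c)))\<^sup>2)"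
        using u2 by (intro integrable_add_square) (simp_all only: norm_minus_cancel, simp_all)
      then show ?thesis by simp
    qed
    define C where "C = D\<^sup>2 / (2 * real K)"
    note step = async_regret_step[where f = f and k = k and R = D and c = c and Z = Z for k Z,
        OF P iid unif \<gamma> convex sub sq x w(1) \<eta>0 bdk, folded V(1) \<phi>_def, unfolded range(1), folded C_def]
    have u_step: "u (Suc k) \<le> u k - 2 * \<eta> * h k + C" for k
      using step[of "\<lambda>_. c" k] by (simp add: u_def h_def prob_space)
    have d_step: "d a (Suc k) \<le> d a k - 2 * \<eta> * (h k - h a) + C" if "a \<le> k" for a k
      using step[of "x a" k] that by (auto simp: d_def h_def)
    have u0: "u 0 \<le> D\<^sup>2"
    proof -
      have "u 0 \<le> (\<integral>\<omega>. D\<^sup>2 \<partial>M)"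
        unfolding u_def using u2[of 0] bdk[of 0]
        by (intro integral_mono_AE) (auto elim!: eventually_mono intro: power_mono)
      then show ?thesis by (simp add: prob_space)
    qed
    have u_sum: "u a \<le> D\<^sup>2 - 2 * \<eta> * (\<Sum>k<a. h k) + real a * (C)" for a
    proof (induction a)
      case (Suc a)
      then show ?case using u_step[of a] by (simp add: algebra_simps)
    qed (use u0 in simp)
    have d_sum: "d a (a + n) \<le> - 2 * \<eta> * (\<Sum>k\<in>{a..<a + n}. h k - h a) + real n * (C)" for a n
    proof (induction n)
      case (Suc n)
      then show ?case using d_step[of a "a + n"] by (simp add: algebra_simps)
    qed (simp add: d_def)
    \<comment> \<open>If the last iterate is close to the target, then it is far from the iterates that are not.\<close>
    have ud: "u a / 2 - u k \<le> d a k" for a k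
    proof -
      have "(norm (x a \<omega> - c))\<^sup>2 \<le> 2 * (norm (x k \<omega> - x a \<omega>))\<^sup>2 + 2 * (norm (x k \<omega> - c))\<^sup>2" for \<omega>
      proof -
        define p where "p = x k \<omega> - c"
        define r where "r = x k \<omega> - x a \<omega>"
        have "(norm (x a \<omega> - c))\<^sup>2 = (norm (p - r))\<^sup>2" by (simp add: p_def r_def)
        moreover have "(norm (p - r))\<^sup>2 + (norm (p + r))\<^sup>2 = 2 * (norm r)\<^sup>2 + 2 * (norm p)\<^sup>2"
          by (simp add: power2_norm_eq_inner inner_diff inner_add inner_commute)
        moreover have "0 \<le> (norm (p + r))\<^sup>2" by simp
        ultimately have "(norm (x a \<omega> - c))\<^sup>2 \<le> 2 * (norm r)\<^sup>2 + 2 * (norm p)\<^sup>2" by linarith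
        then show ?thesis by (simp add: p_def r_def)
      qed
      then have "u a \<le> (\<integral>\<omega>. 2 * (norm (x k \<omega> - x a \<omega>))\<^sup>2 + 2 * (norm (x k \<omega> - c))\<^sup>2 \<partial>M)"
        unfolding u_def using u2 d2 by (intro integral_mono) auto
      also have "\<dots> = 2 * d a k + 2 * u k" unfolding u_def d_def using u2 d2 by simp
      finally show ?thesis by simp
    qed
    have main: "(\<Sum>k<K. h k) + \<epsilon> / (2 * D) * (\<Sum>k<K. 2 / 5 * D + 5 / 8 * u k / D) \<le> real K * \<epsilon>"
    proof (rule async_regret_arithmetic[where u = u and d = "\<lambda>a. d a K", OF K4 D \<epsilon> range(3,4,2)])
      show "d a K \<le> - 2 * \<eta> * (\<Sum>k\<in>{a..<K}. h k - h a) + real (K - a) * (D\<^sup>2 / (2 * real K))" if "a < K" for a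
        using d_sum[of a "K - a"] that by (simp add: C_def)
      show "0 \<le> u K" by (simp add: u_def)
    qed (rule u_sum[unfolded C_def] ud)+
    have "e k \<le> h k + \<epsilon> / (2 * D) * (2 / 5 * D + 5 / 8 * u k / D)" for k
    proof -
      have pt: "f i y - f i c \<le> \<phi> y - \<phi> c + \<epsilon> / (2 * D) * norm (y - c)" for y
      proof -
        have "w j * ((f i y - f i c) - (f j y - f j c)) \<le> w j * (\<epsilon> / (2 * D) * norm (y - c))" for j
        proof (cases "w j = 0")
          case False
          have "(f i y - f j y) - (f i c - f j c) \<le> \<epsilon> / (2 * D) * norm (y - c)"
            by (rule convex_difference_Lipschitz[OF conjunct2[OF sub[of i 0]] conjunct2[OF sub[of j 0]]])
              (rule close[OF False])
          then show ?thesis by (intro mult_left_mono w(1)) simp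
        qed simp
        then have "(\<Sum>j\<in>UNIV. w j * ((f i y - f i c) - (f j y - f j c))) \<le> (\<Sum>j\<in>UNIV. w j * (\<epsilon> / (2 * D) * norm (y - c)))"
          by (rule sum_mono)
        moreover have "(\<Sum>j\<in>UNIV. w j * ((f i y - f i c) - (f j y - f j c)))
            = (\<Sum>j\<in>UNIV. w j) * (f i y - f i c) - (\<phi> y - \<phi> c)"
          by (simp add: \<phi>_def right_diff_distrib sum_subtractf sum_distrib_right)
        ultimately show ?thesis unfolding sum_distrib_right[symmetric] using w(2) by simp
      qed
      \<comment> \<open>This is exact at r = 4 D / 5, near the root mean square distance in the critical case.\<close>
      have am: "r \<le> 2 / 5 * D + 5 / 8 * r\<^sup>2 / D" for r
      proof -
        have "0 \<le> (5 * r - 4 * D)\<^sup>2 / (40 * D)" using D by simp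
        also have "\<dots> = 2 / 5 * D + 5 / 8 * r\<^sup>2 / D - r"
          using D by (simp add: field_simps power2_eq_square)
        finally show ?thesis by simp
      qed
      have "e k \<le> (\<integral>\<omega>. \<phi> (x k \<omega>) - \<phi> c + \<epsilon> / (2 * D) * (2 / 5 * D + 5 / 8 * (norm (x k \<omega> - c))\<^sup>2 / D) \<partial>M)"
        unfolding e_def
      proof (rule integral_mono)
        show "integrable M (\<lambda>\<omega>. f i (x k \<omega>) - f i c)" using fx by simp
        show "integrable M (\<lambda>\<omega>. \<phi> (x k \<omega>) - \<phi> c + \<epsilon> / (2 * D) * (2 / 5 * D + 5 / 8 * (norm (x k \<omega> - c))\<^sup>2 / D))"
          using \<phi>x u2 by simp
        fix \<omega>
        have "\<epsilon> / (2 * D) * norm (x k \<omega> - c) \<le> \<epsilon> / (2 * D) * (2 / 5 * D + 5 / 8 * (norm (x k \<omega> - c))\<^sup>2 / D)"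
          using \<epsilon> D by (intro mult_left_mono am) auto
        then show "f i (x k \<omega>) - f i c \<le> \<phi> (x k \<omega>) - \<phi> c + \<epsilon> / (2 * D) * (2 / 5 * D + 5 / 8 * (norm (x k \<omega> - c))\<^sup>2 / D)"
          using pt[of "x k \<omega>"] by linarith
      qed
      also have "\<dots> = h k + \<epsilon> / (2 * D) * (2 / 5 * D + 5 / 8 * u k / D)"
        using \<phi>x u2 by (simp add: h_def u_def prob_space)
      finally show ?thesis .
    qed
    then have "(\<Sum>k<K. e k) \<le> (\<Sum>k<K. h k + \<epsilon> / (2 * D) * (2 / 5 * D + 5 / 8 * u k / D))"
      by (intro sum_mono)
    also have "\<dots> = (\<Sum>k<K. h k) + \<epsilon> / (2 * D) * (\<Sum>k<K. 2 / 5 * D + 5 / 8 * u k / D)"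
      by (subst sum.distrib) (simp only: sum_distrib_left)
    finally show ?thesis using main by linarith
  qed
  then have "(\<Sum>k<K. e k) / real K \<le> \<epsilon>" using K0 by (simp add: pos_divide_le_eq mult.commute)
  then show ?thesis using int val by (simp add: mean_le_def)
qed

section \<open>Smooth and strongly convex functions\<close>

lemma GDERIV_gradient:
  assumes "L_smooth L f" shows "GDERIV f x :> gradient f x"
proof -
  obtain D where D: "GDERIV f x :> D" using assms unfolding L_smooth_def by blast
  have "D' = D" if "GDERIV f x :> D'" for D'
  proof -
    have "(\<lambda>h. h \<bullet> D') = (\<lambda>h. h \<bullet> D)"
      using that D unfolding gderiv_def by (rule has_derivative_unique)
    then have "(D' - D) \<bullet> D' = (D' - D) \<bullet> D" by (rule fun_cong)
    then have "(D' - D) \<bullet> (D' - D) = 0" by (simp add: inner_diff_right)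
    then show ?thesis by simp
  qed
  then show ?thesis using D unfolding gradient_def by (metis (no_types, lifting) the_equality)
qed

lemma L_smooth_continuous: "L_smooth L f \<Longrightarrow> continuous_on UNIV f"
  using GDERIV_gradient[of L f] unfolding gderiv_def
  by (intro continuous_at_imp_continuous_on ballI has_derivative_continuous) blast

lemma L_smooth_gradient_continuous:
  assumes "L_smooth L f" shows "continuous_on UNIV (gradient f)"
proof (rule continuous_on_iff[THEN iffD2], intro ballI allI impI)
  fix x and e :: real assume e: "0 < e"
  have lip: "norm (gradient f x - gradient f y) \<le> L * norm (x - y)" for x y
    using assms by (simp add: L_smooth_def)
  have "dist (gradient f y) (gradient f x) < e" if "dist y x < e / (\<bar>L\<bar> + 1)" for y
  proof -
    have "dist (gradient f y) (gradient f x) \<le> (\<bar>L\<bar> + 1) * dist y x"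
      unfolding dist_norm by (rule order_trans[OF lip]) (intro mult_right_mono, auto)
    also have "\<dots> < e" using that by (simp add: pos_less_divide_eq mult.commute)
    finally show ?thesis .
  qed
  then show "\<exists>d>0. \<forall>y\<in>UNIV. dist y x < d \<longrightarrow> dist (gradient f y) (gradient f x) < e"
    using e by (intro exI[of _ "e / (\<bar>L\<bar> + 1)"]) auto
qed

lemma gradient_along_line:
  assumes "L_smooth L f"
  shows "((\<lambda>t. f (x + t *\<^sub>R d)) has_real_derivative gradient f (x + t *\<^sub>R d) \<bullet> d) (at t)"
proof -
  have "((\<lambda>t. x + t *\<^sub>R d) has_derivative (\<lambda>s. s *\<^sub>R d)) (at t)"
    by (auto intro!: derivative_eq_intros)
  moreover have "(f has_derivative (\<lambda>h. h \<bullet> gradient f (x + t *\<^sub>R d))) (at (x + t *\<^sub>R d))"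
    using GDERIV_gradient[OF assms] by (simp add: gderiv_def)
  ultimately have "((\<lambda>t. f (x + t *\<^sub>R d)) has_derivative (\<lambda>s. (s *\<^sub>R d) \<bullet> gradient f (x + t *\<^sub>R d))) (at t)"
    by (rule has_derivative_compose)
  moreover have "(\<lambda>s. (s *\<^sub>R d) \<bullet> gradient f (x + t *\<^sub>R d)) = (*) (gradient f (x + t *\<^sub>R d) \<bullet> d)"
    by (simp add: fun_eq_iff inner_commute mult.commute)
  ultimately show ?thesis by (simp add: has_field_derivative_def)
qed

lemma L_smooth_upper:
  assumes "L_smooth L f"
  shows "f v \<le> f x + gradient f x \<bullet> (v - x) + L / 2 * (norm (v - x))\<^sup>2"
proof -
  define d where "d = v - x"
  define \<phi> where "\<phi> t = f (x + t *\<^sub>R d) - t * (gradient f x \<bullet> d) - L / 2 * t\<^sup>2 * (norm d)\<^sup>2" for t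
  have der: "(\<phi> has_real_derivative (gradient f (x + t *\<^sub>R d) \<bullet> d - gradient f x \<bullet> d - L * t * (norm d)\<^sup>2)) (at t)" for t
    unfolding \<phi>_def
    by (rule derivative_eq_intros gradient_along_line[OF assms] refl | simp)+
  have "\<phi> 1 \<le> \<phi> 0"
  proof (rule DERIV_nonpos_imp_nonincreasing[of 0 1])
    fix t :: real assume t: "0 \<le> t"
    have "gradient f (x + t *\<^sub>R d) \<bullet> d - gradient f x \<bullet> d = (gradient f (x + t *\<^sub>R d) - gradient f x) \<bullet> d"
      by (simp add: inner_diff_left)
    also have "\<dots> \<le> norm (gradient f (x + t *\<^sub>R d) - gradient f x) * norm d" by (rule norm_cauchy_schwarz)
    also have "\<dots> \<le> (L * norm (x + t *\<^sub>R d - x)) * norm d"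
      using assms unfolding L_smooth_def by (intro mult_right_mono) (blast, simp)
    also have "\<dots> = L * t * (norm d)\<^sup>2" using t by (simp add: power2_eq_square)
    finally have "gradient f (x + t *\<^sub>R d) \<bullet> d - gradient f x \<bullet> d - L * t * (norm d)\<^sup>2 \<le> 0" by simp
    then show "\<exists>y. (\<phi> has_real_derivative y) (at t) \<and> y \<le> 0" using der by blast
  qed simp
  then show ?thesis by (simp add: \<phi>_def d_def)
qed

lemma strongly_convex_lower:
  assumes sc: "strongly_convex \<mu> f" and "L_smooth L f"
  shows "f x + gradient f x \<bullet> (v - x) + \<mu> / 2 * (norm (v - x))\<^sup>2 \<le> f v"
proof -
  define d where "d = v - x"
  have "((\<lambda>t. f (x + t *\<^sub>R d)) has_real_derivative gradient f x \<bullet> d) (at 0)"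
    using gradient_along_line[OF assms(2), of x d 0] by simp
  then have "((\<lambda>t. (f (x + t *\<^sub>R d) - f x) / t) \<longlongrightarrow> gradient f x \<bullet> d) (at 0)"
    by (simp add: has_field_derivative_iff)
  then have lim: "((\<lambda>t. (f (x + t *\<^sub>R d) - f x) / t) \<longlongrightarrow> gradient f x \<bullet> d) (at_right 0)"
    by (rule filterlim_mono) (auto simp: at_le)
  have lim2: "((\<lambda>t. f v - f x - \<mu> / 2 * (1 - t) * (norm d)\<^sup>2) \<longlongrightarrow> f v - f x - \<mu> / 2 * (1 - 0) * (norm d)\<^sup>2) (at_right 0)"
    by (intro tendsto_intros)
  have "gradient f x \<bullet> d \<le> f v - f x - \<mu> / 2 * (1 - 0) * (norm d)\<^sup>2"
  proof (rule tendsto_le[OF _ lim2 lim])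
    have "\<forall>\<^sub>F t :: real in at_right 0. t \<in> {0<..<1}" by (rule eventually_at_right_real) simp
    then show "\<forall>\<^sub>F t in at_right 0. (f (x + t *\<^sub>R d) - f x) / t \<le> f v - f x - \<mu> / 2 * (1 - t) * (norm d)\<^sup>2"
    proof eventually_elim
      case (elim t)
      have "f (t *\<^sub>R v + (1 - t) *\<^sub>R x) \<le> t * f v + (1 - t) * f x - \<mu> / 2 * t * (1 - t) * (norm (v - x))\<^sup>2"
        using sc elim unfolding strongly_convex_def by auto
      moreover have "t *\<^sub>R v + (1 - t) *\<^sub>R x = x + t *\<^sub>R d" by (simp add: d_def algebra_simps)
      ultimately have "f (x + t *\<^sub>R d) - f x \<le> (f v - f x - \<mu> / 2 * (1 - t) * (norm d)\<^sup>2) * t"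
        by (simp add: d_def algebra_simps)
      then show ?case using elim by (simp add: pos_divide_le_eq)
    qed
  qed simp
  then show ?thesis by (simp add: d_def)
qed

lemma convexity_le_smoothness:
  fixes f :: "'a::euclidean_space \<Rightarrow> real"
  assumes "strongly_convex \<mu> f" "L_smooth L f"
  shows "\<mu> \<le> L"
proof -
  obtain b :: 'a where "b \<in> Basis" using nonempty_Basis by blast
  then have "norm b = 1" by simp
  then show ?thesis
    using order_trans[OF strongly_convex_lower[OF assms, of 0 b] L_smooth_upper[OF assms(2), of b 0]] by simp
qed

text \<open>Outside the ball of radius \<open>2 * norm g / \<mu>\<close> around \<open>x\<close> the quadratic term dominates the linear one,
so a minimum over this compact ball is global.\<close>

lemma quadratic_growth_attains_minimum:
  fixes F :: "'a::euclidean_space \<Rightarrow> real"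
  assumes cont: "continuous_on UNIV F" and \<mu>: "0 < \<mu>"
    and lower: "\<And>v. F x + g \<bullet> (v - x) + \<mu> / 2 * (norm (v - x))\<^sup>2 \<le> F v"
  obtains z where "\<And>v. F z \<le> F v"
proof -
  define r where "r = 2 * norm g / \<mu>"
  have r: "0 \<le> r" using \<mu> by (simp add: r_def)
  have "\<exists>z\<in>cball x r. \<forall>v\<in>cball x r. F z \<le> F v"
    using r by (intro continuous_attains_inf continuous_on_subset[OF cont]) auto
  then obtain z where z: "\<And>v. v \<in> cball x r \<Longrightarrow> F z \<le> F v" by blast
  have "F z \<le> F v" for v
  proof (cases "v \<in> cball x r")
    case False
    then have "r \<le> norm (v - x)" by (simp add: dist_norm norm_minus_commute)
    then have "norm g \<le> \<mu> / 2 * norm (v - x)" using \<mu> by (simp add: r_def field_simps)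
    then have "norm g * norm (v - x) \<le> \<mu> / 2 * norm (v - x) * norm (v - x)" by (intro mult_right_mono) auto
    moreover have "- (norm g * norm (v - x)) \<le> g \<bullet> (v - x)"
      using Cauchy_Schwarz_ineq2[of g "v - x"] by linarith
    ultimately have "F x \<le> F v" using lower[of v] by (simp add: power2_eq_square)
    then show ?thesis using z[of x] r by simp
  qed (rule z)
  then show thesis by (rule that)
qed

text \<open>A step of length \<open>1 / L\<close> against \<open>g\<close> would decrease \<open>F\<close> by \<open>(norm g)^2 / (2 * L)\<close>.\<close>

lemma gradient_at_minimum_zero:
  fixes F :: "'a::euclidean_space \<Rightarrow> real"
  assumes L: "0 < L" and min: "\<And>v. F z \<le> F v"
    and upper: "\<And>v. F v \<le> F z + g \<bullet> (v - z) + L / 2 * (norm (v - z))\<^sup>2"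
  shows "g = 0"
proof -
  have "F z \<le> F z + g \<bullet> (z - (1 / L) *\<^sub>R g - z) + L / 2 * (norm (z - (1 / L) *\<^sub>R g - z))\<^sup>2"
    by (rule order_trans[OF min upper])
  also have "\<dots> = F z - (norm g)\<^sup>2 / (2 * L)"
  proof -
    have "z - (1 / L) *\<^sub>R g - z = - ((1 / L) *\<^sub>R g)" by simp
    moreover have "g \<bullet> g = (norm g)\<^sup>2" by (simp add: power2_norm_eq_inner)
    ultimately show ?thesis using L by (simp add: power_divide field_simps power2_eq_square)
  qed
  finally have "(norm g)\<^sup>2 / (2 * L) \<le> 0" by simp
  then show ?thesis using L by (simp add: divide_le_0_iff)
qed

text \<open>By strong convexity, \<open>f z\<close> exceeds every value of \<open>f\<close> by at most
\<open>(norm (gradient f z))^2 / (2 * \<mu>) \<le> \<epsilon> / 4\<close>. Moving from \<open>z\<close> to \<open>x\<close> costs a linear and a quadratic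
term; Young's inequality turns the linear one into another \<open>\<epsilon> / 4\<close> and a quadratic term.\<close>

lemma suboptimality_near_almost_stationary_point:
  fixes f :: "'a::euclidean_space \<Rightarrow> real"
  assumes sc: "strongly_convex \<mu> f" and sm: "L_smooth L f" and \<mu>: "0 < \<mu>"
    and g: "(norm (gradient f z))\<^sup>2 \<le> \<mu> * \<epsilon> / 2"
  shows "f x - f xm \<le> \<epsilon> / 2 + L * (norm (x - z))\<^sup>2"
proof -
  have \<mu>L: "\<mu> \<le> L" by (rule convexity_le_smoothness[OF sc sm])
  have young: "\<bar>gradient f z \<bullet> p\<bar> \<le> \<epsilon> / 4 + \<mu> / 2 * (norm p)\<^sup>2" for p
  proof -
    define G where "G = norm (gradient f z)"
    have "\<bar>gradient f z \<bullet> p\<bar> \<le> G * norm p" unfolding G_def by (rule Cauchy_Schwarz_ineq2)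
    moreover have "0 \<le> (G - \<mu> * norm p)\<^sup>2 / (2 * \<mu>)" using \<mu> by simp
    moreover have "(G - \<mu> * norm p)\<^sup>2 / (2 * \<mu>) = G\<^sup>2 / (2 * \<mu>) - G * norm p + \<mu> / 2 * (norm p)\<^sup>2"
      using \<mu> by (simp add: field_simps power2_eq_square)
    moreover have "G\<^sup>2 / (2 * \<mu>) \<le> \<epsilon> / 4" using g \<mu> by (simp add: G_def field_simps)
    ultimately show ?thesis by linarith
  qed
  have "f z - \<epsilon> / 4 \<le> f xm"
    using strongly_convex_lower[OF sc sm, of z xm] young[of "xm - z"] by linarith
  moreover have "f x \<le> f z + gradient f z \<bullet> (x - z) + L / 2 * (norm (x - z))\<^sup>2"
    by (rule L_smooth_upper[OF sm])
  moreover have "\<mu> / 2 * (norm (x - z))\<^sup>2 \<le> L / 2 * (norm (x - z))\<^sup>2" using \<mu>L by (intro mult_right_mono) auto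
  moreover have "gradient f z \<bullet> (x - z) \<le> \<epsilon> / 4 + \<mu> / 2 * (norm (x - z))\<^sup>2" using young[of "x - z"] by linarith
  ultimately show ?thesis by linarith
qed

text \<open>Cocoercivity of the gradient of \<open>F - \<mu> / 2 * norm^2\<close>, obtained from upper and lower quadratic bounds at
two points. The bounds at \<open>x\<close> and at \<open>z\<close> are compared at the points \<open>x - w\<close> and \<open>z + w\<close>; the
displacement \<open>w\<close> below makes the sum of the two comparisons sharpest.\<close>

lemma strong_cocoercivity:
  fixes x z p gx :: "'a::euclidean_space"
  assumes "\<mu> < L'" and lz: "\<And>v. F z + \<mu> / 2 * (norm (v - z))\<^sup>2 \<le> F v"
    and lx: "\<And>v. F x + gx \<bullet> (v - x) + \<mu> / 2 * (norm (v - x))\<^sup>2 \<le> F v"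
    and uz: "\<And>v. F v \<le> F z + L' / 2 * (norm (v - z))\<^sup>2"
    and ux: "\<And>v. F v \<le> F x + gx \<bullet> (v - x) + L' / 2 * (norm (v - x))\<^sup>2"
  shows "\<mu> * L' * (norm (x - z))\<^sup>2 + (norm gx)\<^sup>2 \<le> (\<mu> + L') * (gx \<bullet> (x - z))"
proof -
  define p where "p = x - z"
  define w where "w = (1 / (L' - \<mu>)) *\<^sub>R (gx - \<mu> *\<^sub>R p)"
  have pw: "x - w - z = p - w" "z + w - x = w - p" by (simp_all add: p_def)
  have "F z + \<mu> / 2 * (norm (p - w))\<^sup>2 \<le> F x - gx \<bullet> w + L' / 2 * (norm w)\<^sup>2"
    using order_trans[OF lz[of "x - w"] ux[of "x - w"]] pw by simp
  moreover have "F x + gx \<bullet> (w - p) + \<mu> / 2 * (norm (w - p))\<^sup>2 \<le> F z + L' / 2 * (norm w)\<^sup>2"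
    using order_trans[OF lx[of "z + w"] uz[of "z + w"]] pw by simp
  ultimately have "\<mu> * (norm (p - w))\<^sup>2 - L' * (norm w)\<^sup>2 + 2 * (gx \<bullet> w) \<le> gx \<bullet> p"
    by (simp add: norm_minus_commute[of w p] inner_diff_right)
  moreover have "\<mu> * (norm (p - w))\<^sup>2 - L' * (norm w)\<^sup>2 + 2 * (gx \<bullet> w)
     = \<mu> * (norm p)\<^sup>2 + 2 * ((gx - \<mu> *\<^sub>R p) \<bullet> w) - (L' - \<mu>) * (norm w)\<^sup>2"
    by (simp add: power2_norm_eq_inner inner_diff inner_commute algebra_simps)
  moreover have "(gx - \<mu> *\<^sub>R p) \<bullet> w = (norm (gx - \<mu> *\<^sub>R p))\<^sup>2 / (L' - \<mu>)"
    by (simp add: w_def power2_norm_eq_inner)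
  moreover have "(L' - \<mu>) * (norm w)\<^sup>2 = (norm (gx - \<mu> *\<^sub>R p))\<^sup>2 / (L' - \<mu>)"
    using assms(1) by (simp add: w_def power_divide power2_eq_square)
  ultimately have "\<mu> * (norm p)\<^sup>2 + (norm (gx - \<mu> *\<^sub>R p))\<^sup>2 / (L' - \<mu>) \<le> gx \<bullet> p"
    by linarith
  then have "(norm (gx - \<mu> *\<^sub>R p))\<^sup>2 / (L' - \<mu>) \<le> gx \<bullet> p - \<mu> * (norm p)\<^sup>2"
    by linarith
  then have "(norm (gx - \<mu> *\<^sub>R p))\<^sup>2 \<le> (gx \<bullet> p - \<mu> * (norm p)\<^sup>2) * (L' - \<mu>)"
    using assms(1) by (simp add: pos_divide_le_eq)
  moreover have "(norm (gx - \<mu> *\<^sub>R p))\<^sup>2 = (norm gx)\<^sup>2 - 2 * \<mu> * (gx \<bullet> p) + \<mu> * \<mu> * (norm p)\<^sup>2"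
    by (simp add: power2_norm_eq_inner inner_diff inner_commute algebra_simps)
  ultimately show ?thesis by (simp add: p_def algebra_simps)
qed

text \<open>Cocoercivity is applied with \<open>3 * L\<close> in place of \<open>L\<close>: this covers the case \<open>\<mu> = L\<close>, and the squared gradient
is then absorbed for \<open>\<eta> \<le> 2 / (\<mu> + 3 * L)\<close>, which includes all steps up to \<open>1 / (2 * L)\<close>.
With \<open>\<kappa> = L / \<mu>\<close> the rate \<open>6 * L / (\<mu> + 3 * L)\<close> equals \<open>2 - 2 / (3 * \<kappa> + 1)\<close>, so it tends to \<open>2\<close> for
badly conditioned functions, which need it most.\<close>

lemma gradient_step_contraction:
  fixes x z gx :: "'a::euclidean_space"
  assumes "0 < \<mu>" "\<mu> \<le> L" and lz: "\<And>v. F z + \<mu> / 2 * (norm (v - z))\<^sup>2 \<le> F v"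
    and lx: "\<And>v. F x + gx \<bullet> (v - x) + \<mu> / 2 * (norm (v - x))\<^sup>2 \<le> F v"
    and uz: "\<And>v. F v \<le> F z + L / 2 * (norm (v - z))\<^sup>2"
    and ux: "\<And>v. F v \<le> F x + gx \<bullet> (v - x) + L / 2 * (norm (v - x))\<^sup>2"
    and \<eta>: "0 \<le> \<eta>" "\<eta> \<le> 1 / (2 * L)"
  shows "(norm (x - \<eta> *\<^sub>R gx - z))\<^sup>2 \<le> (1 - 6 * L / (\<mu> + 3 * L) * (\<eta> * \<mu>)) * (norm (x - z))\<^sup>2"
proof -
  have L: "0 < L" "\<mu> < 3 * L" "0 < \<mu> + 3 * L" using assms by linarith+
  have mono: "L / 2 * t \<le> 3 * L / 2 * t" if "0 \<le> t" for t
    using that L by simp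
  have uz': "F v \<le> F z + 3 * L / 2 * (norm (v - z))\<^sup>2" for v
    using uz[of v] mono[of "(norm (v - z))\<^sup>2"] by simp
  have ux': "F v \<le> F x + gx \<bullet> (v - x) + 3 * L / 2 * (norm (v - x))\<^sup>2" for v
    using ux[of v] mono[of "(norm (v - x))\<^sup>2"] by simp
  have "\<mu> * (3 * L) * (norm (x - z))\<^sup>2 + (norm gx)\<^sup>2 \<le> (\<mu> + 3 * L) * (gx \<bullet> (x - z))"
    by (rule strong_cocoercivity[OF L(2) lz lx uz' ux'])
  then have coc: "(3 * L * \<mu> * (norm (x - z))\<^sup>2 + (norm gx)\<^sup>2) / (\<mu> + 3 * L) \<le> gx \<bullet> (x - z)"
    using L(3) by (simp add: pos_divide_le_eq mult.commute mult.left_commute)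
  have e2: "\<eta> \<le> 2 / (\<mu> + 3 * L)"
  proof -
    have "1 / (2 * L) \<le> 2 / (\<mu> + 3 * L)" using L assms(1,2) by (simp add: divide_simps)
    then show ?thesis using \<eta>(2) by linarith
  qed
  have "(norm (x - \<eta> *\<^sub>R gx - z))\<^sup>2 = (norm (x - z))\<^sup>2 - 2 * \<eta> * (gx \<bullet> (x - z)) + \<eta> * (\<eta> * (norm gx)\<^sup>2)"
    by (simp add: power2_norm_eq_inner inner_diff inner_commute algebra_simps)
  also have "\<dots> \<le> (norm (x - z))\<^sup>2 - 2 * \<eta> * ((3 * L * \<mu> * (norm (x - z))\<^sup>2 + (norm gx)\<^sup>2) / (\<mu> + 3 * L))
      + \<eta> * (2 / (\<mu> + 3 * L) * (norm gx)\<^sup>2)"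
    by (intro add_mono diff_mono mult_left_mono mult_right_mono coc e2 order_refl) (use \<eta> in auto)
  also have "\<dots> = (1 - 6 * L / (\<mu> + 3 * L) * (\<eta> * \<mu>)) * (norm (x - z))\<^sup>2"
  proof -
    define s where "s = \<mu> + 3 * L"
    have "s \<noteq> 0" using L(3) by (simp add: s_def)
    then show ?thesis unfolding s_def[symmetric] by (simp add: field_simps)
  qed
  finally show ?thesis .
qed

section \<open>The synchronous oracle with smooth strongly convex functions\<close>

text \<open>With \<open>w = L * s / (\<mu>^2 * \<epsilon>)\<close> and \<open>l = 1 + ln (F0 / \<epsilon>)\<close> there are about \<open>16 * w * l\<close> iterations, and
\<open>Q = (F0 / \<epsilon>) * (K / w)\<close> is between \<open>15 * l * F0 / \<epsilon>\<close> and \<open>16 * l * F0 / \<epsilon>\<close>. Hence \<open>ln Q\<close> is at most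
\<open>4 * l\<close>, which makes the noise term small. For the initial term, let \<open>c\<close> be the contraction rate.
If the step size is \<open>ln Q / (\<mu> * K)\<close>, the term is of order \<open>\<kappa> * F0 * Q powr (-c)\<close>. Since \<open>F0 / \<epsilon>\<close> is
at least \<open>\<kappa>\<close>, this is at most \<open>\<epsilon>\<close> times a small constant times \<open>\<kappa> powr (2 - c)\<close>, and the last factor is
bounded because \<open>2 - c = 2 / (3 * \<kappa> + 1)\<close>. If the step size is \<open>1 / (2 * L)\<close>, the iterations suffice with
much room.\<close>

lemma sync_budget_arithmetic:
  fixes \<mu> L s \<epsilon> F0 :: real
  assumes \<mu>: "0 < \<mu>" "\<mu> \<le> L" and s: "0 < s" and \<epsilon>: "0 < \<epsilon>" "\<epsilon> \<le> F0 / (L / \<mu>)" "\<epsilon> \<le> s / \<mu>"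
  defines "R \<equiv> 16 * (L * s / (\<mu>\<^sup>2 * \<epsilon>)) * (1 + ln (F0 / \<epsilon>))"
  defines "K \<equiv> nat \<lfloor>R\<rfloor>"
  defines "Q \<equiv> F0 * \<mu>\<^sup>2 * real K / (L * s)"
  defines "\<eta> \<equiv> min (1 / (2 * L)) (1 / (\<mu> * real K) * ln Q)"
  shows "1 \<le> K" "real K \<le> R" "0 < \<eta>" "\<eta> \<le> 1 / (2 * L)"
    and "2 * (L / \<mu>) * F0 * exp (- (6 * L / (\<mu> + 3 * L) * (\<eta> * \<mu>) * real K)) \<le> \<epsilon> / 4"
    and "2 / 3 * (L * \<eta> * s / \<mu>) \<le> \<epsilon> / 4"
proof -
  define \<kappa> where "\<kappa> = L / \<mu>"
  define w where "w = L * s / (\<mu>\<^sup>2 * \<epsilon>)"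
  define y where "y = ln (F0 / \<epsilon>)"
  define l where "l = 1 + y"
  have L: "0 < L" using \<mu> by linarith
  have \<kappa>: "1 \<le> \<kappa>" "\<kappa> * \<mu> = L" using \<mu> by (simp_all add: \<kappa>_def)
  have wk: "\<kappa> \<le> w"
  proof -
    have "\<epsilon> * \<mu> \<le> s" using \<epsilon>(3) \<mu> by (simp add: pos_le_divide_eq)
    then have "L * (\<epsilon> * \<mu>) \<le> L * s" using L by simp
    then show ?thesis using \<mu> \<epsilon> by (simp add: \<kappa>_def w_def divide_simps power2_eq_square algebra_simps)
  qed
  have w0: "0 < w" using \<kappa> wk by linarith
  have F\<epsilon>: "\<kappa> \<le> F0 / \<epsilon>" using \<epsilon> \<kappa> \<mu> L by (simp add: \<kappa>_def field_simps)
  have F0: "0 < F0" using \<epsilon> L \<mu> by (smt (verit) divide_nonpos_pos zero_less_divide_iff)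
  have ly: "ln \<kappa> \<le> y" using F\<epsilon> \<kappa> unfolding y_def by (subst ln_le_cancel_iff) auto
  have lk: "0 \<le> ln \<kappa>" using \<kappa> by simp
  have y0: "0 \<le> y" and l1: "1 \<le> l" using ly lk by (simp_all add: l_def)
  have R: "R = 16 * (w * l)" by (simp add: R_def w_def l_def y_def)
  have wl: "1 \<le> w * l" using mult_mono[of 1 w 1 l] \<kappa> wk l1 by simp
  have "0 \<le> \<lfloor>R\<rfloor>" using wl R by simp
  then have "real K = of_int \<lfloor>R\<rfloor>" by (simp add: K_def)
  then have K: "real K \<le> R" "R - 1 < real K" by linarith+
  show "real K \<le> R" by (rule K)
  have K15: "15 * (w * l) \<le> real K" using K wl R by linarith
  then have K0: "0 < real K" using wl by linarith
  then show K1: "1 \<le> K" by simp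
  have "L * s = w * \<epsilon> * \<mu>\<^sup>2" using \<mu> \<epsilon> by (simp add: w_def)
  then have Q: "Q = (F0 / \<epsilon>) * (real K / w)"
    using \<mu> \<epsilon> w0 by (simp add: Q_def field_simps)
  have Kw: "15 * l \<le> real K / w" "real K / w \<le> 16 * l"
    using K K15 R w0 by (simp_all add: pos_le_divide_eq pos_divide_le_eq mult.commute mult.left_commute)
  have Kwp: "0 < real K / w" using K0 w0 by simp
  have lnQ: "ln Q = y + ln (real K / w)"
    unfolding Q y_def using F0 \<epsilon> Kwp by (intro ln_mult_pos) auto
  have ln8: "ln (8 :: real) = 3 * ln 2" using ln_realpow[of "2 :: real" 3] by simp
  \<comment> \<open>Only the factor 8 out of 15 is needed, and its logarithm reduces to that of 2.\<close>
  have lower: "y + ln 8 \<le> ln Q"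
  proof -
    have "ln 8 \<le> ln (real K / w)" using Kw l1 by (subst ln_le_cancel_iff) auto
    then show ?thesis by (simp add: lnQ)
  qed
  have upper: "ln Q \<le> 4 * l"
  proof -
    have "ln (real K / w) \<le> ln (16 * l)" using Kw Kwp l1 by (subst ln_le_cancel_iff) auto
    also have "\<dots> = ln (2 ^ 4) + ln l" using l1 by (subst ln_mult_pos) auto
    also have "\<dots> = 4 * ln 2 + ln l" by (subst ln_realpow) auto
    also have "\<dots> \<le> 4 + (l - 1)" using ln_2_less_1 ln_le_minus_one[of l] l1 by linarith
    finally show ?thesis using l1 by (simp add: lnQ l_def)
  qed
  have lnQ0: "0 < ln Q" using lower y0 ln8 by (smt (verit) ln_gt_zero)
  show "0 < \<eta>" using L \<mu> K0 lnQ0 by (simp add: \<eta>_def)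
  show "\<eta> \<le> 1 / (2 * L)" by (simp add: \<eta>_def)
  show "2 / 3 * (L * \<eta> * s / \<mu>) \<le> \<epsilon> / 4"
  proof -
    have "\<eta> \<le> 1 / (\<mu> * real K) * ln Q" by (simp add: \<eta>_def)
    also have "\<dots> \<le> 1 / (\<mu> * real K) * (4 * l)" using upper \<mu> K0 by (intro mult_left_mono) auto
    also have "\<dots> \<le> 4 / (15 * \<mu> * w)"
      using K15 \<mu> K0 w0 by (simp add: divide_simps algebra_simps)
    finally have "L * s / \<mu> * \<eta> \<le> L * s / \<mu> * (4 / (15 * \<mu> * w))"
      using L s \<mu> by (intro mult_left_mono) auto
    also have "\<dots> = 4 / 15 * \<epsilon>"
      using L s \<mu> \<epsilon> by (simp add: w_def field_simps power2_eq_square)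
    finally show ?thesis using \<epsilon> by (simp add: mult.commute mult.left_commute)
  qed
  define c where "c = 6 * L / (\<mu> + 3 * L)"
  have c: "3 / 2 \<le> c" "2 - c = 2 / (3 * \<kappa> + 1)"
    using \<mu> L by (simp_all add: c_def \<kappa>_def field_simps)
  have "ln 8 + ln \<kappa> + y \<le> c * (\<eta> * \<mu>) * real K"
  proof (cases "1 / (2 * L) \<le> 1 / (\<mu> * real K) * ln Q")
    case True
    then have "\<eta> * \<mu> * real K = real K / (2 * \<kappa>)"
      using L \<mu> by (simp add: \<eta>_def \<kappa>_def field_simps)
    moreover have "15 * l / 2 \<le> real K / (2 * \<kappa>)"
    proof -
      have "15 * (\<kappa> * l) \<le> 15 * (w * l)" using wk l1 by simp
      then have "15 * (\<kappa> * l) \<le> real K" using K15 by linarith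
      then show ?thesis using \<kappa>(1) by (simp add: pos_le_divide_eq mult.commute mult.left_commute)
    qed
    ultimately have "3 / 2 * (15 * l / 2) \<le> c * (\<eta> * \<mu> * real K)"
      using c l1 by (intro mult_mono) auto
    moreover have "ln 8 \<le> (3::real)" using ln8 ln_2_less_1 by linarith
    ultimately show ?thesis using ly y0 by (simp add: l_def mult.assoc)
  next
    case False
    then have "\<eta> * \<mu> * real K = ln Q"
      using \<mu> K0 by (simp add: \<eta>_def min_def)
    moreover have "ln 8 + ln \<kappa> + y \<le> c * (y + ln 8)"
    proof -
      have "(c - 1) * ln \<kappa> \<le> (c - 1) * y" using c ly by (intro mult_left_mono) auto
      moreover have "(2 - c) * ln \<kappa> \<le> 1"
      proof -
        have "(2 - c) * ln \<kappa> \<le> (2 - c) * (\<kappa> - 1)"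
          using c \<kappa> ln_le_minus_one[of \<kappa>] by (intro mult_left_mono) auto
        also have "\<dots> \<le> 1" unfolding c(2) using \<kappa> by (simp add: field_simps)
        finally show ?thesis .
      qed
      moreover have "1 \<le> (c - 1) * ln 8"
      proof -
        have "1 / 2 * 2 \<le> (c - 1) * ln 8"
          using c ln8 ln2_ge_two_thirds by (intro mult_mono) auto
        then show ?thesis by simp
      qed
      ultimately show ?thesis by (simp add: algebra_simps)
    qed
    moreover have "c * (y + ln 8) \<le> c * ln Q" using lower c by (intro mult_left_mono) auto
    ultimately show ?thesis by (simp add: mult.assoc)
  qed
  then have "exp (ln 8 + ln \<kappa> + y) \<le> exp (c * (\<eta> * \<mu>) * real K)" by simp
  then have "8 * \<kappa> * (F0 / \<epsilon>) \<le> exp (c * (\<eta> * \<mu>) * real K)"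
    using \<kappa> F0 \<epsilon> by (simp add: exp_add y_def)
  then show "2 * (L / \<mu>) * F0 * exp (- (6 * L / (\<mu> + 3 * L) * (\<eta> * \<mu>) * real K)) \<le> \<epsilon> / 4"
    unfolding c_def[symmetric] \<kappa>_def[symmetric] using \<epsilon>(1)
    by (simp add: exp_minus field_simps)
qed

text \<open>The mean squared distance to the minimizer \<open>z\<close> of the weighted average satisfies an affine recursion
with contraction \<open>\<rho>\<close>; its stationary value is at most \<open>B\<close>. After \<open>K\<close> steps the initial
part and the stationary part contribute at most \<open>\<epsilon> / 4\<close> each to the error; the remaining
\<open>\<epsilon> / 2\<close> pays for \<open>z\<close> not being a minimizer of \<open>f i\<close>.\<close>

lemma sync_collaboration:
  fixes M :: "'w measure" and S :: "'n::finite \<Rightarrow> 's measure" and \<gamma> :: "'n \<Rightarrow> 's \<Rightarrow> 'a::euclidean_space \<Rightarrow> 'a"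
    and i :: 'n and K :: nat
  assumes P: "prob_space M" and iid: "iid_seeds M S \<xi>"
    and \<gamma>: "\<And>j. (\<lambda>(s, y). \<gamma> j s y) \<in> borel_measurable (S j \<Otimes>\<^sub>M borel)"
    and \<mu>: "0 < \<mu>" and sc: "\<And>j. strongly_convex \<mu> (f j)" and sm: "\<And>j. L_smooth L (f j)"
    and mean: "\<And>j k y. integrable M (stoch_grad \<gamma> \<xi> j k y) \<and> (\<integral>\<omega>. stoch_grad \<gamma> \<xi> j k y \<omega> \<partial>M) = gradient (f j) y"
    and var: "\<And>j k y. mean_le M (\<lambda>\<omega>. (norm (stoch_grad \<gamma> \<xi> j k y \<omega> - gradient (f j) y))\<^sup>2) v"
    and min: "\<And>j y. f j (xstar j) \<le> f j y"
    and w: "\<And>j. 0 \<le> w j" "(\<Sum>j\<in>UNIV. w j) = 1"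
    and close: "\<And>z. (\<Sum>j\<in>UNIV. w j *\<^sub>R gradient (f j) z) = 0 \<Longrightarrow> (norm (gradient (f i) z))\<^sup>2 \<le> \<mu> * \<epsilon> / 2"
    and F0: "F0 = (\<Sum>j\<in>UNIV. w j * (f j x0 - f j (xstar j)))"
    and s: "s = v * (\<Sum>j\<in>UNIV. (w j)\<^sup>2)" "0 < s"
    and \<epsilon>: "0 < \<epsilon>" "\<epsilon> \<le> F0 / (L / \<mu>)" "\<epsilon> \<le> s / \<mu>"
    and K: "K = nat \<lfloor>16 * (L * s / (\<mu>\<^sup>2 * \<epsilon>)) * (1 + ln (F0 / \<epsilon>))\<rfloor>"
    and \<eta>: "\<eta> = min (1 / (2 * L)) (1 / (\<mu> * real K) * ln (F0 * \<mu>\<^sup>2 * real K / (L * s)))"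
    and x: "x = wga (sync_oracle (stoch_grad \<gamma> \<xi>)) w \<eta> x0"
  shows "mean_le M (\<lambda>\<omega>. f i (x K \<omega>) - f i (xstar i)) \<epsilon>"
proof -
  interpret prob_space M by fact
  have \<mu>L: "\<mu> \<le> L" by (rule convexity_le_smoothness[OF sc sm])
  then have L: "0 < L" using \<mu> by linarith
  note budget = sync_budget_arithmetic[OF \<mu> \<mu>L s(2) \<epsilon>, folded K, folded \<eta>]
  define F where "F y = (\<Sum>j\<in>UNIV. w j * f j y)" for y
  define g where "g y = (\<Sum>j\<in>UNIV. w j *\<^sub>R gradient (f j) y)" for y
  have lower: "F y + g y \<bullet> (v - y) + \<mu> / 2 * (norm (v - y))\<^sup>2 \<le> F v" for y v
  proof -
    have "(\<Sum>j\<in>UNIV. w j * (f j y + gradient (f j) y \<bullet> (v - y) + \<mu> / 2 * (norm (v - y))\<^sup>2)) \<le> F v"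
      unfolding F_def by (intro sum_mono mult_left_mono strongly_convex_lower[OF sc sm] w)
    moreover have "(\<Sum>j\<in>UNIV. w j * (f j y + gradient (f j) y \<bullet> (v - y) + \<mu> / 2 * (norm (v - y))\<^sup>2))
        = F y + g y \<bullet> (v - y) + (\<Sum>j\<in>UNIV. w j) * (\<mu> / 2 * (norm (v - y))\<^sup>2)"
      by (simp add: F_def g_def inner_sum_left sum.distrib distrib_left sum_distrib_right)
    ultimately show ?thesis using w(2) by simp
  qed
  have upper: "F v \<le> F y + g y \<bullet> (v - y) + L / 2 * (norm (v - y))\<^sup>2" for y v
  proof -
    have "F v \<le> (\<Sum>j\<in>UNIV. w j * (f j y + gradient (f j) y \<bullet> (v - y) + L / 2 * (norm (v - y))\<^sup>2))"
      unfolding F_def by (intro sum_mono mult_left_mono L_smooth_upper[OF sm] w)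
    moreover have "(\<Sum>j\<in>UNIV. w j * (f j y + gradient (f j) y \<bullet> (v - y) + L / 2 * (norm (v - y))\<^sup>2))
        = F y + g y \<bullet> (v - y) + (\<Sum>j\<in>UNIV. w j) * (L / 2 * (norm (v - y))\<^sup>2)"
      by (simp add: F_def g_def inner_sum_left sum.distrib distrib_left sum_distrib_right)
    ultimately show ?thesis using w(2) by simp
  qed
  have cont: "continuous_on UNIV F"
    unfolding F_def by (intro continuous_intros L_smooth_continuous[OF sm])
  obtain z where z: "\<And>v. F z \<le> F v"
    using quadratic_growth_attains_minimum[OF cont \<mu> lower] by blast
  have gz: "g z = 0" by (rule gradient_at_minimum_zero[OF L z upper])
  define \<rho> where "\<rho> = 1 - 6 * L / (\<mu> + 3 * L) * (\<eta> * \<mu>)"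
  have contract: "(norm (y - \<eta> *\<^sub>R g y - z))\<^sup>2 \<le> \<rho> * (norm (y - z))\<^sup>2" for y
    unfolding \<rho>_def
  proof (rule gradient_step_contraction[where F = F, OF \<mu> \<mu>L _ lower _ upper])
    show "F z + \<mu> / 2 * (norm (v - z))\<^sup>2 \<le> F v" "F v \<le> F z + L / 2 * (norm (v - z))\<^sup>2" for v
      using lower[of z v] upper[of v z] gz by auto
  qed (use budget(3,4) in auto)
  have c: "3 / 2 \<le> 6 * L / (\<mu> + 3 * L)" "6 * L / (\<mu> + 3 * L) \<le> 2"
    using \<mu> \<mu>L L by (simp_all add: field_simps)
  have \<eta>\<mu>: "0 < \<eta> * \<mu>" "\<eta> * \<mu> \<le> 1 / 2"
  proof -
    show "0 < \<eta> * \<mu>" using budget(3) \<mu> by simp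
    have "\<eta> * \<mu> \<le> 1 / (2 * L) * L" using budget(3,4) \<mu> \<mu>L L by (intro mult_mono) auto
    then show "\<eta> * \<mu> \<le> 1 / 2" using L by simp
  qed
  have \<rho>: "0 \<le> \<rho>" "3 / 2 * (\<eta> * \<mu>) \<le> 1 - \<rho>"
  proof -
    have "6 * L / (\<mu> + 3 * L) * (\<eta> * \<mu>) \<le> 2 * (1 / 2)" using c \<eta>\<mu> by (intro mult_mono) auto
    then show "0 \<le> \<rho>" by (simp add: \<rho>_def)
    show "3 / 2 * (\<eta> * \<mu>) \<le> 1 - \<rho>" unfolding \<rho>_def using mult_right_mono[OF c(1), of "\<eta> * \<mu>"] \<eta>\<mu> by simp
  qed
  define B where "B = 2 / 3 * (\<eta> * s / \<mu>)"
  have B: "\<eta>\<^sup>2 * s \<le> (1 - \<rho>) * B" and B0: "0 \<le> B"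
  proof -
    show "0 \<le> B" using budget(3) s \<mu> by (simp add: B_def)
    have "\<eta>\<^sup>2 * s = 3 / 2 * (\<eta> * \<mu>) * B" using \<mu> by (simp add: B_def power2_eq_square)
    also have "\<dots> \<le> (1 - \<rho>) * B" using \<rho>(2) \<open>0 \<le> B\<close> by (rule mult_right_mono)
    finally show "\<eta>\<^sup>2 * s \<le> (1 - \<rho>) * B" .
  qed
  have Gm: "gradient (f j) \<in> borel_measurable borel" for j
    by (rule borel_measurable_continuous_onI[OF L_smooth_gradient_continuous[OF sm]])
  have dist_bound: "mean_le M (\<lambda>\<omega>. (norm (x k \<omega> - z))\<^sup>2) (\<rho> ^ k * (norm (x0 - z))\<^sup>2 + B)" for k
  proof (induction k)
    case 0
    then show ?case using B0 by (simp add: x mean_le_def prob_space)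
  next
    case (Suc k)
    have "mean_le M (\<lambda>\<omega>. (norm (x (Suc k) \<omega> - z))\<^sup>2)
        (\<rho> * (\<rho> ^ k * (norm (x0 - z))\<^sup>2 + B) + \<eta>\<^sup>2 * (v * (\<Sum>j\<in>UNIV. (w j)\<^sup>2)))"
      by (rule sync_second_moment_step[OF P iid \<gamma> Gm mean var x contract[unfolded g_def] Suc \<rho>(1)])
    moreover have "\<rho> * (\<rho> ^ k * (norm (x0 - z))\<^sup>2 + B) + \<eta>\<^sup>2 * (v * (\<Sum>j\<in>UNIV. (w j)\<^sup>2))
        \<le> \<rho> ^ Suc k * (norm (x0 - z))\<^sup>2 + B"
      using B by (simp add: s(1) algebra_simps)
    ultimately show ?case unfolding mean_le_def by linarith
  qed
  have "\<rho> ^ K \<le> exp (- (6 * L / (\<mu> + 3 * L) * (\<eta> * \<mu>) * real K))"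
  proof -
    have "\<rho> \<le> exp (- (6 * L / (\<mu> + 3 * L) * (\<eta> * \<mu>)))"
      unfolding \<rho>_def by (rule exp_minus_ge)
    then have "\<rho> ^ K \<le> exp (- (6 * L / (\<mu> + 3 * L) * (\<eta> * \<mu>))) ^ K" using \<rho>(1) by (rule power_mono)
    also have "\<dots> = exp (- (6 * L / (\<mu> + 3 * L) * (\<eta> * \<mu>) * real K))"
      by (simp add: exp_of_nat_mult[symmetric] mult.commute)
    finally show ?thesis .
  qed
  moreover have "(norm (x0 - z))\<^sup>2 \<le> 2 * F0 / \<mu>"
  proof -
    have "(\<Sum>j\<in>UNIV. w j * f j (xstar j)) \<le> F z" unfolding F_def by (intro sum_mono mult_left_mono min w)
    then have "F x0 - F z \<le> F0" by (simp add: F0 F_def right_diff_distrib sum_subtractf)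
    then have "\<mu> / 2 * (norm (x0 - z))\<^sup>2 \<le> F0" using lower[of z x0] gz by simp
    then show ?thesis using \<mu> by (simp add: field_simps)
  qed
  ultimately have "\<rho> ^ K * (norm (x0 - z))\<^sup>2 \<le> exp (- (6 * L / (\<mu> + 3 * L) * (\<eta> * \<mu>) * real K)) * (2 * F0 / \<mu>)"
    by (intro mult_mono) auto
  then have "L * (\<rho> ^ K * (norm (x0 - z))\<^sup>2) \<le> L * (exp (- (6 * L / (\<mu> + 3 * L) * (\<eta> * \<mu>) * real K)) * (2 * F0 / \<mu>))"
    using L by (intro mult_left_mono) auto
  also have "\<dots> = 2 * (L / \<mu>) * F0 * exp (- (6 * L / (\<mu> + 3 * L) * (\<eta> * \<mu>) * real K))" by simp
  also note budget(5)
  finally have "L * (\<rho> ^ K * (norm (x0 - z))\<^sup>2) \<le> \<epsilon> / 4" .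
  moreover have "L * B \<le> \<epsilon> / 4" using budget(6) by (simp add: B_def)
  ultimately have LK: "L * (\<rho> ^ K * (norm (x0 - z))\<^sup>2 + B) \<le> \<epsilon> / 2" by (simp add: distrib_left)
  have pt: "f i y - f i (xstar i) \<le> \<epsilon> / 2 + L * (norm (y - z))\<^sup>2" for y
    using suboptimality_near_almost_stationary_point[OF sc sm \<mu>] close[OF gz[unfolded g_def]] by blast
  have [measurable]: "x K \<in> borel_measurable M"
    unfolding x by (rule sync_iterate_measurable[OF \<gamma> iid_seeds_indep(2)[OF P iid]])
  have [measurable]: "f i \<in> borel_measurable borel"
    by (rule borel_measurable_continuous_onI[OF L_smooth_continuous[OF sm]])
  have i2: "integrable M (\<lambda>\<omega>. \<epsilon> / 2 + L * (norm (x K \<omega> - z))\<^sup>2)"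
    using dist_bound[of K] by (simp add: mean_le_def)
  have i1: "integrable M (\<lambda>\<omega>. f i (x K \<omega>) - f i (xstar i))"
  proof (rule Bochner_Integration.integrable_bound[OF i2])
    have "\<bar>f i y - f i (xstar i)\<bar> \<le> \<bar>\<epsilon> / 2 + L * (norm (y - z))\<^sup>2\<bar>" for y
      using pt[of y] min[of i y] by linarith
    then show "AE \<omega> in M. norm (f i (x K \<omega>) - f i (xstar i)) \<le> norm (\<epsilon> / 2 + L * (norm (x K \<omega> - z))\<^sup>2)"
      by simp
  qed simp
  have "(\<integral>\<omega>. f i (x K \<omega>) - f i (xstar i) \<partial>M) \<le> (\<integral>\<omega>. \<epsilon> / 2 + L * (norm (x K \<omega> - z))\<^sup>2 \<partial>M)"
    using i1 i2 pt by (intro integral_mono) auto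
  also have "\<dots> = \<epsilon> / 2 + L * (\<integral>\<omega>. (norm (x K \<omega> - z))\<^sup>2 \<partial>M)"
    using dist_bound[of K] by (simp add: mean_le_def prob_space)
  also have "\<dots> \<le> \<epsilon> / 2 + L * (\<rho> ^ K * (norm (x0 - z))\<^sup>2 + B)"
    using dist_bound[of K] L by (simp add: mean_le_def)
  also have "\<dots> \<le> \<epsilon>" using LK by linarith
  finally show ?thesis using i1 by (simp add: mean_le_def)
qed

section \<open>The collaboration weights and both guarantees\<close>

lemma collab_weight_props:
  fixes b :: "'n::finite \<Rightarrow> 'n \<Rightarrow> real" and i :: 'n and \<epsilon> :: real
  defines "n \<equiv> real (num_close \<epsilon> (\<lambda>p q. 2 * b p q) i)"
  assumes n: "1 \<le> n"
  shows "0 \<le> collab_weight \<epsilon> b i j" "(\<Sum>j\<in>UNIV. collab_weight \<epsilon> b i j) = 1"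
    "(\<Sum>j\<in>UNIV. (collab_weight \<epsilon> b i j)\<^sup>2) = 1 / n"
    "collab_weight \<epsilon> b i j \<noteq> 0 \<Longrightarrow> b i j \<le> \<epsilon> / 2" "n \<le> real CARD('n)"
proof -
  have n_sum: "n = (\<Sum>j\<in>UNIV. of_bool (b i j \<le> \<epsilon> / 2))"
    unfolding n_def num_close_def by (simp add: of_bool_def if_distrib field_simps cong: if_cong)
  have w: "collab_weight \<epsilon> b i j = of_bool (b i j \<le> \<epsilon> / 2) / n" for j
    by (simp add: collab_weight_def n_def)
  show "0 \<le> collab_weight \<epsilon> b i j" using n by (simp add: w)
  show "(\<Sum>j\<in>UNIV. collab_weight \<epsilon> b i j) = 1"
    unfolding w sum_divide_distrib[symmetric] n_sum[symmetric] using n by simp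
  have "(\<Sum>j\<in>UNIV. (collab_weight \<epsilon> b i j)\<^sup>2) = (\<Sum>j\<in>UNIV. of_bool (b i j \<le> \<epsilon> / 2) / n\<^sup>2)"
    by (intro sum.cong) (auto simp: w power_divide)
  also have "\<dots> = 1 / n"
    unfolding sum_divide_distrib[symmetric] n_sum[symmetric] using n by (simp add: power2_eq_square)
  finally show "(\<Sum>j\<in>UNIV. (collab_weight \<epsilon> b i j)\<^sup>2) = 1 / n" .
  show "b i j \<le> \<epsilon> / 2" if "collab_weight \<epsilon> b i j \<noteq> 0" using that by (auto simp: w split: if_splits)
  have "n \<le> (\<Sum>j\<in>(UNIV :: 'n set). 1)" unfolding n_sum by (intro sum_mono) auto
  then show "n \<le> real CARD('n)" by simp
qed

text \<open>Jensen's inequality for the squared norm, read off from the nonnegative weighted variance of the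
\<open>c - a j\<close>.\<close>

lemma weighted_mean_square_le:
  fixes a :: "'n::finite \<Rightarrow> 'a::euclidean_space"
  assumes w: "\<And>j. 0 \<le> w j" "(\<Sum>j\<in>UNIV. w j) = 1"
  shows "(norm (c - (\<Sum>j\<in>UNIV. w j *\<^sub>R a j)))\<^sup>2 \<le> (\<Sum>j\<in>UNIV. w j * (norm (c - a j))\<^sup>2)"
proof -
  define m where "m = c - (\<Sum>j\<in>UNIV. w j *\<^sub>R a j)"
  have m: "(\<Sum>j\<in>UNIV. w j *\<^sub>R (c - a j)) = m"
    by (simp add: m_def scaleR_diff_right sum_subtractf scaleR_left.sum[symmetric] w(2))
  have "0 \<le> (\<Sum>j\<in>UNIV. w j * (norm ((c - a j) - m))\<^sup>2)" by (intro sum_nonneg mult_nonneg_nonneg w) simp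
  also have "\<dots> = (\<Sum>j\<in>UNIV. w j * (norm (c - a j))\<^sup>2 - 2 * ((w j *\<^sub>R (c - a j)) \<bullet> m) + w j * (norm m)\<^sup>2)"
    by (intro sum.cong refl) (simp add: power2_norm_eq_inner inner_diff inner_commute algebra_simps)
  also have "\<dots> = (\<Sum>j\<in>UNIV. w j * (norm (c - a j))\<^sup>2) - 2 * ((\<Sum>j\<in>UNIV. w j *\<^sub>R (c - a j)) \<bullet> m)
      + (\<Sum>j\<in>UNIV. w j) * (norm m)\<^sup>2"
    by (simp add: sum.distrib sum_subtractf inner_sum_left sum_distrib_left sum_distrib_right del: inner_scaleR_left)
  also have "\<dots> = (\<Sum>j\<in>UNIV. w j * (norm (c - a j))\<^sup>2) - (norm m)\<^sup>2"
    unfolding m w(2) by (simp add: power2_norm_eq_inner)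
  finally show ?thesis by (simp add: m_def)
qed

theorem theorem2:
  fixes M :: "'w measure"
    and S :: "'n::finite \<Rightarrow> 's measure"
    and \<xi> :: "'n \<Rightarrow> nat \<Rightarrow> 'w \<Rightarrow> 's"
    and \<gamma> :: "'n \<Rightarrow> 's \<Rightarrow> 'a::euclidean_space \<Rightarrow> 'a"
    and f :: "'n \<Rightarrow> 'a \<Rightarrow> real"
    and xstar :: "'n \<Rightarrow> 'a"
    and b :: "'n \<Rightarrow> 'n \<Rightarrow> real"
    and g :: "'n \<Rightarrow> nat \<Rightarrow> 'a \<Rightarrow> 'w \<Rightarrow> 'a"
    and lam :: "'n \<Rightarrow> real"
    and x0 :: 'a and i :: 'n and \<epsilon> N Ni :: real
  assumes "prob_space M"
    and "iid_seeds M S \<xi>"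
    and "\<forall>j. (\<lambda>(s, x). \<gamma> j s x) \<in> borel_measurable (S j \<Otimes>\<^sub>M borel)"
    and "g = stoch_grad \<gamma> \<xi>"
    and "\<forall>j x. f j (xstar j) \<le> f j x"
    and "\<forall>j l. 0 \<le> b j l"
    and "0 < \<epsilon>"
    and "N = real CARD('n)"
    and "Ni = real (num_close \<epsilon> (\<lambda>j l. 2 * b j l) i)"
    and "1 \<le> Ni"
    and "lam = collab_weight \<epsilon> b i"
  shows
    "(\<forall>(B::real) (D::real) (I :: nat \<Rightarrow> 'w \<Rightarrow> 'n) (T::nat) (K::nat) (\<eta>::real) x.
        0 < B \<longrightarrow> 0 < D \<longrightarrow>
        uniform_agents M S \<xi> I \<longrightarrow>
        (\<forall>j. convex_on UNIV (f j)) \<longrightarrow>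
        (\<forall>j k x. integrable M (g j k x) \<and> (\<integral>\<omega>. g j k x \<omega> \<partial>M) \<in> subdifferential (f j) x) \<longrightarrow>
        (\<forall>j k x. mean_le M (\<lambda>\<omega>. (norm (g j k x \<omega>))\<^sup>2) (B\<^sup>2)) \<longrightarrow>
        (\<forall>j l k x. (norm ((\<integral>\<omega>. g j k x \<omega> \<partial>M) - (\<integral>\<omega>. g l k x \<omega> \<partial>M)))\<^sup>2 \<le> (b j l / D)\<^sup>2) \<longrightarrow>
        T = max 1 (nat \<lfloor>4 * D\<^sup>2 * B\<^sup>2 / \<epsilon>\<^sup>2 * (N / Ni)\<rfloor>) \<longrightarrow>
        K = T \<longrightarrow>
        \<eta> = sqrt (D\<^sup>2 / (2 * real K * N * B\<^sup>2 * (\<Sum>j\<in>UNIV. (lam j)\<^sup>2))) \<longrightarrow>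
        x = wga (async_oracle g I) lam \<eta> x0 \<longrightarrow>
        (AE \<omega> in M. \<forall>k j. norm (x k \<omega> - xstar j) \<le> D) \<longrightarrow>
          real T \<le> max 1 (4 * D\<^sup>2 * B\<^sup>2 / \<epsilon>\<^sup>2 * (N / Ni)) \<and>
          mean_le M (\<lambda>\<omega>. 1 / real K * (\<Sum>k<K. f i (x k \<omega>)) - f i (xstar i)) \<epsilon>)
     \<and>
     (\<forall>(\<mu>::real) (L::real) (\<sigma>::real) (\<kappa>::real) (F0::real).
        0 < \<mu> \<longrightarrow>
        (\<forall>j. strongly_convex \<mu> (f j) \<and> L_smooth L (f j)) \<longrightarrow>
        \<kappa> = L / \<mu> \<longrightarrow>
        (\<forall>j k x. integrable M (g j k x) \<and> (\<integral>\<omega>. g j k x \<omega> \<partial>M) = gradient (f j) x) \<longrightarrow>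
        (\<forall>j k x. mean_le M (\<lambda>\<omega>. (norm (g j k x \<omega> - gradient (f j) x))\<^sup>2) (\<sigma>\<^sup>2)) \<longrightarrow>
        ((\<forall>j l x. (norm (gradient (f j) x - gradient (f l) x))\<^sup>2 \<le> \<mu> * b j l) \<or>
         (\<exists>m\<ge>0. \<forall>j w x. stochastic_vector w \<longrightarrow>
            (norm (gradient (f j) x - (\<Sum>l\<in>UNIV. w l *\<^sub>R gradient (f l) x)))\<^sup>2
              \<le> m * (norm (\<Sum>l\<in>UNIV. w l *\<^sub>R gradient (f l) x))\<^sup>2
                + (\<Sum>l\<in>UNIV. w l * (\<mu> * b j l)))) \<longrightarrow>
        F0 = (\<Sum>j\<in>UNIV. lam j * (f j x0 - f j (xstar j))) \<longrightarrow>
        \<epsilon> \<le> F0 / \<kappa> \<longrightarrow> \<epsilon> \<le> \<sigma>\<^sup>2 / (\<mu> * Ni) \<longrightarrow>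
        (\<exists>(T::nat) (K::nat) (\<eta>::real) x.
          1 \<le> K \<and> T = CARD('n) * K \<and>
          real T \<le> 16 * (\<kappa> * \<sigma>\<^sup>2 / (\<mu> * \<epsilon>)) * (N / Ni) * (1 + ln (F0 / \<epsilon>)) \<and>
          \<eta> = min (1 / (2 * L))
                (1 / (\<mu> * real K) * ln (F0 * \<mu>\<^sup>2 * real K / (L * \<sigma>\<^sup>2 * (\<Sum>j\<in>UNIV. (lam j)\<^sup>2)))) \<and>
          x = wga (sync_oracle g) lam \<eta> x0 \<and>
          mean_le M (\<lambda>\<omega>. f i (x K \<omega>) - f i (xstar i)) \<epsilon>))"
proof -
  note P = assms(1) and iid = assms(2) and eps = assms(7) and Ni1 = assms(10)
  have \<gamma>: "(\<lambda>(s, x). \<gamma> j s x) \<in> borel_measurable (S j \<Otimes>\<^sub>M borel)" for j using assms(3) by blast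
  have min: "f j (xstar j) \<le> f j y" for j y using assms(5) by blast
  have w: "\<And>j. 0 \<le> lam j" "(\<Sum>j\<in>UNIV. lam j) = 1" "(\<Sum>j\<in>UNIV. (lam j)\<^sup>2) = 1 / Ni"
    "\<And>j. lam j \<noteq> 0 \<Longrightarrow> b i j \<le> \<epsilon> / 2" "Ni \<le> N"
    unfolding assms(8,11) assms(9)
    using collab_weight_props[OF Ni1[unfolded assms(9)]] by blast+
  have Ni: "0 < Ni" using Ni1 by simp
  show ?thesis
  proof (rule conjI; intro allI impI; (elim conjE)?)
    fix B D :: real and I :: "nat \<Rightarrow> 'w \<Rightarrow> 'n" and T K :: nat and \<eta> :: real and x
    assume B: "0 < B" and D: "0 < D" and unif: "uniform_agents M S \<xi> I"
      and conv: "\<forall>j. convex_on UNIV (f j)"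
      and sub: "\<forall>j k x. integrable M (g j k x) \<and> (\<integral>\<omega>. g j k x \<omega> \<partial>M) \<in> subdifferential (f j) x"
      and sq: "\<forall>j k x. mean_le M (\<lambda>\<omega>. (norm (g j k x \<omega>))\<^sup>2) (B\<^sup>2)"
      and close: "\<forall>j l k x. (norm ((\<integral>\<omega>. g j k x \<omega> \<partial>M) - (\<integral>\<omega>. g l k x \<omega> \<partial>M)))\<^sup>2 \<le> (b j l / D)\<^sup>2"
      and T: "T = max 1 (nat \<lfloor>4 * D\<^sup>2 * B\<^sup>2 / \<epsilon>\<^sup>2 * (N / Ni)\<rfloor>)" and K: "K = T"
      and \<eta>: "\<eta> = sqrt (D\<^sup>2 / (2 * real K * N * B\<^sup>2 * (\<Sum>j\<in>UNIV. (lam j)\<^sup>2)))"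
      and x: "x = wga (async_oracle g I) lam \<eta> x0"
      and bd: "AE \<omega> in M. \<forall>k j. norm (x k \<omega> - xstar j) \<le> D"
    define A where "A = 4 * D\<^sup>2 * B\<^sup>2 / \<epsilon>\<^sup>2 * (N / Ni)"
    have "0 \<le> A" using Ni w(5) by (simp add: A_def)
    then have "real T \<le> max 1 A" unfolding T A_def[symmetric] by linarith
    moreover have "mean_le M (\<lambda>\<omega>. 1 / real K * (\<Sum>k<K. f i (x k \<omega>)) - f i (xstar i)) \<epsilon>"
    proof (rule async_collaboration[where S = S and \<xi> = \<xi> and I = I and \<gamma> = \<gamma> and w = lam and B = B
          and V = "N * B\<^sup>2 / Ni" and D = D and \<eta> = \<eta> and x = x and f = f,
          OF P iid unif \<gamma> _ _ _ x[unfolded assms(4)] w(1,2) _ B D eps])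
      show "convex_on UNIV (f j)" for j using conv by blast
      show "integrable M (stoch_grad \<gamma> \<xi> j k y) \<and> (\<integral>\<omega>. stoch_grad \<gamma> \<xi> j k y \<omega> \<partial>M) \<in> subdifferential (f j) y" for j k y
        using sub unfolding assms(4) by blast
      show "mean_le M (\<lambda>\<omega>. (norm (stoch_grad \<gamma> \<xi> j k y \<omega>))\<^sup>2) (B\<^sup>2)" for j k y
        using sq unfolding assms(4) by blast
      show "norm ((\<integral>\<omega>. stoch_grad \<gamma> \<xi> i k y \<omega> \<partial>M) - (\<integral>\<omega>. stoch_grad \<gamma> \<xi> j k y \<omega> \<partial>M)) \<le> \<epsilon> / (2 * D)"
        if "lam j \<noteq> 0" for j k y
      proof -
        have "norm ((\<integral>\<omega>. stoch_grad \<gamma> \<xi> i k y \<omega> \<partial>M) - (\<integral>\<omega>. stoch_grad \<gamma> \<xi> j k y \<omega> \<partial>M)) \<le> b i j / D"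
          by (rule power2_le_imp_le) (use close assms(6) D in \<open>auto simp: assms(4)\<close>)
        also have "\<dots> \<le> \<epsilon> / 2 / D" using w(4)[OF that] D by (intro divide_right_mono) auto
        finally show ?thesis by simp
      qed
      show "N * B\<^sup>2 / Ni = real CARD('n) * B\<^sup>2 * (\<Sum>j\<in>UNIV. (lam j)\<^sup>2)" by (simp add: w(3) assms(8))
      show "B\<^sup>2 \<le> N * B\<^sup>2 / Ni" using Ni w(5) by (simp add: pos_le_divide_eq mult.commute mult_right_mono)
      show "K = max 1 (nat \<lfloor>4 * D\<^sup>2 * (N * B\<^sup>2 / Ni) / \<epsilon>\<^sup>2\<rfloor>)" unfolding K T by (simp add: ac_simps)
      show "\<eta> = sqrt (D\<^sup>2 / (2 * real K * (N * B\<^sup>2 / Ni)))" unfolding \<eta> w(3) by simp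
      show "AE \<omega> in M. \<forall>k. norm (x k \<omega> - xstar i) \<le> D" using bd by eventually_elim blast
    qed
    ultimately show "real T \<le> max 1 (4 * D\<^sup>2 * B\<^sup>2 / \<epsilon>\<^sup>2 * (N / Ni)) \<and>
        mean_le M (\<lambda>\<omega>. 1 / real K * (\<Sum>k<K. f i (x k \<omega>)) - f i (xstar i)) \<epsilon>"
      unfolding A_def by blast
  next
    fix \<mu> L \<sigma> \<kappa> F0 :: real
    assume \<mu>: "0 < \<mu>" and reg: "\<forall>j. strongly_convex \<mu> (f j) \<and> L_smooth L (f j)" and \<kappa>: "\<kappa> = L / \<mu>"
      and mean: "\<forall>j k x. integrable M (g j k x) \<and> (\<integral>\<omega>. g j k x \<omega> \<partial>M) = gradient (f j) x"
      and var: "\<forall>j k x. mean_le M (\<lambda>\<omega>. (norm (g j k x \<omega> - gradient (f j) x))\<^sup>2) (\<sigma>\<^sup>2)"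
      and close: "(\<forall>j l x. (norm (gradient (f j) x - gradient (f l) x))\<^sup>2 \<le> \<mu> * b j l) \<or>
         (\<exists>m\<ge>0. \<forall>j w x. stochastic_vector w \<longrightarrow>
            (norm (gradient (f j) x - (\<Sum>l\<in>UNIV. w l *\<^sub>R gradient (f l) x)))\<^sup>2
              \<le> m * (norm (\<Sum>l\<in>UNIV. w l *\<^sub>R gradient (f l) x))\<^sup>2
                + (\<Sum>l\<in>UNIV. w l * (\<mu> * b j l)))"
      and F0: "F0 = (\<Sum>j\<in>UNIV. lam j * (f j x0 - f j (xstar j)))"
      and e1: "\<epsilon> \<le> F0 / \<kappa>" and e2: "\<epsilon> \<le> \<sigma>\<^sup>2 / (\<mu> * Ni)"
    have sc: "strongly_convex \<mu> (f j)" and sm: "L_smooth L (f j)" for j using reg by auto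
    have \<mu>L: "\<mu> \<le> L" by (rule convexity_le_smoothness[OF sc sm])
    define s where "s = \<sigma>\<^sup>2 / Ni"
    have s: "s = \<sigma>\<^sup>2 * (\<Sum>j\<in>UNIV. (lam j)\<^sup>2)" by (simp add: s_def w(3))
    have e2': "\<epsilon> \<le> s / \<mu>" using e2 by (simp add: s_def mult.commute)
    have s0: "0 < s" using eps e2' \<mu> by (smt (verit) divide_nonpos_pos)
    have e1': "\<epsilon> \<le> F0 / (L / \<mu>)" using e1 by (simp add: \<kappa>)
    define K where "K = nat \<lfloor>16 * (L * s / (\<mu>\<^sup>2 * \<epsilon>)) * (1 + ln (F0 / \<epsilon>))\<rfloor>"
    define \<eta> where "\<eta> = min (1 / (2 * L)) (1 / (\<mu> * real K) * ln (F0 * \<mu>\<^sup>2 * real K / (L * s)))"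
    define x where "x = wga (sync_oracle g) lam \<eta> x0"
    note budget = sync_budget_arithmetic(1,2)[OF \<mu> \<mu>L s0 eps e1' e2', folded K_def]
    have mixed: "(\<Sum>l\<in>UNIV. lam l * (\<mu> * b i l)) \<le> \<mu> * \<epsilon> / 2"
    proof -
      have "lam l * (\<mu> * b i l) \<le> lam l * (\<mu> * (\<epsilon> / 2))" for l
        using w(1)[of l] w(4)[of l] \<mu> by (cases "lam l = 0") (auto intro!: mult_left_mono)
      then have "(\<Sum>l\<in>UNIV. lam l * (\<mu> * b i l)) \<le> (\<Sum>l\<in>UNIV. lam l * (\<mu> * (\<epsilon> / 2)))" by (rule sum_mono)
      then show ?thesis unfolding sum_distrib_right[symmetric] w(2) by simp
    qed
    \<comment> \<open>Both closeness conditions enter only at a zero of the weighted gradient.\<close>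
    have stationary: "(norm (gradient (f i) z))\<^sup>2 \<le> \<mu> * \<epsilon> / 2"
      if z: "(\<Sum>j\<in>UNIV. lam j *\<^sub>R gradient (f j) z) = 0" for z
      using close
    proof
      assume c: "\<forall>j l x. (norm (gradient (f j) x - gradient (f l) x))\<^sup>2 \<le> \<mu> * b j l"
      have "(norm (gradient (f i) z))\<^sup>2 \<le> (\<Sum>j\<in>UNIV. lam j * (norm (gradient (f i) z - gradient (f j) z))\<^sup>2)"
        using weighted_mean_square_le[OF w(1,2), of "gradient (f i) z" "\<lambda>j. gradient (f j) z"] z by simp
      also have "\<dots> \<le> (\<Sum>l\<in>UNIV. lam l * (\<mu> * b i l))" using c by (intro sum_mono mult_left_mono w) blast
      finally show ?thesis using mixed by linarith
    next
      assume "\<exists>m\<ge>0. \<forall>j w x. stochastic_vector w \<longrightarrow>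
            (norm (gradient (f j) x - (\<Sum>l\<in>UNIV. w l *\<^sub>R gradient (f l) x)))\<^sup>2
              \<le> m * (norm (\<Sum>l\<in>UNIV. w l *\<^sub>R gradient (f l) x))\<^sup>2
                + (\<Sum>l\<in>UNIV. w l * (\<mu> * b j l))"
      then obtain m where m: "\<And>j w x. stochastic_vector w \<Longrightarrow>
            (norm (gradient (f j) x - (\<Sum>l\<in>UNIV. w l *\<^sub>R gradient (f l) x)))\<^sup>2
              \<le> m * (norm (\<Sum>l\<in>UNIV. w l *\<^sub>R gradient (f l) x))\<^sup>2
                + (\<Sum>l\<in>UNIV. w l * (\<mu> * b j l))" by blast
      have "stochastic_vector lam" using w(1,2) by (simp add: stochastic_vector_def)
      from m[OF this, of i z] show ?thesis using mixed unfolding z by simp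
    qed
    have "mean_le M (\<lambda>\<omega>. f i (x K \<omega>) - f i (xstar i)) \<epsilon>"
      by (rule sync_collaboration[where f = f and w = lam and xstar = xstar and v = "\<sigma>\<^sup>2",
            OF P iid \<gamma> \<mu> sc sm _ _ min w(1,2) stationary F0 s s0 eps e1' e2' K_def \<eta>_def x_def[unfolded assms(4)]])
        (use mean var in \<open>auto simp: assms(4)\<close>)
    moreover have "real (CARD('n) * K) \<le> 16 * (\<kappa> * \<sigma>\<^sup>2 / (\<mu> * \<epsilon>)) * (N / Ni) * (1 + ln (F0 / \<epsilon>))"
    proof -
      have "real (CARD('n) * K) \<le> N * (16 * (L * s / (\<mu>\<^sup>2 * \<epsilon>)) * (1 + ln (F0 / \<epsilon>)))"
        using mult_left_mono[OF budget(2), of N] by (simp add: assms(8))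
      also have "\<dots> = 16 * (\<kappa> * \<sigma>\<^sup>2 / (\<mu> * \<epsilon>)) * (N / Ni) * (1 + ln (F0 / \<epsilon>))"
        by (simp add: \<kappa> s_def power2_eq_square ac_simps)
      finally show ?thesis .
    qed
    moreover have "\<eta> = min (1 / (2 * L))
        (1 / (\<mu> * real K) * ln (F0 * \<mu>\<^sup>2 * real K / (L * \<sigma>\<^sup>2 * (\<Sum>j\<in>UNIV. (lam j)\<^sup>2))))"
      unfolding \<eta>_def s by (simp add: mult.assoc)
    ultimately show "\<exists>(T::nat) (K::nat) (\<eta>::real) x.
          1 \<le> K \<and> T = CARD('n) * K \<and>
          real T \<le> 16 * (\<kappa> * \<sigma>\<^sup>2 / (\<mu> * \<epsilon>)) * (N / Ni) * (1 + ln (F0 / \<epsilon>)) \<and>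
          \<eta> = min (1 / (2 * L))
                (1 / (\<mu> * real K) * ln (F0 * \<mu>\<^sup>2 * real K / (L * \<sigma>\<^sup>2 * (\<Sum>j\<in>UNIV. (lam j)\<^sup>2)))) \<and>
          x = wga (sync_oracle g) lam \<eta> x0 \<and>
          mean_le M (\<lambda>\<omega>. f i (x K \<omega>) - f i (xstar i)) \<epsilon>"
      using budget(1) x_def by blast
  qed
qed

end
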